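(* (a) Assume $n\geq 3$. Given $n>d$ doubly transitive lines that span $\mathbb{C}^d$, there exists $r$ such that one may select $r$ equal-norm representatives from each of the $n$ lines whose Gram matrix carries the association scheme of a Higman pair $(G,H)$ with $r=[N_G(H):H]$ and $n=[G:N_G(H)]$. Moreover, their Gram matrix is a primitive idempotent for this scheme. (b) Every Higman pair $(G,H)$ is a Gelfand pair. Every primitive idempotent of its association scheme is the Gram matrix of $r=[N_G(H):H]$ equal-norm representatives from each of $n=[G:N_G(H)]$ doubly transitive lines that span $\mathbb{C}^d$ with $d<n$, and the phase of each entry is an $r$th root of unity. Moreover, the automorphism group of the lines contains the doubly transitive action of $G$ on $G/N_G(H)$.
   Context: Given a finite group $G$ and a proper subgroup $H\le G$, let $K=N_G(H)$ be the normalizer of $H$ in $G$. The pair $(G,H)$ is a Higman pair if there exists a key $b\in G\setminus K$ such that: (H1) $G$ acts doubly transitively on $G/K$; (H2) $K/H$ is abelian; (H3) $HbH=Hb^{-1}H$; (H4) $aba^{-1}\in HbH$ for every $a\in K$; (H5) $a\in K$ satisfies $ab\in HbH$ only if $a\in H$. For each double coset $HaH$ let $A_{HaH}\in\{0,1\}^{G/H\times G/H}$ be the matrix with $(A_{HaH})_{xH,yH}=1$ if $y^{-1}x\in HaH$ and $0$ otherwise. These are the adjacency matrices of the (Schurian) association scheme of $(G,H)$, and $\mathscr{A}(G,H)$ is their complex span, a $*$-algebra under matrix multiplication. $(G,H)$ is a Gelfand pair if $\mathscr{A}(G,H)$ is commutative. In that case the primitive idempotents of the scheme are the minimal nonzero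 orthogonal projections in $\mathscr{A}(G,H)$. A matrix $M$ carries an association scheme with adjacency matrices $\{A_i\}_{i\in[k]}$ if $M=\sum_{i\in[k]}c_iA_i$ with $\{c_i\}_{i\in[k]}$ distinct. The Gram matrix of $\{v_i\}$ is $(\langle v_j,v_i\rangle)_{ij}$. The lines considered are lines through the origin of $\mathbb{C}^d$. An automorphism of a sequence of lines $\{\ell_i\}_{i\in X}$ in $\mathbb{C}^d$ is a permutation $\sigma$ of $X$ for which there is a unitary $Q\in\mathrm{U}(d)$ with $Q\ell_i=\ell_{\sigma(i)}$ for all $i\in X$. The lines are doubly transitive if their group of automorphisms acts doubly transitively on $X$. The span of a sequence of lines is the smallest subspace containing them.
   Formalization: In (a) the n lines are taken distinct (the claim fails if all coincide, d=1). In (b) the phases are rth roots of unity only up to one common sign ±1 on entries between different lines (for odd r the literal claim fails, e.g. I−J/3 for S_3). *)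

theory Defs
  imports
    "HOL-Algebra.Group_Action"
    "HOL-Algebra.Left_Coset"
    "Jordan_Normal_Form.VS_Connect"
    "Jordan_Normal_Form.Schur_Decomposition"
begin

section \<open>Higman pairs\<close>

text \<open>The condition on pairs of distinct points implies transitivity as soon as the set has at
  least two points.\<close>

definition doubly_transitive_action ::
    "('g, 'm) monoid_scheme \<Rightarrow> 'x set \<Rightarrow> ('g \<Rightarrow> 'x \<Rightarrow> 'x) \<Rightarrow> bool" where
  "doubly_transitive_action G X \<phi> \<longleftrightarrow>
     group_action G X \<phi> \<and>
     (\<forall>x\<in>X. \<forall>y\<in>X. \<forall>x'\<in>X. \<forall>y'\<in>X. x \<noteq> y \<longrightarrow> x' \<noteq> y' \<longrightarrow>
        (\<exists>g\<in>carrier G. \<phi> g x = x' \<and> \<phi> g y = y'))"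

text \<open>The action of \<open>G\<close> on \<open>G/K\<close>; permutations are extensional functions, as in
  \<^const>\<open>Bij\<close>.\<close>

definition coset_action ::
    "('g, 'm) monoid_scheme \<Rightarrow> 'g set \<Rightarrow> 'g \<Rightarrow> 'g set \<Rightarrow> 'g set" where
  "coset_action G K g = (\<lambda>C\<in>lcosets\<^bsub>G\<^esub> K. g <#\<^bsub>G\<^esub> C)"

definition subgroup_index ::
    "('g, 'm) monoid_scheme \<Rightarrow> 'g set \<Rightarrow> 'g set \<Rightarrow> nat" where
  "subgroup_index G K H = card (lcosets\<^bsub>G\<lparr>carrier := K\<rparr>\<^esub> H)"

definition double_coset :: "('g, 'm) monoid_scheme \<Rightarrow> 'g set \<Rightarrow> 'g \<Rightarrow> 'g set" where
  "double_coset G H a = (H #>\<^bsub>G\<^esub> a) <#>\<^bsub>G\<^esub> H"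

definition double_cosets :: "('g, 'm) monoid_scheme \<Rightarrow> 'g set \<Rightarrow> 'g set set" where
  "double_cosets G H = double_coset G H ` carrier G"

definition higman_key :: "('g, 'm) monoid_scheme \<Rightarrow> 'g set \<Rightarrow> 'g \<Rightarrow> bool" where
  "higman_key G H b \<longleftrightarrow>
     (let K = normalizer G H in
        b \<in> carrier G - K \<and>
        doubly_transitive_action G (lcosets\<^bsub>G\<^esub> K) (coset_action G K) \<and>
        comm_group (G\<lparr>carrier := K\<rparr> Mod H) \<and>
        double_coset G H b = double_coset G H (inv\<^bsub>G\<^esub> b) \<and>
        (\<forall>a\<in>K. a \<otimes>\<^bsub>G\<^esub> b \<otimes>\<^bsub>G\<^esub> inv\<^bsub>G\<^esub> a \<in> double_coset G H b) \<and>
        (\<forall>a\<in>K. a \<otimes>\<^bsub>G\<^esub> b \<in> double_coset G H b \<longrightarrow> a \<in> H))"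

definition higman_pair :: "('g, 'm) monoid_scheme \<Rightarrow> 'g set \<Rightarrow> bool" where
  "higman_pair G H \<longleftrightarrow>
     group G \<and> finite (carrier G) \<and> subgroup H G \<and> H \<noteq> carrier G \<and> (\<exists>b. higman_key G H b)"


section \<open>The association scheme of a pair\<close>

text \<open>A complex matrix with rows and columns indexed by a finite set \<open>I\<close> is a function
  \<open>M i j\<close> that vanishes unless \<open>i\<close> and \<open>j\<close> are in \<open>I\<close>, so
  equality of functions is equality of matrices.\<close>

type_synonym 'i cmatrix = "'i \<Rightarrow> 'i \<Rightarrow> complex"

definition mtimes :: "'i set \<Rightarrow> 'i cmatrix \<Rightarrow> 'i cmatrix \<Rightarrow> 'i cmatrix" where
  "mtimes I M N = (\<lambda>i j. \<Sum>k\<in>I. M i k * N k j)"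

definition madjoint :: "'i cmatrix \<Rightarrow> 'i cmatrix" where
  "madjoint M = (\<lambda>i j. cnj (M j i))"

text \<open>For a double coset \<open>D\<close> of \<open>H\<close>, whether \<open>inv y \<otimes> x\<close>
  lies in \<open>D\<close> depends only on the cosets \<open>xH\<close> and \<open>yH\<close>.\<close>

definition adjacency ::
    "('g, 'm) monoid_scheme \<Rightarrow> 'g set \<Rightarrow> 'g set \<Rightarrow> 'g set cmatrix" where
  "adjacency G H D = (\<lambda>X Y.
     if X \<in> lcosets\<^bsub>G\<^esub> H \<and> Y \<in> lcosets\<^bsub>G\<^esub> H \<and>
        (\<exists>x\<in>X. \<exists>y\<in>Y. inv\<^bsub>G\<^esub> y \<otimes>\<^bsub>G\<^esub> x \<in> D)
     then 1 else 0)"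

definition scheme_combination ::
    "('g, 'm) monoid_scheme \<Rightarrow> 'g set \<Rightarrow> ('g set \<Rightarrow> complex) \<Rightarrow> 'g set cmatrix" where
  "scheme_combination G H c = (\<lambda>X Y. \<Sum>D\<in>double_cosets G H. c D * adjacency G H D X Y)"

definition scheme_algebra :: "('g, 'm) monoid_scheme \<Rightarrow> 'g set \<Rightarrow> 'g set cmatrix set" where
  "scheme_algebra G H = range (scheme_combination G H)"

definition carries_scheme ::
    "('g, 'm) monoid_scheme \<Rightarrow> 'g set \<Rightarrow> 'g set cmatrix \<Rightarrow> bool" where
  "carries_scheme G H M \<longleftrightarrow>
     (\<exists>c. inj_on c (double_cosets G H) \<and> M = scheme_combination G H c)"

definition gelfand_pair :: "('g, 'm) monoid_scheme \<Rightarrow> 'g set \<Rightarrow> bool" where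
  "gelfand_pair G H \<longleftrightarrow>
     group G \<and> finite (carrier G) \<and> subgroup H G \<and>
     (\<forall>M\<in>scheme_algebra G H. \<forall>N\<in>scheme_algebra G H.
        mtimes (lcosets\<^bsub>G\<^esub> H) M N = mtimes (lcosets\<^bsub>G\<^esub> H) N M)"

definition scheme_projection ::
    "('g, 'm) monoid_scheme \<Rightarrow> 'g set \<Rightarrow> 'g set cmatrix \<Rightarrow> bool" where
  "scheme_projection G H P \<longleftrightarrow>
     P \<in> scheme_algebra G H \<and> mtimes (lcosets\<^bsub>G\<^esub> H) P P = P \<and> madjoint P = P"

text \<open>Minimality refers to the usual order on orthogonal projections: \<open>P \<le> E\<close> iff the
  range of \<open>P\<close> is contained in that of \<open>E\<close>, that is, \<open>E P = P\<close>.\<close>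

definition primitive_idempotent ::
    "('g, 'm) monoid_scheme \<Rightarrow> 'g set \<Rightarrow> 'g set cmatrix \<Rightarrow> bool" where
  "primitive_idempotent G H E \<longleftrightarrow>
     scheme_projection G H E \<and> E \<noteq> (\<lambda>X Y. 0) \<and>
     (\<forall>P. scheme_projection G H P \<and> P \<noteq> (\<lambda>X Y. 0) \<and> mtimes (lcosets\<^bsub>G\<^esub> H) E P = P
        \<longrightarrow> P = E)"


section \<open>Sequences of lines\<close>

definition is_line :: "nat \<Rightarrow> complex vec set \<Rightarrow> bool" where
  "is_line d S \<longleftrightarrow>
     (\<exists>v\<in>carrier_vec d. v \<noteq> 0\<^sub>v d \<and> S = {c \<cdot>\<^sub>v v | c. True})"

definition unitary_mat :: "nat \<Rightarrow> complex mat \<Rightarrow> bool" where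
  "unitary_mat d Q \<longleftrightarrow> Q \<in> carrier_mat d d \<and> mat_adjoint Q * Q = 1\<^sub>m d"

definition line_automorphisms ::
    "nat \<Rightarrow> 'x set \<Rightarrow> ('x \<Rightarrow> complex vec set) \<Rightarrow> ('x \<Rightarrow> 'x) set" where
  "line_automorphisms d X L =
     {\<sigma> \<in> Bij X. \<exists>Q. unitary_mat d Q \<and> (\<forall>i\<in>X. (\<lambda>v. Q *\<^sub>v v) ` L i = L (\<sigma> i))}"

text \<open>A sequence of lines may have repetitions: distinctness is not part of this notion.\<close>

definition doubly_transitive_lines ::
    "nat \<Rightarrow> 'x set \<Rightarrow> ('x \<Rightarrow> complex vec set) \<Rightarrow> bool" where
  "doubly_transitive_lines d X L \<longleftrightarrow>
     (\<forall>i\<in>X. is_line d (L i)) \<and>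
     doubly_transitive_action (BijGroup X\<lparr>carrier := line_automorphisms d X L\<rparr>) X (\<lambda>\<sigma>. \<sigma>)"

definition lines_span_space ::
    "nat \<Rightarrow> 'x set \<Rightarrow> ('x \<Rightarrow> complex vec set) \<Rightarrow> bool" where
  "lines_span_space d X L \<longleftrightarrow>
     LinearCombinations.module.span class_ring (module_vec TYPE(complex) d) (\<Union>i\<in>X. L i)
       = carrier_vec d"

text \<open>The family \<open>v\<close>, indexed by \<open>I\<close>, consists of \<open>r\<close> representatives of
  each line; \<open>\<pi> x\<close> is the index of the line that \<open>v x\<close> represents.\<close>

definition equal_norm_representatives ::
    "'x set \<Rightarrow> ('x \<Rightarrow> complex vec set) \<Rightarrow> nat \<Rightarrow> nat \<Rightarrow> 'i set \<Rightarrow> ('i \<Rightarrow> 'x) \<Rightarrow> ('i \<Rightarrow> complex vec) \<Rightarrow> bool"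
  where
  "equal_norm_representatives X L d r I \<pi> v \<longleftrightarrow>
     \<pi> \<in> I \<rightarrow> X \<and>
     (\<forall>i\<in>X. card {x \<in> I. \<pi> x = i} = r) \<and>
     (\<forall>x\<in>I. v x \<in> L (\<pi> x) \<and> v x \<noteq> 0\<^sub>v d) \<and>
     (\<forall>x\<in>I. \<forall>y\<in>I. v x \<bullet>c v x = v y \<bullet>c v y)"

text \<open>The inner product \<open>\<bullet>c\<close> is conjugate-linear in its second argument.\<close>

definition gram_matrix :: "'i set \<Rightarrow> ('i \<Rightarrow> complex vec) \<Rightarrow> 'i cmatrix" where
  "gram_matrix I v = (\<lambda>i j. if i \<in> I \<and> j \<in> I then v j \<bullet>c v i else 0)"

end

theory Submission
  imports
    Defs
    "HOL-Algebra.Zassenhaus"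
    "HOL-Algebra.Multiplicative_Group"
begin

text \<open>
  Let \<open>K\<close> be the normalizer of \<open>H\<close>. Double transitivity and the key give \<open>G = K \<union> H b K\<close>, and the
  scheme algebra consists of the \<open>G\<close>-invariant matrices on \<open>G/H\<close>. Conjugation by \<open>K\<close> preserves
  every double coset of \<open>H\<close>, so right translations by \<open>K\<close> commute with the algebra, which they
  generate together with the adjacency matrix of \<open>H b H\<close>: the algebra is commutative. Since \<open>K/H\<close>
  has finite exponent, a minimal projection \<open>E\<close> is an eigenvector of right translation by every
  \<open>k \<in> K\<close>, with an eigenvalue \<open>\<psi> k\<close> that is a root of unity. An invariant matrix with eigenvalues
  \<open>\<psi>\<close> is determined by its entries at \<open>1\<close> and \<open>b\<close>; these are real for a Hermitian matrix because
  \<open>inv b \<in> H b H\<close>. Writing \<open>E = V\<^sup>* V\<close> with \<open>V V\<^sup>* = 1\<close> yields the lines, and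
  \<open>E E = E\<close> together with the nonvanishing of the entry at \<open>b\<close> bounds the trace of \<open>E\<close> by \<open>n\<close>.

  Conversely, given the lines, the unitary matrices of determinant \<open>1\<close> that permute them form a
  finite group, which we extend by sufficiently many scalars. In this group \<open>G\<close> the stabilizer \<open>S\<close>
  of a line acts on a representative \<open>u\<close> through a character \<open>\<chi>\<close> all of whose values are scalars
  in \<open>G\<close>; take \<open>H\<close> to be its kernel, and as key an element for which \<open>\<langle>b u, u\<rangle>\<close> is real. As
  \<open>d < n\<close>, the Gram matrix \<open>M\<close> of the orbit of \<open>u\<close> annihilates a nonzero vector with at most one
  nonzero coordinate in each coset of \<open>S\<close>. An equivariant matrix whose entry at \<open>b\<close> is zero cannot annihilate
  such a vector unless it is zero; applied to \<open>M M - s M\<close> and to \<open>P - t M\<close> this shows that \<open>M\<close> is a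
  multiple of a minimal projection.
\<close>

section \<open>Cosets and double cosets of a Higman pair\<close>

text \<open>The sign in the claim about phases cannot be removed: if \<open>H\<close> is its own
  normalizer, then \<open>r = 1\<close>, the algebra is spanned by the identity and the all-ones
  matrix \<open>J\<close>, and the minimal projection \<open>1 - J / n\<close> has negative entries
  off the diagonal. In general such phases are \<open>r\<close>th roots of unity times the sign of
  one real number, the entry at the key. No spectral theorem for the scheme is used. The joint
  eigenspaces of the right translations have dimension at most two, so a smaller projection is
  produced by solving a quadratic equation and excluded by solving a linear one. In the converse,
  determinant \<open>1\<close> makes the group finite because it bounds the scalars, but it also
  removes scalars that the construction needs. Those put back are the roots of unity of exponent
  \<open>2 * m\<close>: \<open>m\<close> serves the eigenvalues of the stabilizer at
  \<open>u\<close>, and the factor \<open>2\<close> allows the key to be rotated until its inner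
  product is real. A third line is needed to see that the normalizer of \<open>H\<close> is no
  larger than \<open>S\<close>, and distinct lines for a matrix to determine its
  permutation.\<close>

lemma doubly_transitive_actionD:
  assumes "doubly_transitive_action G X \<phi>" "x \<in> X" "y \<in> X" "x' \<in> X" "y' \<in> X" "x \<noteq> y" "x' \<noteq> y'"
  obtains g where "g \<in> carrier G" "\<phi> g x = x'" "\<phi> g y = y'"
  using assms unfolding doubly_transitive_action_def by metis

context group
begin

lemma inv_cancel_left:
  assumes "a \<in> carrier G" "x \<in> carrier G"
  shows "a \<otimes> (inv a \<otimes> x) = x" "inv a \<otimes> (a \<otimes> x) = x"
  using assms by (simp_all add: m_assoc[symmetric])

lemma l_coset_eq_iff:
  assumes "subgroup H G" "x \<in> carrier G" "y \<in> carrier G"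
  shows "x <# H = y <# H \<longleftrightarrow> inv y \<otimes> x \<in> H"
proof
  assume "x <# H = y <# H"
  then have "x \<in> y <# H" using lcos_self[OF assms(2,1)] by simp
  then show "inv y \<otimes> x \<in> H"
    using subgroup.lcos_module_imp[OF assms(1) is_group assms(3)] by simp
next
  assume "inv y \<otimes> x \<in> H"
  then have "x \<in> y <# H"
    using subgroup.lcos_module_rev[OF assms(1) is_group assms(3,2)] by simp
  then show "x <# H = y <# H"
    using l_repr_independence[OF _ assms(3) assms(1)] by simp
qed

lemma mem_double_coset:
  assumes "subgroup H G" "a \<in> carrier G"
  shows "x \<in> double_coset G H a \<longleftrightarrow> (\<exists>h\<in>H. \<exists>h'\<in>H. x = h \<otimes> a \<otimes> h')"
  unfolding double_coset_def set_mult_def r_coset_def by auto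

text \<open>Asking for both conjugations, by \<open>a\<close> and by \<open>inv a\<close>, turns the
  equality of sets behind the stabilizer into a closure condition from which each inclusion can be
  read off.\<close>

lemma mem_normalizer_iff:
  assumes "subgroup H G"
  shows "a \<in> normalizer G H \<longleftrightarrow> a \<in> carrier G \<and> (\<forall>h\<in>H. a \<otimes> h \<otimes> inv a \<in> H \<and> inv a \<otimes> h \<otimes> a \<in> H)"
proof -
  have HG: "H \<subseteq> carrier G" using assms subgroup.subset by auto
  have "a \<in> normalizer G H \<longleftrightarrow> a \<in> carrier G \<and> a <# H #> inv a = H"
    using HG unfolding normalizer_def stabilizer_def by auto
  also have "\<dots> \<longleftrightarrow> a \<in> carrier G \<and> (\<forall>h\<in>H. a \<otimes> h \<otimes> inv a \<in> H \<and> inv a \<otimes> h \<otimes> a \<in> H)"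
  proof (cases "a \<in> carrier G")
    case True
    have eq: "a <# H #> inv a = (\<lambda>h. a \<otimes> h \<otimes> inv a) ` H"
      unfolding l_coset_def r_coset_def by auto
    have i1: "a \<otimes> (inv a \<otimes> h \<otimes> a) \<otimes> inv a = h" if "h \<in> carrier G" for h
      using that True by (simp add: m_assoc inv_cancel_left)
    have i2: "inv a \<otimes> (a \<otimes> h \<otimes> inv a) \<otimes> a = h" if "h \<in> carrier G" for h
      using that True by (simp add: m_assoc inv_cancel_left)
    have "(\<lambda>h. a \<otimes> h \<otimes> inv a) ` H = H \<longleftrightarrow> (\<forall>h\<in>H. a \<otimes> h \<otimes> inv a \<in> H \<and> inv a \<otimes> h \<otimes> a \<in> H)"
    proof
      assume im: "(\<lambda>h. a \<otimes> h \<otimes> inv a) ` H = H"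
      show "\<forall>h\<in>H. a \<otimes> h \<otimes> inv a \<in> H \<and> inv a \<otimes> h \<otimes> a \<in> H"
      proof
        fix h assume h: "h \<in> H"
        then obtain h' where "h' \<in> H" "h = a \<otimes> h' \<otimes> inv a" using im by blast
        then show "a \<otimes> h \<otimes> inv a \<in> H \<and> inv a \<otimes> h \<otimes> a \<in> H"
          using i2[of h'] HG im h by auto
      qed
    next
      assume al: "\<forall>h\<in>H. a \<otimes> h \<otimes> inv a \<in> H \<and> inv a \<otimes> h \<otimes> a \<in> H"
      show "(\<lambda>h. a \<otimes> h \<otimes> inv a) ` H = H"
      proof
        show "(\<lambda>h. a \<otimes> h \<otimes> inv a) ` H \<subseteq> H" using al by auto
        show "H \<subseteq> (\<lambda>h. a \<otimes> h \<otimes> inv a) ` H"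
        proof
          fix h assume h: "h \<in> H"
          then have "h = a \<otimes> (inv a \<otimes> h \<otimes> a) \<otimes> inv a" using i1 HG by auto
          then show "h \<in> (\<lambda>h. a \<otimes> h \<otimes> inv a) ` H" using al h by blast
        qed
      qed
    qed
    then show ?thesis using eq by simp
  qed simp
  finally show ?thesis .
qed

end

section \<open>Left and right translations of the cosets of a subgroup\<close>

locale finite_pair = group G for G (structure) +
  fixes H :: "'a set"
  assumes finite_carrier: "finite (carrier G)"
    and H_subgroup: "subgroup H G"
begin

definition "K = normalizer G H"

abbreviation "\<I> \<equiv> lcosets\<^bsub>G\<^esub> H"

lemma H_carrier: "h \<in> H \<Longrightarrow> h \<in> carrier G"
  using H_subgroup subgroup.mem_carrier by metis

lemma K_subgroup: "subgroup K G"
  unfolding K_def using normalizer_imp_subgroup H_subgroup subgroup.subset by auto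

lemma K_carrier: "a \<in> K \<Longrightarrow> a \<in> carrier G"
  using K_subgroup subgroup.mem_carrier by metis

lemma K_mult: "a \<in> K \<Longrightarrow> a' \<in> K \<Longrightarrow> a \<otimes> a' \<in> K"
  using K_subgroup subgroup.m_closed by metis

lemma K_inv: "a \<in> K \<Longrightarrow> inv a \<in> K"
  using K_subgroup subgroup.m_inv_closed by metis

lemma H_mult: "a \<in> H \<Longrightarrow> a' \<in> H \<Longrightarrow> a \<otimes> a' \<in> H"
  using H_subgroup subgroup.m_closed by metis

lemma H_inv: "a \<in> H \<Longrightarrow> inv a \<in> H"
  using H_subgroup subgroup.m_inv_closed by metis

lemma H_one: "\<one> \<in> H"
  using H_subgroup subgroup.one_closed by metis

lemma mem_K_iff:
  "a \<in> K \<longleftrightarrow> a \<in> carrier G \<and> (\<forall>h\<in>H. a \<otimes> h \<otimes> inv a \<in> H \<and> inv a \<otimes> h \<otimes> a \<in> H)"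
  unfolding K_def using mem_normalizer_iff[OF H_subgroup] .

lemma H_K: "h \<in> H \<Longrightarrow> h \<in> K"
  by (simp add: mem_K_iff H_carrier H_mult H_inv)

lemma K_conj: "a \<in> K \<Longrightarrow> h \<in> H \<Longrightarrow> a \<otimes> h \<otimes> inv a \<in> H"
  by (simp add: mem_K_iff)

lemma K_conj': "a \<in> K \<Longrightarrow> h \<in> H \<Longrightarrow> inv a \<otimes> h \<otimes> a \<in> H"
  by (simp add: mem_K_iff)

lemma normal_H: "H \<lhd> G\<lparr>carrier := K\<rparr>"
  unfolding K_def using subgroup_in_normalizer[OF H_subgroup] .

lemma coset_mem: "x \<in> carrier G \<Longrightarrow> x <# H \<in> \<I>"
  unfolding LCOSETS_def by auto

lemma coset_cases:
  assumes "X \<in> \<I>"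
  obtains x where "x \<in> carrier G" "X = x <# H"
  using assms unfolding LCOSETS_def by auto

lemma one_coset: "\<one> <# H = H"
  using lcos_mult_one subgroup.subset[OF H_subgroup] by auto

lemma H_mem_cosets: "H \<in> \<I>"
  using coset_mem[OF one_closed] one_coset by simp

lemma coset_absorb: "h \<in> H \<Longrightarrow> h <# H = H"
  using l_coset_eq_iff[OF H_subgroup, of h \<one>] H_carrier one_coset by simp

lemma lt_coset: "g \<in> carrier G \<Longrightarrow> x \<in> carrier G \<Longrightarrow> g <# (x <# H) = (g \<otimes> x) <# H"
  using lcos_m_assoc subgroup.subset[OF H_subgroup] by auto

text \<open>Elements of the normalizer move past \<open>H\<close> at the cost of a conjugation, one
  direction for each inclusion; this makes right translation by \<open>K\<close> an operation on
  left cosets of \<open>H\<close>.\<close>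

lemma rt_coset:
  assumes x: "x \<in> carrier G" and k: "k \<in> K"
  shows "(x <# H) #> k = (x \<otimes> k) <# H"
proof -
  have "(x <# H) #> k = (\<lambda>h. x \<otimes> h \<otimes> k) ` H"
    unfolding l_coset_def r_coset_def by auto
  also have "\<dots> = (\<lambda>h. x \<otimes> k \<otimes> h) ` H"
  proof -
    have "x \<otimes> h \<otimes> k = x \<otimes> k \<otimes> (inv k \<otimes> h \<otimes> k)" "x \<otimes> k \<otimes> h = x \<otimes> (k \<otimes> h \<otimes> inv k) \<otimes> k"
      if "h \<in> H" for h
      using that x k K_carrier H_carrier by (simp_all add: m_assoc inv_cancel_left)
    then show ?thesis using K_conj[OF k] K_conj'[OF k] by (auto simp: image_iff) metis+
  qed
  finally show ?thesis unfolding l_coset_def by auto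
qed

text \<open>Multiplication by \<open>K\<close> is the projection of \<open>G/H\<close> onto
  \<open>G/K\<close>; later it assigns to a representative its line.\<close>

lemma coset_set_mult_K: "x \<in> carrier G \<Longrightarrow> (x <# H) <#> K = x <# K"
proof -
  assume x: "x \<in> carrier G"
  have "H <#> K = K"
    unfolding set_mult_def using H_K K_mult H_one K_carrier by auto
  then show ?thesis
    using setmult_lcos_assoc[of H K x] x subgroup.subset[OF H_subgroup] subgroup.subset[OF K_subgroup]
    by simp
qed

lemma finite_cosets: "finite \<I>"
  unfolding LCOSETS_def using finite_carrier by auto

lemma bij_lt:
  assumes "g \<in> carrier G"
  shows "bij_betw (\<lambda>X. g <# X) \<I> \<I>"
  by (rule bij_betw_byWitness[where f' = "\<lambda>X. inv g <# X"])
    (auto elim!: coset_cases simp: assms lt_coset coset_mem inv_cancel_left)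

lemma bij_rt:
  assumes "k \<in> K"
  shows "bij_betw (\<lambda>X. X #> k) \<I> \<I>"
  by (rule bij_betw_byWitness[where f' = "\<lambda>X. X #> inv k"])
    (auto elim!: coset_cases simp: assms K_inv K_carrier rt_coset coset_mem m_assoc)

end

section \<open>Consequences of the conditions on a key\<close>

locale key_pair = finite_pair G H for G (structure) and H +
  fixes b :: 'a
  assumes key: "higman_key G H b"
begin

lemma b_carrier: "b \<in> carrier G" and b_notin: "b \<notin> K"
  using key unfolding higman_key_def K_def Let_def by auto

lemma doubly_transitive: "doubly_transitive_action G (lcosets K) (coset_action G K)"
  using key unfolding higman_key_def K_def Let_def by auto

lemma conj_b:
  assumes "a \<in> K"
  obtains h h' where "h \<in> H" "h' \<in> H" "a \<otimes> b \<otimes> inv a = h \<otimes> b \<otimes> h'"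
proof -
  have "a \<otimes> b \<otimes> inv a \<in> double_coset G H b"
    using key assms unfolding higman_key_def K_def Let_def by auto
  then show ?thesis using mem_double_coset[OF H_subgroup b_carrier] that by metis
qed

lemma key_faithful:
  assumes "a \<in> K" "h \<in> H" "h' \<in> H" "a \<otimes> b = h \<otimes> b \<otimes> h'"
  shows "a \<in> H"
proof -
  have "a \<otimes> b \<in> double_coset G H b"
    using mem_double_coset[OF H_subgroup b_carrier] assms by blast
  then show ?thesis using key assms unfolding higman_key_def K_def Let_def by auto
qed

lemma inv_b: obtains h h' where "h \<in> H" "h' \<in> H" "inv b = h \<otimes> b \<otimes> h'"
proof -
  have "double_coset G H b = double_coset G H (inv b)"
    using key unfolding higman_key_def Let_def by auto
  moreover have "inv b \<in> double_coset G H (inv b)"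
    using mem_double_coset[OF H_subgroup inv_closed[OF b_carrier]] H_one b_carrier
    by (metis inv_closed l_one r_one)
  ultimately show ?thesis
    using mem_double_coset[OF H_subgroup b_carrier] that by metis
qed

lemma K_commutator:
  assumes "a \<in> K" "a' \<in> K"
  shows "a \<otimes> a' \<otimes> inv a \<otimes> inv a' \<in> H"
proof -
  let ?K = "G\<lparr>carrier := K\<rparr>"
  interpret N: normal H ?K using normal_H .
  have comm: "comm_group (?K Mod H)"
    using key unfolding higman_key_def K_def Let_def by auto
  have c: "H #>\<^bsub>?K\<^esub> a \<in> carrier (?K Mod H)" "H #>\<^bsub>?K\<^esub> a' \<in> carrier (?K Mod H)"
    using assms by (auto simp: FactGroup_def RCOSETS_def)
  have "(H #>\<^bsub>?K\<^esub> a) \<otimes>\<^bsub>?K Mod H\<^esub> (H #>\<^bsub>?K\<^esub> a') = (H #>\<^bsub>?K\<^esub> a') \<otimes>\<^bsub>?K Mod H\<^esub> (H #>\<^bsub>?K\<^esub> a)"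
    using comm_groupE(4)[OF comm c] .
  then have "H #>\<^bsub>?K\<^esub> (a \<otimes> a') = H #>\<^bsub>?K\<^esub> (a' \<otimes> a)"
    using assms N.rcos_sum[of a a'] N.rcos_sum[of a' a] by (simp add: FactGroup_def)
  then have "H #> (a \<otimes> a') = H #> (a' \<otimes> a)"
    by (simp add: r_coset_def)
  then have "a \<otimes> a' \<in> H #> (a' \<otimes> a)"
    using rcos_self[of "a \<otimes> a'" H] H_subgroup K_carrier assms by auto
  then obtain h where h: "h \<in> H" "a \<otimes> a' = h \<otimes> (a' \<otimes> a)"
    unfolding r_coset_def by auto
  have "a \<otimes> a' \<otimes> inv a \<otimes> inv a' = h"
    using h assms K_carrier H_carrier by (simp add: m_assoc inv_solve_left' r_cancel_one')
  then show ?thesis using h by simp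
qed

text \<open>Double transitivity enters only through the stabilizer \<open>K\<close> being transitive
  on the remaining cosets: some \<open>t\<close> in \<open>K\<close> carries \<open>b <# K\<close>
  to \<open>g <# K\<close>. Since \<open>K\<close> conjugates \<open>b\<close> into
  \<open>H b H\<close>, the factor \<open>t\<close> on the left of \<open>b\<close> can be traded
  for an element of \<open>H\<close> and moved to the right.\<close>

lemma outside_K:
  assumes g: "g \<in> carrier G" "g \<notin> K"
  obtains h k where "h \<in> H" "k \<in> K" "g = h \<otimes> b \<otimes> k"
proof -
  have K1: "\<one> <# K = K" using lcos_mult_one subgroup.subset[OF K_subgroup] by auto
  have lc: "x <# K \<in> lcosets K" if "x \<in> carrier G" for x
    using that unfolding LCOSETS_def by auto
  have ne: "\<one> <# K \<noteq> x <# K" if "x \<in> carrier G" "x \<notin> K" for x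
    using l_coset_eq_iff[OF K_subgroup one_closed that(1)] that(1,2) K_inv[of "inv x"] by auto
  obtain t where t: "t \<in> carrier G" "coset_action G K t (\<one> <# K) = \<one> <# K"
      "coset_action G K t (b <# K) = g <# K"
    using doubly_transitive_actionD[OF doubly_transitive lc[OF one_closed] lc[OF b_carrier]
        lc[OF one_closed] lc[OF g(1)] ne[OF b_carrier b_notin] ne[OF g]] by metis
  have "t <# K = K" using t(1,2) lc[OF one_closed] K1 unfolding coset_action_def by auto
  then have tK: "t \<in> K" using lcos_self[OF t(1) K_subgroup] by simp
  have "(t \<otimes> b) <# K = g <# K"
    using t(1,3) lc[OF b_carrier] lcos_m_assoc[OF subgroup.subset[OF K_subgroup] t(1) b_carrier]
    unfolding coset_action_def by auto
  then have "inv (t \<otimes> b) \<otimes> g \<in> K"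
    using l_coset_eq_iff[OF K_subgroup g(1), of "t \<otimes> b"] t(1) b_carrier by simp
  moreover define k where "k = inv (t \<otimes> b) \<otimes> g"
  ultimately have k: "k \<in> K" and gk: "g = t \<otimes> b \<otimes> k"
    using g t(1) b_carrier inv_cancel_left(1)[of "t \<otimes> b" g] by auto
  obtain h h' where h: "h \<in> H" "h' \<in> H" "t \<otimes> b \<otimes> inv t = h \<otimes> b \<otimes> h'"
    using conj_b[OF tK] .
  have "g = (t \<otimes> b \<otimes> inv t) \<otimes> (t \<otimes> k)"
    using gk t(1) k K_carrier b_carrier by (simp add: m_assoc inv_cancel_left)
  also have "\<dots> = h \<otimes> b \<otimes> (h' \<otimes> (t \<otimes> k))"
    using h t(1) k K_carrier H_carrier b_carrier by (simp add: m_assoc)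
  finally show ?thesis using that h(1) K_mult[OF H_K[OF h(2)] K_mult[OF tK k]] by simp
qed

text \<open>Inside \<open>K\<close> this is commutativity of \<open>K/H\<close>. Outside, the
  factors of \<open>g = h \<otimes> b \<otimes> k\<close> are conjugated separately:
  \<open>h\<close> stays in \<open>H\<close>, \<open>b\<close> moves within \<open>H b H\<close>,
  and \<open>k\<close> changes by a commutator, which lies in \<open>H\<close>.\<close>

lemma conj_K:
  assumes a: "a \<in> K" and g: "g \<in> carrier G"
  obtains h h' where "h \<in> H" "h' \<in> H" "a \<otimes> g \<otimes> inv a = h \<otimes> g \<otimes> h'"
proof (cases "g \<in> K")
  case True
  have "a \<otimes> g \<otimes> inv a = (a \<otimes> g \<otimes> inv a \<otimes> inv g) \<otimes> g \<otimes> \<one>"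
    using a g K_carrier by (simp add: m_assoc)
  then show ?thesis using that K_commutator[OF a True] H_one by blast
next
  case False
  obtain h k where hk: "h \<in> H" "k \<in> K" "g = h \<otimes> b \<otimes> k" using outside_K[OF g False] .
  obtain h1 h2 where h12: "h1 \<in> H" "h2 \<in> H" "a \<otimes> b \<otimes> inv a = h1 \<otimes> b \<otimes> h2" using conj_b[OF a] .
  define c where "c = a \<otimes> h \<otimes> inv a"
  have c: "c \<in> H" unfolding c_def using K_conj[OF a hk(1)] .
  define e where "e = a \<otimes> k \<otimes> inv a \<otimes> inv k"
  have e: "e \<in> H" unfolding e_def using K_commutator[OF a hk(2)] .
  \<comment> \<open>The elements of \<open>H\<close> that end up between \<open>b\<close> and
    \<open>k\<close> are pushed to the right of \<open>k\<close>.\<close>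
  define f where "f = inv k \<otimes> (h2 \<otimes> e) \<otimes> k"
  have f: "f \<in> H" unfolding f_def using K_conj'[OF hk(2) H_mult[OF h12(2) e]] .
  note cl = a hk(1,2) h12(1,2) c e f K_carrier H_carrier b_carrier
  have "a \<otimes> g \<otimes> inv a = c \<otimes> (a \<otimes> b \<otimes> inv a) \<otimes> (e \<otimes> k)"
    unfolding hk(3) c_def e_def using a hk(1,2) K_carrier H_carrier b_carrier
    by (simp add: m_assoc inv_cancel_left)
  also have "\<dots> = c \<otimes> h1 \<otimes> inv h \<otimes> (h \<otimes> b \<otimes> k) \<otimes> f"
    unfolding h12(3) f_def using cl by (simp add: m_assoc inv_cancel_left)
  finally have "a \<otimes> g \<otimes> inv a = (c \<otimes> h1 \<otimes> inv h) \<otimes> g \<otimes> f" unfolding hk(3) .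
  then show ?thesis using that[of "c \<otimes> h1 \<otimes> inv h" f] c h12(1) hk(1) f H_mult H_inv by simp
qed

end

section \<open>The scheme algebra as the algebra of invariant matrices\<close>

lemma mtimes_sum_left:
  "mtimes I (\<lambda>i j. \<Sum>k\<in>S. c k * A k i j) N = (\<lambda>i j. \<Sum>k\<in>S. c k * mtimes I (A k) N i j)"
proof (intro ext)
  fix i j
  have "mtimes I (\<lambda>i j. \<Sum>k\<in>S. c k * A k i j) N i j = (\<Sum>l\<in>I. \<Sum>k\<in>S. c k * (A k i l * N l j))"
    unfolding mtimes_def by (simp add: sum_distrib_right mult.assoc)
  also have "\<dots> = (\<Sum>k\<in>S. \<Sum>l\<in>I. c k * (A k i l * N l j))" by (rule sum.swap)
  finally show "mtimes I (\<lambda>i j. \<Sum>k\<in>S. c k * A k i j) N i j = (\<Sum>k\<in>S. c k * mtimes I (A k) N i j)"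
    unfolding mtimes_def by (simp add: sum_distrib_left)
qed

lemma mtimes_sum_right:
  "mtimes I N (\<lambda>i j. \<Sum>k\<in>S. c k * A k i j) = (\<lambda>i j. \<Sum>k\<in>S. c k * mtimes I N (A k) i j)"
proof (intro ext)
  fix i j
  have "mtimes I N (\<lambda>i j. \<Sum>k\<in>S. c k * A k i j) i j = (\<Sum>l\<in>I. \<Sum>k\<in>S. c k * (N i l * A k l j))"
    unfolding mtimes_def by (simp add: sum_distrib_left mult_ac)
  also have "\<dots> = (\<Sum>k\<in>S. \<Sum>l\<in>I. c k * (N i l * A k l j))" by (rule sum.swap)
  finally show "mtimes I N (\<lambda>i j. \<Sum>k\<in>S. c k * A k i j) i j = (\<Sum>k\<in>S. c k * mtimes I N (A k) i j)"
    unfolding mtimes_def by (simp add: sum_distrib_left)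
qed

lemma mtimes_assoc: "mtimes I (mtimes I A B) C = mtimes I A (mtimes I B C)"
proof (intro ext)
  fix i j
  have "mtimes I (mtimes I A B) C i j = (\<Sum>l\<in>I. \<Sum>k\<in>I. A i k * B k l * C l j)"
    unfolding mtimes_def by (simp add: sum_distrib_right)
  also have "\<dots> = (\<Sum>k\<in>I. \<Sum>l\<in>I. A i k * B k l * C l j)" by (rule sum.swap)
  finally show "mtimes I (mtimes I A B) C i j = mtimes I A (mtimes I B C) i j"
    unfolding mtimes_def by (simp add: sum_distrib_left mult.assoc)
qed

lemma madjoint_mtimes: "madjoint (mtimes I A B) = mtimes I (madjoint B) (madjoint A)"
  unfolding madjoint_def mtimes_def by (simp add: mult.commute)

context finite_pair
begin

text \<open>The support condition is there because a matrix is a function on all pairs of sets. The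
  notion describes the scheme algebra without reference to double cosets
  (\<open>scheme_algebra_iff\<close>).\<close>

definition invariant :: "'a set cmatrix \<Rightarrow> bool" where
  "invariant M \<longleftrightarrow> (\<forall>X Y. M X Y \<noteq> 0 \<longrightarrow> X \<in> \<I> \<and> Y \<in> \<I>) \<and>
     (\<forall>g\<in>carrier G. \<forall>X\<in>\<I>. \<forall>Y\<in>\<I>. M (g <# X) (g <# Y) = M X Y)"

text \<open>The column at the base coset, read as a function on \<open>G\<close>. It determines an
  invariant matrix and is constant on double cosets.\<close>

definition ent :: "'a set cmatrix \<Rightarrow> 'a \<Rightarrow> complex" where
  "ent M g = M (g <# H) H"

lemma invariant_outside: "invariant M \<Longrightarrow> X \<notin> \<I> \<or> Y \<notin> \<I> \<Longrightarrow> M X Y = 0"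
  unfolding invariant_def by blast

lemma invariant_lt:
  "invariant M \<Longrightarrow> g \<in> carrier G \<Longrightarrow> X \<in> \<I> \<Longrightarrow> Y \<in> \<I> \<Longrightarrow> M (g <# X) (g <# Y) = M X Y"
  unfolding invariant_def by blast

lemma invariant_entry:
  assumes "invariant M" "x \<in> carrier G" "y \<in> carrier G"
  shows "M (x <# H) (y <# H) = ent M (inv y \<otimes> x)"
proof -
  have "M (inv y <# (x <# H)) (inv y <# (y <# H)) = M (x <# H) (y <# H)"
    using invariant_lt[OF assms(1) inv_closed[OF assms(3)]] assms coset_mem by auto
  then show ?thesis using assms by (simp add: lt_coset one_coset ent_def)
qed

lemma ent_lt:
  assumes "invariant M" "h \<in> H" "g \<in> carrier G"
  shows "ent M (h \<otimes> g) = ent M g"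
proof -
  have "M (h <# (g <# H)) (h <# H) = M (g <# H) H"
    using invariant_lt[OF assms(1) H_carrier[OF assms(2)]] assms coset_mem H_mem_cosets by auto
  then show ?thesis using assms H_carrier by (simp add: lt_coset coset_absorb ent_def)
qed

lemma ent_rt:
  assumes "invariant M" "h \<in> H" "g \<in> carrier G"
  shows "ent M (g \<otimes> h) = ent M g"
  using assms lt_coset[of g h] H_carrier coset_absorb by (simp add: ent_def)

lemma invariant_eqI:
  assumes "invariant M" "invariant N" "\<And>g. g \<in> carrier G \<Longrightarrow> ent M g = ent N g"
  shows "M = N"
proof (intro ext)
  fix X Y
  show "M X Y = N X Y"
  proof (cases "X \<in> \<I> \<and> Y \<in> \<I>")
    case True
    then obtain x y where "x \<in> carrier G" "X = x <# H" "y \<in> carrier G" "Y = y <# H"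
      using coset_cases by metis
    then show ?thesis using assms by (simp add: invariant_entry)
  next
    case False
    then show ?thesis using assms(1,2) invariant_outside by metis
  qed
qed

text \<open>Left translation by \<open>g\<close> permutes the summation index.\<close>

lemma invariant_mtimes:
  assumes M: "invariant M" and N: "invariant N"
  shows "invariant (mtimes \<I> M N)"
  unfolding invariant_def
proof (intro conjI allI ballI impI)
  fix X Y assume "mtimes \<I> M N X Y \<noteq> 0"
  then obtain Z where "M X Z * N Z Y \<noteq> 0" unfolding mtimes_def by (meson sum.neutral)
  then show "X \<in> \<I>" "Y \<in> \<I>"
    using invariant_outside[OF M, of X Z] invariant_outside[OF N, of Z Y] by auto
next
  fix g X Y assume g: "g \<in> carrier G" and X: "X \<in> \<I>" and Y: "Y \<in> \<I>"
  have "mtimes \<I> M N (g <# X) (g <# Y) = (\<Sum>Z\<in>\<I>. M (g <# X) (g <# Z) * N (g <# Z) (g <# Y))"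
    unfolding mtimes_def by (rule sum.reindex_bij_betw[OF bij_lt[OF g], symmetric])
  then show "mtimes \<I> M N (g <# X) (g <# Y) = mtimes \<I> M N X Y"
    unfolding mtimes_def using invariant_lt[OF M g] invariant_lt[OF N g] X Y by simp
qed

lemma lt_mem: "g \<in> carrier G \<Longrightarrow> X \<in> \<I> \<Longrightarrow> g <# X \<in> \<I>"
  using bij_lt[of g] bij_betwE by blast

lemma rt_mem: "k \<in> K \<Longrightarrow> X \<in> \<I> \<Longrightarrow> X #> k \<in> \<I>"
  using bij_rt[of k] bij_betwE by blast

lemma lt_rt: "g \<in> carrier G \<Longrightarrow> X \<in> \<I> \<Longrightarrow> k \<in> K \<Longrightarrow> (g <# X) #> k = g <# (X #> k)"
  by (auto elim!: coset_cases simp: K_carrier rt_coset lt_coset m_assoc)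

lemma invariant_lincomb:
  assumes "\<And>i. i \<in> S \<Longrightarrow> invariant (A i)"
  shows "invariant (\<lambda>X Y. \<Sum>i\<in>S. c i * A i X Y)"
  unfolding invariant_def
proof (intro conjI allI ballI impI)
  fix X Y assume "(\<Sum>i\<in>S. c i * A i X Y) \<noteq> 0"
  then obtain i where "i \<in> S" "A i X Y \<noteq> 0" by (metis (mono_tags, lifting) mult_zero_right sum.neutral)
  then show "X \<in> \<I>" "Y \<in> \<I>"
    using assms invariant_outside by blast+
next
  fix g X Y assume "g \<in> carrier G" "X \<in> \<I>" "Y \<in> \<I>"
  then show "(\<Sum>i\<in>S. c i * A i (g <# X) (g <# Y)) = (\<Sum>i\<in>S. c i * A i X Y)"
    using assms by (intro sum.cong) (auto simp: invariant_lt)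
qed

lemma invariant_lincomb2:
  assumes "invariant A" "invariant B"
  shows "invariant (\<lambda>X Y. s * A X Y + t * B X Y)"
  unfolding invariant_def
proof (intro conjI allI ballI impI)
  fix X Y assume "s * A X Y + t * B X Y \<noteq> 0"
  then have "A X Y \<noteq> 0 \<or> B X Y \<noteq> 0" by auto
  then show "X \<in> \<I>" "Y \<in> \<I>" using assms invariant_outside by blast+
qed (simp add: assms invariant_lt)

lemma invariant_madjoint: "invariant M \<Longrightarrow> invariant (madjoint M)"
  unfolding invariant_def madjoint_def by auto

lemma ent_madjoint:
  assumes "invariant M" "g \<in> carrier G"
  shows "ent (madjoint M) g = cnj (ent M (inv g))"
  using invariant_entry[OF assms(1) one_closed assms(2)] assms(2)
  by (simp add: ent_def madjoint_def one_coset)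

lemma mem_double_coset_trans:
  assumes "x \<in> carrier G" "h \<in> H" "h' \<in> H" "a \<in> carrier G"
  shows "h \<otimes> x \<otimes> h' \<in> double_coset G H a \<longleftrightarrow> x \<in> double_coset G H a"
proof -
  have "h \<otimes> x \<otimes> h' \<in> double_coset G H a" if "x \<in> double_coset G H a" "h \<in> H" "h' \<in> H" for x h h'
  proof -
    obtain k k' where k: "k \<in> H" "k' \<in> H" "x = k \<otimes> a \<otimes> k'"
      using \<open>x \<in> double_coset G H a\<close> mem_double_coset[OF H_subgroup assms(4)] by blast
    then have "h \<otimes> x \<otimes> h' = (h \<otimes> k) \<otimes> a \<otimes> (k' \<otimes> h')"
      using that assms(4) H_carrier by (simp add: m_assoc)
    then show ?thesis using that k H_mult mem_double_coset[OF H_subgroup assms(4)] by metis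
  qed
  from this[of x h h'] this[of "h \<otimes> x \<otimes> h'" "inv h" "inv h'"] show ?thesis
    using assms H_inv H_carrier by (auto simp: m_assoc inv_cancel_left)
qed

lemma double_coset_self: "a \<in> carrier G \<Longrightarrow> a \<in> double_coset G H a"
  using mem_double_coset[OF H_subgroup] H_one by (metis l_one r_one)

lemma double_coset_eqI:
  assumes "a \<in> carrier G" "x \<in> double_coset G H a"
  shows "double_coset G H x = double_coset G H a"
proof -
  obtain k k' where k: "k \<in> H" "k' \<in> H" "x = k \<otimes> a \<otimes> k'"
    using assms mem_double_coset[OF H_subgroup] by blast
  then have x: "x \<in> carrier G" and a: "a = inv k \<otimes> x \<otimes> inv k'"
    using assms H_carrier by (simp_all add: m_assoc inv_cancel_left)
  have "y \<in> double_coset G H x \<longleftrightarrow> y \<in> double_coset G H a" for y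
  proof
    assume "y \<in> double_coset G H x"
    then obtain h h' where h: "h \<in> H" "h' \<in> H" "y = h \<otimes> x \<otimes> h'"
      using x mem_double_coset[OF H_subgroup] by blast
    then show "y \<in> double_coset G H a"
      using mem_double_coset_trans[OF x h(1,2) assms(1)] assms(2) by simp
  next
    assume "y \<in> double_coset G H a"
    then obtain h h' where h: "h \<in> H" "h' \<in> H" "y = h \<otimes> a \<otimes> h'"
      using assms(1) mem_double_coset[OF H_subgroup] by blast
    moreover have "a \<in> double_coset G H x"
      using a k H_inv mem_double_coset[OF H_subgroup x] by blast
    ultimately show "y \<in> double_coset G H x"
      using mem_double_coset_trans[OF assms(1) h(1,2) x] by simp
  qed
  then show ?thesis by blast
qed

lemma mem_double_coset_iff:
  assumes "a \<in> carrier G" "x \<in> carrier G"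
  shows "x \<in> double_coset G H a \<longleftrightarrow> double_coset G H x = double_coset G H a"
  using double_coset_eqI[OF assms(1)] double_coset_self[OF assms(2)] by auto

text \<open>The existential over representatives in \<open>adjacency\<close> is harmless: other
  representatives change \<open>inv y \<otimes> x\<close> by factors of \<open>H\<close> on both
  sides.\<close>

lemma adjacency_entry:
  assumes x: "x \<in> carrier G" and y: "y \<in> carrier G" and a: "a \<in> carrier G"
  shows "adjacency G H (double_coset G H a) (x <# H) (y <# H) =
    (if inv y \<otimes> x \<in> double_coset G H a then 1 else 0)"
proof -
  have "inv (y \<otimes> h) \<otimes> (x \<otimes> h') \<in> double_coset G H a \<longleftrightarrow> inv y \<otimes> x \<in> double_coset G H a"
    if "h \<in> H" "h' \<in> H" for h h'
  proof -
    have "inv (y \<otimes> h) \<otimes> (x \<otimes> h') = inv h \<otimes> (inv y \<otimes> x) \<otimes> h'"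
      using that x y H_carrier by (simp add: m_assoc inv_mult_group)
    then show ?thesis
      using mem_double_coset_trans[OF _ H_inv[OF that(1)] that(2) a] x y by simp
  qed
  then show ?thesis
    unfolding adjacency_def using coset_mem x y H_one unfolding l_coset_def by auto
qed

lemma invariant_adjacency:
  assumes a: "a \<in> carrier G"
  shows "invariant (adjacency G H (double_coset G H a))"
  unfolding invariant_def
proof (intro conjI allI ballI impI)
  fix X Y assume "adjacency G H (double_coset G H a) X Y \<noteq> 0"
  then show "X \<in> \<I>" "Y \<in> \<I>" unfolding adjacency_def by presburger+
next
  fix g X Y assume g: "g \<in> carrier G" and "X \<in> \<I>" "Y \<in> \<I>"
  then obtain x y where xy: "x \<in> carrier G" "X = x <# H" "y \<in> carrier G" "Y = y <# H"
      using coset_cases by metis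
  have "inv (g \<otimes> y) \<otimes> (g \<otimes> x) = inv y \<otimes> x"
    using g xy by (simp add: inv_mult_group m_assoc inv_cancel_left)
  then show "adjacency G H (double_coset G H a) (g <# X) (g <# Y) = adjacency G H (double_coset G H a) X Y"
    using g xy a by (simp add: lt_coset adjacency_entry)
qed

lemma finite_double_cosets: "finite (double_cosets G H)"
  unfolding double_cosets_def using finite_carrier by simp

lemma invariant_scheme_combination: "invariant (scheme_combination G H c)"
  unfolding scheme_combination_def
  by (rule invariant_lincomb) (auto simp: double_cosets_def invariant_adjacency)

text \<open>Double cosets partition \<open>G\<close>, so exactly one summand survives.\<close>

lemma ent_scheme_combination:
  assumes g: "g \<in> carrier G"
  shows "ent (scheme_combination G H c) g = c (double_coset G H g)"
proof -
  have eq: "adjacency G H D (g <# H) H = (if D = double_coset G H g then 1 else 0)"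
    if D: "D \<in> double_cosets G H" for D
  proof -
    obtain a where a: "a \<in> carrier G" "D = double_coset G H a" using D unfolding double_cosets_def by auto
    show ?thesis using adjacency_entry[OF g one_closed a(1)] a g mem_double_coset_iff[OF a(1) g]
      by (auto simp: one_coset)
  qed
  have "ent (scheme_combination G H c) g
      = (\<Sum>D\<in>double_cosets G H. if D = double_coset G H g then c D else 0)"
    unfolding ent_def scheme_combination_def by (intro sum.cong refl) (simp add: eq)
  also have "\<dots> = c (double_coset G H g)"
    using finite_double_cosets g by (auto simp: double_cosets_def)
  finally show ?thesis .
qed

lemma scheme_combination_eq:
  assumes "invariant M" "\<And>g. g \<in> carrier G \<Longrightarrow> c (double_coset G H g) = ent M g"
  shows "M = scheme_combination G H c"
  by (rule invariant_eqI[OF assms(1) invariant_scheme_combination])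
    (simp add: assms(2) ent_scheme_combination)

lemma ent_double_coset:
  assumes "invariant M" "a \<in> carrier G" "x \<in> double_coset G H a"
  shows "ent M x = ent M a"
  using assms mem_double_coset[OF H_subgroup assms(2)] ent_lt ent_rt H_carrier by auto

text \<open>The coefficient of a double coset is the entry at any of its members; constancy on the
  double coset makes the choice by \<open>SOME\<close> irrelevant.\<close>

lemma scheme_algebra_iff: "M \<in> scheme_algebra G H \<longleftrightarrow> invariant M"
proof
  assume "invariant M"
  moreover have "ent M (SOME x. x \<in> double_coset G H g) = ent M g" if "g \<in> carrier G" for g
    using ent_double_coset[OF \<open>invariant M\<close> that] someI[of "\<lambda>x. x \<in> double_coset G H g", OF double_coset_self[OF that]]
    by blast
  ultimately have "M = scheme_combination G H (\<lambda>D. ent M (SOME x. x \<in> D))"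
    by (intro scheme_combination_eq) auto
  then show "M \<in> scheme_algebra G H" unfolding scheme_algebra_def by simp
next
  show "M \<in> scheme_algebra G H \<Longrightarrow> invariant M"
    unfolding scheme_algebra_def using invariant_scheme_combination by auto
qed

end

section \<open>Commutativity and equivariant matrices\<close>

lemma (in normal) FactGroup_nat_pow:
  "x \<in> carrier G \<Longrightarrow> (H #> x) [^]\<^bsub>G Mod H\<^esub> (n::nat) = H #> (x [^] n)"
  by (induction n) (simp_all add: FactGroup_def rcos_sum coset_mult_one[OF subset])

context finite_pair
begin

lemma invariant_eqI2:
  assumes "invariant M" "invariant N" "\<And>X Y. X \<in> \<I> \<Longrightarrow> Y \<in> \<I> \<Longrightarrow> M X Y = N X Y"
  shows "M = N"
  using assms coset_mem H_mem_cosets by (intro invariant_eqI) (auto simp: ent_def)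

lemma rt_one: "X \<in> \<I> \<Longrightarrow> X #> \<one> = X"
  using H_one H_K by (auto elim!: coset_cases simp: rt_coset)

lemma rt_rt: "X \<in> \<I> \<Longrightarrow> k \<in> K \<Longrightarrow> l \<in> K \<Longrightarrow> (X #> k) #> l = X #> (k \<otimes> l)"
  by (auto elim!: coset_cases simp: K_carrier K_mult rt_coset m_assoc)

lemma rt_H: "X \<in> \<I> \<Longrightarrow> h \<in> H \<Longrightarrow> X #> h = X"
  by (auto elim!: coset_cases simp: H_carrier H_K rt_coset lt_coset[symmetric] coset_absorb)

definition "r = subgroup_index G K H"

lemma r_eq: "r = card ((\<lambda>k. k <# H) ` K)"
  unfolding r_def subgroup_index_def LCOSETS_def l_coset_def by (simp add: UNION_singleton_eq_range)

lemma r_pos: "r > 0"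
  unfolding r_eq using H_K[OF H_one] finite_subset[OF subgroup.subset[OF K_subgroup] finite_carrier]
  by (auto simp: card_gt_0_iff)

lemma K_pow: "k \<in> K \<Longrightarrow> k [^] (n::nat) \<in> K"
  by (induction n) (auto simp: K_mult H_K[OF H_one])

text \<open>Lagrange in the factor group \<open>K/H\<close>, whose order is \<open>r\<close> because
  left and right cosets of a normal subgroup agree. This exponent makes the eigenvalues of right
  translations \<open>r\<close>th roots of unity.\<close>

lemma K_pow_r:
  assumes k: "k \<in> K"
  shows "k [^] r \<in> H"
proof -
  let ?K = "G\<lparr>carrier := K\<rparr>"
  interpret N: normal H ?K using normal_H .
  have "lcosets\<^bsub>?K\<^esub> H = rcosets\<^bsub>?K\<^esub> H"
    unfolding LCOSETS_def RCOSETS_def using N.coset_eq by auto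
  then have r: "r = Coset.order (?K Mod H)"
    unfolding r_def subgroup_index_def Coset.order_def by (simp add: FactGroup_def)
  have F: "group (?K Mod H)" using N.factorgroup_is_group .
  have fin: "finite (carrier (?K Mod H))"
    using r r_pos unfolding Coset.order_def by (simp add: card_gt_0_iff)
  have mem: "H #>\<^bsub>?K\<^esub> k \<in> carrier (?K Mod H)"
    using k unfolding FactGroup_def RCOSETS_def by auto
  have "H #>\<^bsub>?K\<^esub> (k [^]\<^bsub>?K\<^esub> r) = H"
    using N.FactGroup_nat_pow[of k r] group.pow_order_eq_1[OF F mem] k
    by (simp add: r[symmetric])
  then have "H #>\<^bsub>?K\<^esub> (k [^] r) = H" by (simp add: nat_pow_consistent[symmetric])
  then have "H #> (k [^] r) = H" by (simp add: r_coset_def)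
  then show ?thesis
    using rcos_self[of "k [^] r" H] H_subgroup K_carrier[OF K_pow[OF k]] by auto
qed

end

context key_pair
begin

text \<open>The element \<open>a \<otimes> g\<close> is the conjugate of
  \<open>g \<otimes> a\<close> by \<open>a\<close>, hence lies in the same double coset.\<close>

lemma ent_commute_K:
  assumes "invariant M" "a \<in> K" "g \<in> carrier G"
  shows "ent M (a \<otimes> g) = ent M (g \<otimes> a)"
proof -
  have ga: "g \<otimes> a \<in> carrier G" using assms K_carrier by auto
  obtain h h' where h: "h \<in> H" "h' \<in> H" "a \<otimes> (g \<otimes> a) \<otimes> inv a = h \<otimes> (g \<otimes> a) \<otimes> h'"
    using conj_K[OF assms(2) ga] .
  have "a \<otimes> (g \<otimes> a) \<otimes> inv a = a \<otimes> g"
    using assms K_carrier by (simp add: m_assoc)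
  then have "a \<otimes> g = h \<otimes> (g \<otimes> a) \<otimes> h'" using h by simp
  then show ?thesis using ent_lt[OF assms(1) h(1) ga] ent_rt[OF assms(1) h(2), of "h \<otimes> (g \<otimes> a)"] h ga H_carrier
    by simp
qed

text \<open>Right translations commute with every invariant matrix; entrywise, a translation of the
  row index passes to the column index with the inverse element.\<close>

lemma entry_rt_left:
  assumes "invariant M" "X \<in> \<I>" "Y \<in> \<I>" "k \<in> K"
  shows "M (X #> k) Y = M X (Y #> inv k)"
proof -
  obtain x y where "x \<in> carrier G" "X = x <# H" "y \<in> carrier G" "Y = y <# H"
    using coset_cases assms by metis
  then show ?thesis
    using assms ent_commute_K[OF assms(1,4), of "inv y \<otimes> x"]
    by (simp add: rt_coset K_inv K_carrier invariant_entry inv_mult_group m_assoc)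
qed

lemma entry_rt_rt:
  assumes "invariant M" "X \<in> \<I>" "Y \<in> \<I>" "k \<in> K"
  shows "M (X #> k) (Y #> k) = M X Y"
  using entry_rt_left[OF assms(1,2) rt_mem[OF assms(4,3)] assms(4)] assms
  by (simp add: rt_rt K_inv K_carrier rt_one)

abbreviation "A\<^sub>b \<equiv> adjacency G H (double_coset G H b)"

text \<open>As \<open>a\<close> normalizes \<open>H\<close>, the double coset of
  \<open>b \<otimes> a\<close> is a right translate of that of \<open>b\<close>, so its matrix is
  \<open>A\<^sub>b\<close> composed with a translation.\<close>

lemma adjacency_mult_K:
  assumes a: "a \<in> K" and X: "X \<in> \<I>" and Y: "Y \<in> \<I>"
  shows "adjacency G H (double_coset G H (b \<otimes> a)) X Y = A\<^sub>b (X #> inv a) Y"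
proof -
  obtain x y where xy: "x \<in> carrier G" "X = x <# H" "y \<in> carrier G" "Y = y <# H"
    using coset_cases X Y by metis
  have ac: "a \<in> carrier G" using a K_carrier by auto
  have "g \<in> double_coset G H (b \<otimes> a) \<longleftrightarrow> g \<otimes> inv a \<in> double_coset G H b"
    if g: "g \<in> carrier G" for g
  proof
    assume "g \<in> double_coset G H (b \<otimes> a)"
    then obtain h h' where h: "h \<in> H" "h' \<in> H" "g = h \<otimes> (b \<otimes> a) \<otimes> h'"
      using ac b_carrier mem_double_coset[OF H_subgroup, of "b \<otimes> a"] by auto
    then have "g \<otimes> inv a = h \<otimes> b \<otimes> (a \<otimes> h' \<otimes> inv a)"
      using ac b_carrier H_carrier by (simp add: m_assoc)
    then show "g \<otimes> inv a \<in> double_coset G H b"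
      using mem_double_coset[OF H_subgroup b_carrier] h K_conj[OF a] by blast
  next
    assume "g \<otimes> inv a \<in> double_coset G H b"
    then obtain h h' where h: "h \<in> H" "h' \<in> H" "g \<otimes> inv a = h \<otimes> b \<otimes> h'"
      using mem_double_coset[OF H_subgroup b_carrier] by auto
    have "g = g \<otimes> inv a \<otimes> a" using g ac by (simp add: m_assoc)
    also have "\<dots> = h \<otimes> (b \<otimes> a) \<otimes> (inv a \<otimes> h' \<otimes> a)"
      unfolding h(3) using h(1,2) ac b_carrier H_carrier by (simp add: m_assoc inv_cancel_left)
    finally show "g \<in> double_coset G H (b \<otimes> a)"
      using ac b_carrier mem_double_coset[OF H_subgroup, of "b \<otimes> a"] h K_conj'[OF a] by blast
  qed
  from this[of "inv y \<otimes> x"] show ?thesis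
    using xy a ac b_carrier by (simp add: adjacency_entry rt_coset K_inv m_assoc)
qed

text \<open>The double coset of an element of \<open>K\<close> is a single coset of
  \<open>H\<close>, and its matrix is the permutation matrix of a right translation.\<close>

lemma adjacency_K:
  assumes a: "a \<in> K" and X: "X \<in> \<I>" and Y: "Y \<in> \<I>"
  shows "adjacency G H (double_coset G H a) X Y = (if Y = X #> inv a then 1 else 0)"
proof -
  obtain x y where xy: "x \<in> carrier G" "X = x <# H" "y \<in> carrier G" "Y = y <# H"
    using coset_cases X Y by metis
  have ac: "a \<in> carrier G" using a K_carrier by auto
  have "g \<in> double_coset G H a \<longleftrightarrow> g \<otimes> inv a \<in> H" if g: "g \<in> carrier G" for g
  proof
    assume "g \<in> double_coset G H a"
    then obtain h h' where h: "h \<in> H" "h' \<in> H" "g = h \<otimes> a \<otimes> h'"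
      using ac mem_double_coset[OF H_subgroup ac] by auto
    then have "g \<otimes> inv a = h \<otimes> (a \<otimes> h' \<otimes> inv a)"
      using ac H_carrier by (simp add: m_assoc)
    then show "g \<otimes> inv a \<in> H" using h H_mult K_conj[OF a] by simp
  next
    assume m: "g \<otimes> inv a \<in> H"
    have "g = (g \<otimes> inv a) \<otimes> a \<otimes> \<one>" using g ac by (simp add: m_assoc)
    then show "g \<in> double_coset G H a" using mem_double_coset[OF H_subgroup ac] m H_one by blast
  qed
  from this[of "inv y \<otimes> x"] have "adjacency G H (double_coset G H a) X Y = (if inv y \<otimes> (x \<otimes> inv a) \<in> H then 1 else 0)"
    using xy a ac b_carrier by (simp add: adjacency_entry m_assoc)
  moreover have "inv y \<otimes> (x \<otimes> inv a) \<in> H \<longleftrightarrow> Y = X #> inv a"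
    using xy a ac l_coset_eq_iff[OF H_subgroup, of "x \<otimes> inv a" y] by (auto simp: rt_coset K_inv)
  ultimately show ?thesis by simp
qed

lemma double_coset_representative:
  assumes "D \<in> double_cosets G H"
  obtains a where "a \<in> K" "D = double_coset G H a \<or> D = double_coset G H (b \<otimes> a)"
proof -
  obtain g where g: "g \<in> carrier G" "D = double_coset G H g" using assms unfolding double_cosets_def by auto
  show ?thesis
  proof (cases "g \<in> K")
    case False
    then obtain h k where hk: "h \<in> H" "k \<in> K" "g = h \<otimes> b \<otimes> k" using outside_K[OF g(1)] by metis
    have bk: "b \<otimes> k \<in> carrier G" using hk b_carrier K_carrier by simp
    have "g = h \<otimes> (b \<otimes> k) \<otimes> \<one>" using hk b_carrier K_carrier H_carrier by (simp add: m_assoc)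
    then have "g \<in> double_coset G H (b \<otimes> k)"
      using mem_double_coset[OF H_subgroup bk] hk(1) H_one by blast
    then have "D = double_coset G H (b \<otimes> k)" using double_coset_eqI[OF bk] g(2) by simp
    then show ?thesis using that hk(2) by blast
  qed (use that g in blast)
qed

text \<open>Every adjacency matrix is a right translation or a right translate of
  \<open>A\<^sub>b\<close>. Since \<open>N\<close> commutes with the translations, commuting with
  \<open>A\<^sub>b\<close> is all that has to be assumed.\<close>

lemma adjacency_commute_step:
  assumes N: "invariant N" and comm: "mtimes \<I> A\<^sub>b N = mtimes \<I> N A\<^sub>b"
    and D: "D \<in> double_cosets G H"
  shows "mtimes \<I> (adjacency G H D) N = mtimes \<I> N (adjacency G H D)"
proof (rule invariant_eqI2)
  have invD: "invariant (adjacency G H D)"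
    using D invariant_adjacency unfolding double_cosets_def by auto
  show "invariant (mtimes \<I> (adjacency G H D) N)" "invariant (mtimes \<I> N (adjacency G H D))"
    using invariant_mtimes N invD by auto
  fix X Y assume X: "X \<in> \<I>" and Y: "Y \<in> \<I>"
  obtain a where a: "a \<in> K" "D = double_coset G H a \<or> D = double_coset G H (b \<otimes> a)"
    using double_coset_representative[OF D] .
  note ai = K_inv[OF a(1)]
  from a(2) show "mtimes \<I> (adjacency G H D) N X Y = mtimes \<I> N (adjacency G H D) X Y"
  proof
    assume D: "D = double_coset G H a"
    have "mtimes \<I> (adjacency G H D) N X Y = (\<Sum>Z\<in>\<I>. if Z = X #> inv a then N Z Y else 0)"
      unfolding mtimes_def D by (intro sum.cong refl) (simp add: adjacency_K a X)
    also have "\<dots> = N (X #> inv a) Y" using finite_cosets rt_mem[OF ai X] by simp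
    also have "\<dots> = N X (Y #> a)" using entry_rt_left[OF N X Y ai] a K_carrier by simp
    also have "\<dots> = (\<Sum>Z\<in>\<I>. if Z = Y #> a then N X Z else 0)"
      using finite_cosets rt_mem[OF a(1) Y] by simp
    also have "\<dots> = mtimes \<I> N (adjacency G H D) X Y"
      unfolding mtimes_def D
    proof (intro sum.cong refl)
      fix Z assume Z: "Z \<in> \<I>"
      have "Y = Z #> inv a \<longleftrightarrow> Z = Y #> a"
        using Y Z a ai K_carrier by (auto simp: rt_rt rt_one)
      then show "(if Z = Y #> a then N X Z else 0) = N X Z * adjacency G H (double_coset G H a) Z Y"
        by (simp add: adjacency_K a Z Y)
    qed
    finally show ?thesis .
  next
    assume D: "D = double_coset G H (b \<otimes> a)"
    have "mtimes \<I> (adjacency G H D) N X Y = mtimes \<I> A\<^sub>b N (X #> inv a) Y"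
      unfolding mtimes_def D by (intro sum.cong refl) (simp add: adjacency_mult_K a X)
    also have "\<dots> = (\<Sum>Z\<in>\<I>. N (X #> inv a) (Z #> inv a) * A\<^sub>b (Z #> inv a) Y)"
      unfolding comm unfolding mtimes_def by (rule sum.reindex_bij_betw[OF bij_rt[OF ai], symmetric])
    also have "\<dots> = mtimes \<I> N (adjacency G H D) X Y"
      unfolding mtimes_def D
      by (intro sum.cong refl) (simp add: adjacency_mult_K a Y entry_rt_rt[OF N X _ ai])
    finally show ?thesis .
  qed
qed

lemma commute_combination:
  assumes "invariant M"
    and "\<And>D. D \<in> double_cosets G H \<Longrightarrow> mtimes \<I> (adjacency G H D) N = mtimes \<I> N (adjacency G H D)"
  shows "mtimes \<I> M N = mtimes \<I> N M"
proof -
  obtain c where c: "M = scheme_combination G H c"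
    using assms(1) scheme_algebra_iff unfolding scheme_algebra_def by blast
  show ?thesis unfolding c scheme_combination_def mtimes_sum_left mtimes_sum_right
    by (intro ext sum.cong refl) (simp add: assms(2))
qed

theorem invariant_commute:
  assumes M: "invariant M" and N: "invariant N"
  shows "mtimes \<I> M N = mtimes \<I> N M"
proof -
  have Ab: "invariant A\<^sub>b" using invariant_adjacency b_carrier by auto
  \<comment> \<open>The matrix \<open>A\<^sub>b\<close> commutes with itself, hence with every
    adjacency matrix and with \<open>N\<close>. This supplies the hypothesis for a second use of the
    same lemma, now for \<open>N\<close>.\<close>
  have "mtimes \<I> N A\<^sub>b = mtimes \<I> A\<^sub>b N"
    by (rule commute_combination[OF N adjacency_commute_step[OF Ab refl]])
  then show ?thesis
    by (intro commute_combination[OF M adjacency_commute_step[OF N]]) simp_all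
qed

corollary gelfand: "gelfand_pair G H"
  unfolding gelfand_pair_def
  using is_group finite_carrier H_subgroup invariant_commute scheme_algebra_iff by auto

text \<open>A joint eigenspace of the right translations. No multiplicativity of
  \<open>\<psi>\<close> is built in, so that the eigenvalues can be found for one \<open>k\<close>
  at a time.\<close>

definition equivariant :: "('a \<Rightarrow> complex) \<Rightarrow> 'a set cmatrix \<Rightarrow> bool" where
  "equivariant \<psi> M \<longleftrightarrow> invariant M \<and> (\<forall>k\<in>K. \<forall>X\<in>\<I>. \<forall>Y\<in>\<I>. M (X #> k) Y = \<psi> k * M X Y)"

lemma equivariant_invariant: "equivariant \<psi> M \<Longrightarrow> invariant M"
  unfolding equivariant_def by simp

lemma equivariant_ent:
  assumes "equivariant \<psi> M" "g \<in> carrier G" "k \<in> K"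
  shows "ent M (g \<otimes> k) = \<psi> k * ent M g"
proof -
  have "M ((g <# H) #> k) H = \<psi> k * M (g <# H) H"
    using assms coset_mem H_mem_cosets unfolding equivariant_def by blast
  then show ?thesis using assms by (simp add: ent_def rt_coset)
qed

lemma equivariant_ent_K: "equivariant \<psi> M \<Longrightarrow> k \<in> K \<Longrightarrow> ent M k = \<psi> k * ent M \<one>"
  using equivariant_ent[of \<psi> M \<one> k] K_carrier by simp

lemma equivariant_ent_outside:
  assumes "equivariant \<psi> M" "h \<in> H" "k \<in> K"
  shows "ent M (h \<otimes> b \<otimes> k) = \<psi> k * ent M b"
  using equivariant_ent[OF assms(1), of "h \<otimes> b" k] assms b_carrier H_carrier
    ent_lt[OF equivariant_invariant[OF assms(1)], of h b] by simp

text \<open>The sets \<open>K\<close> and \<open>H b K\<close> cover \<open>G\<close>, and on each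
  of them \<open>\<psi>\<close> propagates a single entry. The eigenspaces are thus at most
  two-dimensional, on which all later comparisons of matrices rest.\<close>

lemma equivariant_eqI:
  assumes "equivariant \<psi> M" "equivariant \<psi> N" "ent M \<one> = ent N \<one>" "ent M b = ent N b"
  shows "M = N"
proof (rule invariant_eqI)
  show "invariant M" "invariant N" using assms equivariant_invariant by auto
  fix g assume g: "g \<in> carrier G"
  show "ent M g = ent N g"
  proof (cases "g \<in> K")
    case True
    then show ?thesis using assms equivariant_ent_K by metis
  next
    case False
    obtain h k where "h \<in> H" "k \<in> K" "g = h \<otimes> b \<otimes> k" using outside_K[OF g False] .
    then show ?thesis using assms equivariant_ent_outside by metis
  qed
qed

lemma equivariant_lincomb:
  assumes "equivariant \<psi> M" "equivariant \<psi> N"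
  shows "equivariant \<psi> (\<lambda>X Y. s * M X Y + t * N X Y)"
  using assms unfolding equivariant_def by (auto simp: invariant_lincomb2 algebra_simps)

lemma equivariant_mtimes:
  assumes "equivariant \<psi> M" "invariant N"
  shows "equivariant \<psi> (mtimes \<I> M N)"
  using assms invariant_mtimes[of M N] unfolding equivariant_def mtimes_def
  by (auto simp: sum_distrib_left mult.assoc)

text \<open>Translation by the \<open>r\<close>th power of \<open>k\<close> is the identity, as that
  power lies in \<open>H\<close>; any nonzero entry then pins down the power of the
  eigenvalue.\<close>

lemma equivariant_pow:
  assumes M: "equivariant \<psi> M" and nz: "M \<noteq> (\<lambda>X Y. 0)" and k: "k \<in> K"
  shows "\<psi> k ^ r = 1"
proof -
  obtain X Y where XY: "M X Y \<noteq> 0" using nz by (auto simp: fun_eq_iff)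
  then have X: "X \<in> \<I>" "Y \<in> \<I>" using invariant_outside[OF equivariant_invariant[OF M]] by auto
  have "M (X #> k [^] n) Y = \<psi> k ^ n * M X Y" for n :: nat
  proof (induction n)
    case (Suc n)
    have "M (X #> k [^] Suc n) Y = M ((X #> k [^] n) #> k) Y"
      using X k K_pow by (simp add: rt_rt)
    also have "\<dots> = \<psi> k * M (X #> k [^] n) Y"
      using M X k rt_mem[OF K_pow[OF k] X(1)] unfolding equivariant_def by blast
    finally show ?case using Suc by simp
  qed (use X in \<open>simp add: rt_one\<close>)
  from this[of r] show ?thesis using XY X rt_H[OF X(1) K_pow_r[OF k]] by simp
qed

lemma ent_inv_b: "invariant M \<Longrightarrow> ent M (inv b) = ent M b"
proof -
  assume M: "invariant M"
  obtain h h' where h: "h \<in> H" "h' \<in> H" "inv b = h \<otimes> b \<otimes> h'" using inv_b .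
  show ?thesis unfolding h(3) using ent_lt[OF M h(1) b_carrier] ent_rt[OF M h(2), of "h \<otimes> b"] h b_carrier H_carrier
    by simp
qed

text \<open>Transposition inverts the argument of \<open>ent\<close>, and \<open>inv b\<close> lies
  in the double coset of \<open>b\<close>; being Hermitian therefore equates the entry at
  \<open>b\<close> with its own conjugate.\<close>

lemma selfadjoint_real:
  assumes "invariant M" "madjoint M = M"
  shows "ent M \<one> \<in> \<real>" "ent M b \<in> \<real>"
  using ent_madjoint[OF assms(1), of \<one>] ent_madjoint[OF assms(1) b_carrier] assms ent_inv_b[OF assms(1)]
  by (auto simp: Reals_cnj_iff)

end

section \<open>Eigenvalues of right translation\<close>

text \<open>Orthogonality of the characters of a cyclic group, as a geometric sum.\<close>

lemma sum_powers_of_roots_unity: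
  assumes "m > 0" "j < m"
  shows "(\<Sum>z | z ^ m = 1. z ^ j) = (if j = 0 then of_nat m else (0::complex))"
proof -
  have bij: "bij_betw (\<lambda>k. cis (2 * pi * real k / real m)) {..<m} {z. z ^ m = 1}"
    using bij_betw_roots_unity[OF assms(1)] .
  define \<zeta> where "\<zeta> = cis (2 * pi / real m)"
  have z: "cis (2 * pi * real k / real m) = \<zeta> ^ k" for k
    unfolding \<zeta>_def Complex.DeMoivre by (simp add: mult_ac)
  have bij: "bij_betw (\<lambda>k. \<zeta> ^ k) {..<m} {z. z ^ m = 1}" using bij by (simp add: z)
  have "(\<Sum>z | z ^ m = 1. z ^ j) = (\<Sum>k<m. (\<zeta> ^ k) ^ j)"
    by (rule sum.reindex_bij_betw[OF bij, symmetric])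
  also have "\<dots> = (\<Sum>k<m. (\<zeta> ^ j) ^ k)"
    by (simp add: power_mult[symmetric] mult.commute)
  also have "\<dots> = (if j = 0 then of_nat m else 0)"
  proof (cases "j = 0")
    case False
    \<comment> \<open>Here \<open>j < m\<close> matters: the enumeration of the roots is injective
      below \<open>m\<close>.\<close>
    have "\<zeta> ^ j \<noteq> \<zeta> ^ 0"
      using bij False assms unfolding bij_betw_def by (metis inj_on_eq_iff lessThan_iff)
    then have "\<zeta> ^ j \<noteq> 1" by simp
    moreover have "(\<zeta> ^ j) ^ m = 1"
      using z[of m] assms(1) by (simp add: power_mult[symmetric] mult.commute[of j]) (simp add: power_mult)
    ultimately show ?thesis using False geometric_sum[of "\<zeta> ^ j" m] by simp
  qed simp
  finally show ?thesis .
qed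

text \<open>Needed to multiply averages over a cyclic group.\<close>

lemma sum_periodic:
  fixes f :: "nat \<Rightarrow> 'b::ab_group_add"
  assumes "\<And>j. f (j + m) = f j"
  shows "(\<Sum>j<m. f (i + j)) = (\<Sum>j<m. f j)"
proof (induction i)
  case (Suc i)
  have "(\<Sum>j<m. f (Suc i + j)) + f i = (\<Sum>j<Suc m. f (i + j))"
    by (subst sum.lessThan_Suc_shift) simp
  also have "\<dots> = (\<Sum>j<m. f (i + j)) + f i" using assms[of i] by simp
  finally show ?case using Suc by simp
qed simp

lemma mtimes_lincomb_left:
  "mtimes I (\<lambda>i j. s * A i j + t * B i j) N = (\<lambda>i j. s * mtimes I A N i j + t * mtimes I B N i j)"
  unfolding mtimes_def by (intro ext) (simp add: sum_distrib_left sum.distrib algebra_simps)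

lemma mtimes_lincomb_right:
  "mtimes I N (\<lambda>i j. s * A i j + t * B i j) = (\<lambda>i j. s * mtimes I N A i j + t * mtimes I N B i j)"
  unfolding mtimes_def by (intro ext) (simp add: sum_distrib_left sum.distrib algebra_simps)

text \<open>The diagonal of the square of a Hermitian matrix consists of squared column norms;
  positivity of traces and of diagonal entries is drawn from here.\<close>

lemma mtimes_self_diag:
  assumes "madjoint M = M"
  shows "mtimes I M M i i = of_real (\<Sum>k\<in>I. (cmod (M k i))\<^sup>2)"
proof -
  have "M i k = cnj (M k i)" for k
    using fun_cong[OF fun_cong[OF assms], of i k] by (simp add: madjoint_def)
  then show ?thesis unfolding mtimes_def of_real_sum complex_norm_square by (simp add: mult.commute)
qed

context finite_pair
begin

text \<open>Left translation by \<open>x\<close> carries the fiber over \<open>K\<close> bijectively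
  to the fiber over \<open>x <# K\<close>.\<close>

lemma card_K_fiber:
  assumes "C \<in> lcosets K"
  shows "card {X \<in> \<I>. X <#> K = C} = r"
proof -
  obtain x where x: "x \<in> carrier G" "C = x <# K" using assms unfolding LCOSETS_def by auto
  have "{X \<in> \<I>. X <#> K = C} = (\<lambda>X. x <# X) ` (\<lambda>k. k <# H) ` K"
  proof (intro equalityI subsetI)
    fix X assume "X \<in> {X \<in> \<I>. X <#> K = C}"
    then have X: "X \<in> \<I>" "X <#> K = x <# K" using x by auto
    obtain y where y: "y \<in> carrier G" "X = y <# H" using coset_cases[OF X(1)] .
    then have "y <# K = x <# K" using X(2) coset_set_mult_K by simp
    then have "inv x \<otimes> y \<in> K" using l_coset_eq_iff[OF K_subgroup] x y by simp
    moreover have "X = x <# ((inv x \<otimes> y) <# H)" using x y by (simp add: lt_coset inv_cancel_left)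
    ultimately show "X \<in> (\<lambda>X. x <# X) ` (\<lambda>k. k <# H) ` K" by blast
  next
    fix X assume "X \<in> (\<lambda>X. x <# X) ` (\<lambda>k. k <# H) ` K"
    then obtain k where k: "k \<in> K" "X = (x \<otimes> k) <# H" using x K_carrier by (auto simp: lt_coset)
    then have "X <#> K = (x \<otimes> k) <# K" using x K_carrier coset_set_mult_K by simp
    also have "\<dots> = x <# K"
      using l_coset_eq_iff[OF K_subgroup, of "x \<otimes> k" x] x k K_carrier by (simp add: inv_cancel_left)
    finally show "X \<in> {X \<in> \<I>. X <#> K = C}" using k x K_carrier coset_mem by simp
  qed
  moreover have "inj_on (\<lambda>X. x <# X) ((\<lambda>k. k <# H) ` K)"
  proof (rule inj_on_subset)
    show "inj_on (\<lambda>X. x <# X) \<I>" using bij_lt[OF x(1)] by (rule bij_betw_imp_inj_on)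
    show "(\<lambda>k. k <# H) ` K \<subseteq> \<I>" using coset_mem K_carrier by auto
  qed
  ultimately show ?thesis unfolding r_eq by (simp add: card_image)
qed

definition "n = subgroup_index G (carrier G) K"

lemma n_eq: "n = card (lcosets K)"
  unfolding n_def subgroup_index_def by simp

lemma finite_K_cosets: "finite (lcosets K)"
  unfolding LCOSETS_def using finite_carrier by auto

lemma K_coset_mem: "x \<in> carrier G \<Longrightarrow> x <# K \<in> lcosets K"
  unfolding LCOSETS_def by auto

lemma set_mult_K_mem: "X \<in> \<I> \<Longrightarrow> X <#> K \<in> lcosets K"
  by (auto elim!: coset_cases simp: coset_set_mult_K K_coset_mem)

lemma card_cosets: "card \<I> = n * r"
proof -
  have "card \<I> = (\<Sum>C\<in>lcosets K. card {X \<in> \<I>. X <#> K = C})"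
    using sum.group[OF finite_cosets finite_K_cosets, of "\<lambda>X. X <#> K" "\<lambda>_. 1::nat"] set_mult_K_mem
    by (force simp: image_subset_iff)
  then show ?thesis by (simp add: card_K_fiber n_eq)
qed

end

context key_pair
begin

text \<open>The right translate of \<open>M\<close> by \<open>k\<close> is its product with the adjacency matrix of the
  double coset of \<open>inv k\<close>.\<close>

definition shift :: "'a \<Rightarrow> 'a set cmatrix \<Rightarrow> 'a set cmatrix" where
  "shift k M = (\<lambda>X Y. if X \<in> \<I> \<and> Y \<in> \<I> then M (X #> k) Y else 0)"

lemma shift_invariant:
  assumes "invariant M" "k \<in> K"
  shows "invariant (shift k M)"
  unfolding invariant_def shift_def
  using assms lt_mem rt_mem by (auto simp: lt_rt invariant_lt)

text \<open>The translation in the second factor is absorbed by reindexing the sum, since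
  translating both indices of \<open>M\<close> at once changes no entry.\<close>

lemma shift_mtimes:
  assumes M: "invariant M" and N: "invariant N" and k: "k \<in> K" and l: "l \<in> K"
  shows "mtimes \<I> (shift k M) (shift l N) = shift (k \<otimes> l) (mtimes \<I> M N)"
proof (intro ext)
  fix X Y
  show "mtimes \<I> (shift k M) (shift l N) X Y = shift (k \<otimes> l) (mtimes \<I> M N) X Y"
  proof (cases "X \<in> \<I> \<and> Y \<in> \<I>")
    case True
    then have X: "X \<in> \<I>" and Y: "Y \<in> \<I>" by auto
    have "mtimes \<I> (shift k M) (shift l N) X Y = (\<Sum>Z\<in>\<I>. M (X #> k) Z * N (Z #> l) Y)"
      unfolding mtimes_def shift_def using True by (intro sum.cong) auto
    also have "\<dots> = (\<Sum>Z\<in>\<I>. M (X #> (k \<otimes> l)) (Z #> l) * N (Z #> l) Y)"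
      using entry_rt_rt[OF M rt_mem[OF k X] _ l] by (intro sum.cong) (simp_all add: rt_rt X k l)
    also have "\<dots> = (\<Sum>Z\<in>\<I>. M (X #> (k \<otimes> l)) Z * N Z Y)"
      by (rule sum.reindex_bij_betw[OF bij_rt[OF l]])
    finally show ?thesis unfolding shift_def mtimes_def using True by simp
  qed (auto simp: mtimes_def shift_def)
qed

lemma shift_madjoint:
  assumes M: "invariant M" and k: "k \<in> K"
  shows "madjoint (shift k M) = shift (inv k) (madjoint M)"
  unfolding madjoint_def shift_def
  using entry_rt_left[OF M _ _ k] by (auto simp: fun_eq_iff)

lemma shift_H:
  assumes M: "invariant M" and h: "h \<in> H"
  shows "shift h M = M"
  unfolding shift_def using rt_H h invariant_outside[OF M] by (auto simp: fun_eq_iff)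

lemma shift_shift:
  assumes "k \<in> K" "l \<in> K"
  shows "shift k (shift l M) = shift (k \<otimes> l) M"
  unfolding shift_def using assms rt_mem by (auto simp: fun_eq_iff rt_rt)

text \<open>The translates \<open>S j\<close> of \<open>E\<close> by powers of \<open>k\<close> form
  a cyclic group with identity \<open>E\<close>. Its Fourier components \<open>F z\<close> are
  projections below \<open>E\<close> that add up to \<open>E\<close>; some component is nonzero and,
  by minimality, equal to \<open>E\<close>, so \<open>E\<close> is an eigenvector with eigenvalue
  \<open>inverse z\<close>.\<close>

lemma primitive_eigenvalue:
  assumes E: "primitive_idempotent G H E" and k: "k \<in> K"
  obtains \<omega> where "\<And>X Y. X \<in> \<I> \<Longrightarrow> Y \<in> \<I> \<Longrightarrow> E (X #> k) Y = \<omega> * E X Y"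
proof -
  have inv: "invariant E" and idem: "mtimes \<I> E E = E" and adj: "madjoint E = E"
    and nz: "E \<noteq> (\<lambda>X Y. 0)"
    using E scheme_algebra_iff unfolding primitive_idempotent_def scheme_projection_def by auto
  define S where "S j = shift (k [^] j) E" for j :: nat
  have kc: "k \<in> carrier G" using k K_carrier by auto
  have S_inv: "invariant (S j)" for j unfolding S_def using shift_invariant[OF inv K_pow[OF k]] .
  have S_mult: "mtimes \<I> (S i) (S j) = S (i + j)" for i j
    unfolding S_def using shift_mtimes[OF inv inv K_pow[OF k] K_pow[OF k]] idem
    by (simp add: nat_pow_mult kc)
  have S_0: "S 0 = E" unfolding S_def using shift_H[OF inv H_one] by simp
  have S_per: "S (j + r) = S j" for j
  proof -
    have "S (j + r) = shift (k [^] j) (shift (k [^] r) E)"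
      unfolding S_def using shift_shift[OF K_pow[OF k] K_pow[OF k], of j r E] kc by (simp add: nat_pow_mult)
    then show ?thesis using shift_H[OF inv K_pow_r[OF k]] unfolding S_def by simp
  qed
  have S_adj: "madjoint (S j) = S (r - j)" if "j \<le> r" for j
  proof -
    have "k [^] (r - j) \<otimes> k [^] j = k [^] r" using that kc by (simp add: nat_pow_mult)
    then have eq: "inv (k [^] j) \<otimes> (k [^] r) = k [^] (r - j)"
      using kc inv_cancel_left(2)[of "k [^] j" "k [^] (r - j)"] that by (simp add: nat_pow_mult)
    have "madjoint (S j) = shift (inv (k [^] j)) (shift (k [^] r) E)"
      unfolding S_def using shift_madjoint[OF inv K_pow[OF k]] adj shift_H[OF inv K_pow_r[OF k]] by simp
    also have "\<dots> = S (r - j)"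
      unfolding S_def using shift_shift[OF K_inv[OF K_pow[OF k]] K_pow[OF k]] eq by simp
    finally show ?thesis .
  qed
  \<comment> \<open>The component on which translation by \<open>k\<close> acts as
    \<open>inverse z\<close>; division by \<open>r\<close> makes it idempotent.\<close>
  define F where "F z = (\<lambda>X Y. \<Sum>j<r. (z ^ j / of_nat r) * S j X Y)" for z :: complex
  have F_eq: "F z X Y = (\<Sum>j<r. z ^ j * S j X Y) / of_nat r" for z X Y
    unfolding F_def by (simp add: sum_divide_distrib)
  have F_inv: "invariant (F z)" for z unfolding F_def by (rule invariant_lincomb) (rule S_inv)
  have r0: "complex_of_nat r \<noteq> 0" using r_pos by simp
  have EF: "mtimes \<I> E (F z) = F z" for z
    unfolding F_def mtimes_sum_right using S_mult[of 0] by (simp add: S_0)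
  have per: "z ^ (j + r) * S (j + r) X Y = z ^ j * S j X Y" if "z ^ r = 1" for z j X Y
    using that by (simp add: S_per power_add)
  have proj: "scheme_projection G H (F z)" if z: "z ^ r = 1" for z
    unfolding scheme_projection_def
  proof (intro conjI)
    show "F z \<in> scheme_algebra G H" using F_inv scheme_algebra_iff by simp
    have "mtimes \<I> (F z) (F z) X Y = F z X Y" for X Y
    proof -
      have "mtimes \<I> (F z) (F z) X Y = (\<Sum>i<r. \<Sum>j<r. z ^ (i + j) * S (i + j) X Y / (of_nat r * of_nat r))"
        unfolding F_def mtimes_sum_left mtimes_sum_right S_mult
        by (simp add: sum_distrib_left sum_distrib_right power_add mult_ac)
      also have "\<dots> = (\<Sum>i<r. (\<Sum>j<r. z ^ (i + j) * S (i + j) X Y) / (of_nat r * of_nat r))"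
        by (simp add: sum_divide_distrib)
      also have "\<dots> = (\<Sum>i<r. (\<Sum>j<r. z ^ j * S j X Y) / (of_nat r * of_nat r))"
        using sum_periodic[of "\<lambda>j. z ^ j * S j X Y" r, OF per[OF z]] by simp
      also have "\<dots> = F z X Y" using r0 by (simp add: F_eq)
      finally show ?thesis .
    qed
    then show "mtimes \<I> (F z) (F z) = F z" by (intro ext)
    have nz: "cmod z = 1"
      using power_eq_imp_eq_base[of "cmod z" r 1] r_pos z by (simp add: norm_power[symmetric])
    have zc: "cnj z ^ j = z ^ (r - j)" if "j \<le> r" for j
    proof -
      have "cnj z * z = 1" using complex_norm_square[of z] nz by (simp add: mult.commute)
      then have "cnj z ^ j * z ^ j = 1" by (simp add: power_mult_distrib[symmetric])
      moreover have "z ^ (r - j) * z ^ j = 1" using that z by (simp add: power_add[symmetric])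
      moreover have "z ^ j \<noteq> 0" using nz by auto
      ultimately show ?thesis using mult_right_cancel[of "z ^ j" "cnj z ^ j" "z ^ (r - j)"] by simp
    qed
    have "cnj (F z Y X) = F z X Y" for X Y
    proof -
      have "cnj (F z Y X) = (\<Sum>j<r. cnj z ^ j / of_nat r * madjoint (S j) X Y)"
        unfolding F_def madjoint_def by simp
      also have "\<dots> = (\<Sum>j<r. z ^ (r - j) / of_nat r * S (r - j) X Y)"
        by (intro sum.cong) (simp_all add: zc S_adj)
      \<comment> \<open>While \<open>j\<close> runs from \<open>0\<close> to \<open>r - 1\<close>,
        the index \<open>r - j\<close> runs from \<open>r\<close> down to \<open>1\<close>.
        Reversing the order and shifting by one period step restores the original range.\<close>
      also have "\<dots> = (\<Sum>j<r. z ^ (r - Suc j + 1) * S (r - Suc j + 1) X Y) / of_nat r"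
        unfolding sum_divide_distrib by (intro sum.cong) (simp_all add: Suc_diff_Suc)
      also have "\<dots> = (\<Sum>j<r. z ^ (j + 1) * S (j + 1) X Y) / of_nat r"
        using sum.nat_diff_reindex[of "\<lambda>j. z ^ (j + 1) * S (j + 1) X Y" r] by simp
      also have "\<dots> = (\<Sum>j<r. z ^ j * S j X Y) / of_nat r"
        using sum_periodic[of "\<lambda>j. z ^ j * S j X Y" r 1, OF per[OF z]] by (simp add: add.commute)
      also have "\<dots> = F z X Y" by (simp add: F_eq)
      finally show ?thesis .
    qed
    then show "madjoint (F z) = F z" unfolding madjoint_def by (intro ext)
  qed
  have sum_F: "(\<Sum>z | z ^ r = 1. F z X Y) = E X Y" for X Y
  proof -
    have "(\<Sum>z | z ^ r = 1. F z X Y) = (\<Sum>j<r. \<Sum>z | z ^ r = 1. (z ^ j / of_nat r) * S j X Y)"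
      unfolding F_def by (rule sum.swap)
    also have "\<dots> = (\<Sum>j<r. (\<Sum>z | z ^ r = 1. z ^ j) / of_nat r * S j X Y)"
      by (simp add: sum_distrib_right sum_divide_distrib)
    also have "\<dots> = (\<Sum>j<r. if j = 0 then S j X Y else 0)"
      using r0 by (intro sum.cong refl) (simp add: sum_powers_of_roots_unity)
    also have "\<dots> = E X Y" using r_pos by (simp add: S_0)
    finally show ?thesis .
  qed
  obtain z where z: "z ^ r = 1" "F z \<noteq> (\<lambda>X Y. 0)"
  proof (rule ccontr)
    assume "\<not> thesis"
    then have "F z = (\<lambda>X Y. 0)" if "z ^ r = 1" for z using that \<open>\<And>z. \<lbrakk>z ^ r = 1; F z \<noteq> (\<lambda>X Y. 0)\<rbrakk> \<Longrightarrow> thesis\<close> by blast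
    then have "E X Y = 0" for X Y using sum_F[of X Y, symmetric] by simp
    then show False using nz by blast
  qed
  then have FE: "F z = E" using E proj[OF z(1)] EF unfolding primitive_idempotent_def by blast
  have z0: "z \<noteq> 0" using z(1) r_pos by (auto simp: power_0_left)
  have "E (X #> k) Y = inverse z * E X Y" if X: "X \<in> \<I>" and Y: "Y \<in> \<I>" for X Y
  proof -
    have sh: "S j (X #> k) Y = S (Suc j) X Y" for j
    proof -
      have "k \<otimes> k [^] j = k [^] Suc j" using nat_pow_Suc2[OF kc] by simp
      then show ?thesis unfolding S_def shift_def using X Y rt_mem[OF k X] rt_rt[OF X k K_pow[OF k]] by simp
    qed
    have "z * E (X #> k) Y = z * F z (X #> k) Y" using FE by simp
    also have "\<dots> = (\<Sum>j<r. z ^ (1 + j) * S (1 + j) X Y) / of_nat r"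
      unfolding F_eq sh by (simp add: sum_distrib_left mult_ac)
    also have "\<dots> = (\<Sum>j<r. z ^ j * S j X Y) / of_nat r"
      using sum_periodic[of "\<lambda>j. z ^ j * S j X Y" r 1, OF per[OF z(1)]] by simp
    also have "\<dots> = F z X Y" by (simp add: F_eq)
    also have "\<dots> = E X Y" using FE by simp
    finally show ?thesis using z0 by (simp add: field_simps)
  qed
  then show ?thesis using that by blast
qed

lemma primitive_equivariant:
  assumes "primitive_idempotent G H E"
  obtains \<psi> where "equivariant \<psi> E"
proof -
  have "invariant E"
    using assms scheme_algebra_iff unfolding primitive_idempotent_def scheme_projection_def by auto
  moreover have "\<forall>k\<in>K. \<exists>\<omega>. \<forall>X\<in>\<I>. \<forall>Y\<in>\<I>. E (X #> k) Y = \<omega> * E X Y"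
    using primitive_eigenvalue[OF assms] by metis
  ultimately show ?thesis using that unfolding equivariant_def by metis
qed

end

section \<open>Entries of primitive idempotents\<close>

context key_pair
begin

lemma ent_adjacency_b:
  "g \<in> carrier G \<Longrightarrow> ent A\<^sub>b g = (if g \<in> double_coset G H b then 1 else 0)"
  using adjacency_entry[of g \<one> b] b_carrier by (simp add: ent_def one_coset)

lemma inv_mem_double_coset_b:
  assumes "g \<in> double_coset G H b"
  shows "inv g \<in> double_coset G H b"
proof -
  obtain h h' where h: "h \<in> H" "h' \<in> H" "g = h \<otimes> b \<otimes> h'"
    using assms mem_double_coset[OF H_subgroup b_carrier] by auto
  obtain l l' where l: "l \<in> H" "l' \<in> H" "inv b = l \<otimes> b \<otimes> l'" using inv_b .
  have "inv g = inv h' \<otimes> inv b \<otimes> inv h"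
    using h b_carrier H_carrier by (simp add: inv_mult_group m_assoc)
  also have "\<dots> = (inv h' \<otimes> l) \<otimes> b \<otimes> (l' \<otimes> inv h)"
    unfolding l(3) using h(1,2) l(1,2) b_carrier H_carrier by (simp add: m_assoc)
  finally show ?thesis
    using mem_double_coset[OF H_subgroup b_carrier] H_mult[OF H_inv[OF h(2)] l(1)] H_mult[OF l(2) H_inv[OF h(1)]]
    by blast
qed

lemma double_coset_b_disjoint: "g \<in> double_coset G H b \<Longrightarrow> g \<notin> K"
proof
  assume "g \<in> double_coset G H b" and g: "g \<in> K"
  then obtain h h' where h: "h \<in> H" "h' \<in> H" "g = h \<otimes> b \<otimes> h'"
    using mem_double_coset[OF H_subgroup b_carrier] by auto
  then have "b = inv h \<otimes> g \<otimes> inv h'" using b_carrier H_carrier by (simp add: m_assoc inv_cancel_left)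
  then have "b \<in> K" using K_mult[OF K_mult[OF H_K[OF H_inv[OF h(1)]] g] H_K[OF H_inv[OF h(2)]]] by simp
  then show False using b_notin by simp
qed

lemma madjoint_adjacency_b: "madjoint A\<^sub>b = A\<^sub>b"
proof (rule invariant_eqI)
  show Ab: "invariant A\<^sub>b" "invariant (madjoint A\<^sub>b)"
    using invariant_adjacency b_carrier invariant_madjoint by auto
  fix g assume g: "g \<in> carrier G"
  have "inv g \<in> double_coset G H b \<longleftrightarrow> g \<in> double_coset G H b"
    using inv_mem_double_coset_b[of g] inv_mem_double_coset_b[of "inv g"] g by auto
  then show "ent (madjoint A\<^sub>b) g = ent A\<^sub>b g"
    using g by (simp add: ent_madjoint[OF Ab(1)] ent_adjacency_b)
qed

text \<open>A vanishing entry at \<open>b\<close> confines \<open>M\<close> to pairs over the same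
  coset of \<open>K\<close>. A nonzero term of the product at \<open>g\<close> then needs
  \<open>z\<close> in \<open>H b H\<close> with \<open>inv z \<otimes> g\<close> in
  \<open>K\<close>: impossible for \<open>g = \<one>\<close>, and for \<open>g = b\<close> possible
  only on the coset of \<open>b\<close>, by the last condition on the key.\<close>

lemma block_times_adjacency_b:
  assumes M: "equivariant \<psi> M" and Mb: "ent M b = 0"
  shows "ent (mtimes \<I> M A\<^sub>b) \<one> = 0" "ent (mtimes \<I> M A\<^sub>b) b = ent M \<one>"
proof -
  have inv: "invariant M" "invariant A\<^sub>b"
    using M equivariant_invariant invariant_adjacency b_carrier by auto
  have out: "ent M g = 0" if "g \<in> carrier G" "g \<notin> K" for g
    using outside_K[OF that] equivariant_ent_outside[OF M] Mb by (metis mult_zero_right)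
  have summand: "M (g <# H) (z <# H) * A\<^sub>b (z <# H) H
      = (if inv z \<otimes> g \<in> K \<and> z \<in> double_coset G H b then ent M (inv z \<otimes> g) else 0)"
    if "g \<in> carrier G" "z \<in> carrier G" for g z
    using that out[of "inv z \<otimes> g"] invariant_entry[OF inv(1), of g z]
      ent_adjacency_b[OF that(2)] unfolding ent_def[of A\<^sub>b] by auto
  have "M (\<one> <# H) Z * A\<^sub>b Z H = 0" if Z: "Z \<in> \<I>" for Z
  proof -
    obtain z where z: "z \<in> carrier G" "Z = z <# H" using coset_cases[OF Z] .
    have "z \<notin> double_coset G H b" if "inv z \<in> K"
      using double_coset_b_disjoint[of z] K_inv[OF that] z by auto
    then show ?thesis using summand[OF one_closed z(1)] z by auto
  qed
  then show "ent (mtimes \<I> M A\<^sub>b) \<one> = 0" unfolding ent_def mtimes_def by simp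
  have "M (b <# H) Z * A\<^sub>b Z H = (if Z = b <# H then ent M \<one> else 0)" if Z: "Z \<in> \<I>" for Z
  proof (cases "Z = b <# H")
    case True
    then show ?thesis
      using summand[OF b_carrier b_carrier] b_carrier double_coset_self[OF b_carrier] H_K[OF H_one] by simp
  next
    case False
    obtain z where z: "z \<in> carrier G" "Z = z <# H" using coset_cases[OF Z] .
    have "\<not> (inv z \<otimes> b \<in> K \<and> z \<in> double_coset G H b)"
    proof
      assume zb: "inv z \<otimes> b \<in> K \<and> z \<in> double_coset G H b"
      define k where "k = inv (inv z \<otimes> b)"
      have k: "k \<in> K" using zb K_inv unfolding k_def by blast
      have zk: "z = b \<otimes> k"
        using z b_carrier unfolding k_def by (simp add: inv_mult_group inv_cancel_left)
      \<comment> \<open>Entries of \<open>A\<^sub>b\<close> do not distinguish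
        \<open>b \<otimes> k\<close> from \<open>k \<otimes> b\<close>, so \<open>k\<close> can be
        moved to the side on which the key condition applies.\<close>
      have "ent A\<^sub>b (k \<otimes> b) = 1"
        using ent_commute_K[OF inv(2) k b_carrier] ent_adjacency_b[OF z(1)] zb zk by simp
      then have "k \<otimes> b \<in> double_coset G H b"
        using ent_adjacency_b[of "k \<otimes> b"] k K_carrier b_carrier by (simp split: if_splits)
      then have "k \<in> H" using key_faithful[OF k] mem_double_coset[OF H_subgroup b_carrier] by metis
      then have "z <# H = b <# H"
        using zk z b_carrier H_carrier by (simp add: lt_coset[symmetric] coset_absorb)
      then show False using False z by simp
    qed
    then show ?thesis using summand[OF b_carrier z(1)] z False by auto
  qed
  then show "ent (mtimes \<I> M A\<^sub>b) b = ent M \<one>"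
    unfolding ent_def[of _ b] mtimes_def
    using finite_cosets coset_mem[OF b_carrier] by simp
qed

lemma projection_one:
  assumes "invariant E" "mtimes \<I> E E = E" "madjoint E = E"
  shows "ent E \<one> = of_real (\<Sum>Z\<in>\<I>. (cmod (E Z H))\<^sup>2)"
  using mtimes_self_diag[OF assms(3), of \<I> H] assms(2) by (simp add: ent_def one_coset)

text \<open>Otherwise \<open>E\<close> and its product \<open>B\<close> with
  \<open>A\<^sub>b\<close> live on complementary entries and span the eigenspace, so the square of
  \<open>B\<close> is \<open>p\<close> times \<open>E\<close> plus \<open>q\<close> times
  \<open>B\<close>. As \<open>p > 0\<close>, this quadratic relation has two distinct real roots,
  and the spectral projection for one of them lies properly below \<open>E\<close>.\<close>

lemma primitive_ent_b:
  assumes E: "primitive_idempotent G H E" and eq: "equivariant \<psi> E"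
  shows "ent E b \<noteq> 0"
proof
  assume E0: "ent E b = 0"
  have inv: "invariant E" and idem: "mtimes \<I> E E = E" and adj: "madjoint E = E"
    and nz: "E \<noteq> (\<lambda>X Y. 0)"
    using E scheme_algebra_iff unfolding primitive_idempotent_def scheme_projection_def by auto
  have Ab: "invariant A\<^sub>b" using invariant_adjacency b_carrier by auto
  define e where "e = ent E \<one>"
  have e0: "e \<noteq> 0"
  proof
    assume "e = 0"
    have "E = (\<lambda>X Y. 0)"
      by (rule equivariant_eqI[OF eq])
        (use E0 \<open>e = 0\<close> in \<open>auto simp: e_def equivariant_def invariant_def ent_def\<close>)
    then show False using nz by simp
  qed
  define B where "B = mtimes \<I> E A\<^sub>b"
  have Beq: "equivariant \<psi> B" unfolding B_def using equivariant_mtimes[OF eq Ab] .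
  have B1: "ent B \<one> = 0" and Bb: "ent B b = e"
    unfolding B_def e_def using block_times_adjacency_b[OF eq E0] by auto
  have BE: "mtimes \<I> E B = B" unfolding B_def using idem by (simp add: mtimes_assoc[symmetric])
  have EB: "mtimes \<I> B E = B"
    using BE invariant_commute[OF inv equivariant_invariant[OF Beq]] by simp
  have Badj: "madjoint B = B"
    unfolding B_def madjoint_mtimes adj madjoint_adjacency_b using invariant_commute[OF inv Ab] by simp
  define C where "C = mtimes \<I> B B"
  have Ceq: "equivariant \<psi> C"
    unfolding C_def using equivariant_mtimes[OF Beq equivariant_invariant[OF Beq]] .
  have Cadj: "madjoint C = C" unfolding C_def madjoint_mtimes Badj ..
  obtain t where t: "e = of_real t" "t > 0"
  proof -
    define s where "s = (\<Sum>Z\<in>\<I>. (cmod (E Z H))\<^sup>2)"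
    have "e = of_real s" unfolding e_def s_def using projection_one[OF inv idem adj] .
    moreover have "s \<ge> 0" unfolding s_def by (simp add: sum_nonneg)
    ultimately show ?thesis using that[of s] e0 by auto
  qed
  \<comment> \<open>Both coefficients are normalized by \<open>e\<close>, the entry of
    \<open>E\<close> at \<open>\<one>\<close> and also that of \<open>B\<close> at
    \<open>b\<close>.\<close>
  obtain p where p: "ent C \<one> = of_real p * e" "p > 0"
  proof -
    define s where "s = (\<Sum>Z\<in>\<I>. (cmod (B Z H))\<^sup>2)"
    have "ent C \<one> = of_real s"
      unfolding s_def C_def using mtimes_self_diag[OF Badj, of \<I> H] by (simp add: ent_def one_coset)
    moreover have "(cmod (B (b <# H) H))\<^sup>2 \<le> s"
      unfolding s_def using finite_cosets coset_mem[OF b_carrier] by (intro member_le_sum) auto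
    moreover have "(cmod (B (b <# H) H))\<^sup>2 > 0" using Bb e0 by (simp add: ent_def)
    ultimately have "ent C \<one> = of_real s" "s > 0" by (blast, linarith)
    moreover have "of_real (s / t) * e = of_real s"
      using t by simp
    ultimately show ?thesis using that[of "s / t"] t by simp
  qed
  obtain q where q: "ent C b = of_real q * e"
  proof -
    obtain s where "ent C b = of_real s"
      using selfadjoint_real(2)[OF equivariant_invariant[OF Ceq] Cadj] unfolding Reals_def by auto
    moreover have "of_real (s / t) * e = of_real s"
      using t by simp
    ultimately show ?thesis using that[of "s / t"] by simp
  qed
  have C: "C = (\<lambda>X Y. of_real p * E X Y + of_real q * B X Y)"
  proof (rule equivariant_eqI[OF Ceq equivariant_lincomb[OF eq Beq]])
    show "ent C \<one> = ent (\<lambda>X Y. of_real p * E X Y + of_real q * B X Y) \<one>"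
      using p(1) B1 by (simp add: ent_def e_def)
    show "ent C b = ent (\<lambda>X Y. of_real p * E X Y + of_real q * B X Y) b"
      using q Bb E0 by (simp add: ent_def)
  qed
  \<comment> \<open>The roots of \<open>x^2 = q x + p\<close> differ by \<open>s\<close>, and
    \<open>l\<close> is the smaller one; \<open>P = (B - l E) / s\<close> is the projection that
    belongs to the larger one.\<close>
  define s where "s = sqrt (q\<^sup>2 + 4 * p)"
  have s: "s > 0" "s\<^sup>2 = q\<^sup>2 + 4 * p" unfolding s_def using p(2) by (auto simp: add_nonneg_pos)
  define l where "l = (q - s) / 2"
  have ls: "q - 2 * l = s" "p + l * l = - l * s"
    unfolding l_def using s(2) by (simp_all add: power2_eq_square field_simps)
  define u v where "u = complex_of_real (- l / s)" and "v = complex_of_real (1 / s)"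
  define P where "P = (\<lambda>X Y. u * E X Y + v * B X Y)"
  have Peq: "equivariant \<psi> P" unfolding P_def using equivariant_lincomb[OF eq Beq] .
  have "u * u + v * v * of_real p = u" "u * v + u * v + v * v * of_real q = v"
  proof -
    have "(- l / s) * (- l / s) + (1 / s) * (1 / s) * p = (p + l * l) / (s * s)"
      by (simp add: add_divide_distrib)
    also have "\<dots> = - l / s" unfolding ls(2) using s(1) by simp
    finally show "u * u + v * v * of_real p = u"
      unfolding u_def v_def by (metis of_real_add of_real_mult)
    have "(- l / s) * (1 / s) + (- l / s) * (1 / s) + (1 / s) * (1 / s) * q = (q - 2 * l) / (s * s)"
      using s(1) by (simp add: divide_simps)
    also have "\<dots> = 1 / s" unfolding ls(1) using s(1) by simp
    finally show "u * v + u * v + v * v * of_real q = v"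
      unfolding u_def v_def by (metis of_real_add of_real_mult)
  qed
  note uv = this
  have "mtimes \<I> P P = P"
  proof (intro ext)
    fix X Y
    have "mtimes \<I> P P X Y = (u * u + v * v * of_real p) * E X Y + (u * v + u * v + v * v * of_real q) * B X Y"
      unfolding P_def mtimes_lincomb_left mtimes_lincomb_right idem BE EB C_def[symmetric] C
      by (simp add: algebra_simps)
    then show "mtimes \<I> P P X Y = P X Y" unfolding uv P_def .
  qed
  moreover have "madjoint P = P"
  proof -
    have "cnj (E Y X) = E X Y" "cnj (B Y X) = B X Y" for X Y
      using fun_cong[OF fun_cong[OF adj]] fun_cong[OF fun_cong[OF Badj]] unfolding madjoint_def by auto
    then show ?thesis unfolding madjoint_def P_def u_def v_def by simp
  qed
  ultimately have "scheme_projection G H P"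
    unfolding scheme_projection_def using scheme_algebra_iff equivariant_invariant[OF Peq] by simp
  moreover have Pb: "ent P b \<noteq> 0"
    using E0 Bb e0 s(1) unfolding P_def ent_def v_def by simp
  moreover have "mtimes \<I> E P = P" unfolding P_def mtimes_lincomb_right idem BE ..
  ultimately have "P = E" using E unfolding primitive_idempotent_def by (auto simp: ent_def)
  then show False using Pb E0 by simp
qed

lemma fiber_K: "{X \<in> \<I>. X <#> K = K} = (\<lambda>k. k <# H) ` K"
proof (intro equalityI subsetI)
  fix X assume "X \<in> {X \<in> \<I>. X <#> K = K}"
  then have X: "X \<in> \<I>" "X <#> K = K" by auto
  obtain x where x: "x \<in> carrier G" "X = x <# H" using coset_cases[OF X(1)] .
  then have "x <# K = K" using X(2) coset_set_mult_K by simp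
  then have "x \<in> K" using lcos_self[OF x(1) K_subgroup] by simp
  then show "X \<in> (\<lambda>k. k <# H) ` K" using x by blast
next
  fix X assume "X \<in> (\<lambda>k. k <# H) ` K"
  then obtain k where k: "k \<in> K" "X = k <# H" by auto
  then have "k <# K = K" using coset_join3[OF _ K_subgroup] K_carrier by simp
  then show "X \<in> {X \<in> \<I>. X <#> K = K}" using k K_carrier coset_mem coset_set_mult_K by simp
qed

text \<open>The entry at \<open>\<one>\<close> is the squared norm \<open>s\<close> of a column. The
  \<open>r\<close> rows over \<open>K\<close> contribute \<open>r * s^2\<close>, all these entries
  having modulus \<open>s\<close>, and the entry at \<open>b\<close> adds something positive:
  \<open>r * s^2 < s\<close>.\<close>

lemma r_ent_one_less:
  assumes inv: "invariant E" and idem: "mtimes \<I> E E = E" and adj: "madjoint E = E"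
    and eq: "equivariant \<psi> E" and unit: "\<And>k. k \<in> K \<Longrightarrow> cmod (\<psi> k) = 1" and Eb: "ent E b \<noteq> 0"
  shows "ent E \<one> = of_real (Re (ent E \<one>))" "0 < Re (ent E \<one>)" "real r * Re (ent E \<one>) < 1"
proof -
  define s where "s = (\<Sum>Z\<in>\<I>. (cmod (E Z H))\<^sup>2)"
  have e: "ent E \<one> = of_real s" unfolding s_def using projection_one[OF inv idem adj] .
  then show "ent E \<one> = of_real (Re (ent E \<one>))" by simp
  let ?F = "{X \<in> \<I>. X <#> K = K}"
  have bF: "b <# H \<in> \<I> - ?F"
    using coset_mem[OF b_carrier] coset_set_mult_K[OF b_carrier] lcos_self[OF b_carrier K_subgroup] b_notin by auto
  have cF: "card ?F = r" unfolding fiber_K r_eq ..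
  have "(\<Sum>Z\<in>?F. (cmod (E Z H))\<^sup>2) = (\<Sum>Z\<in>?F. s\<^sup>2)"
  proof (intro sum.cong refl)
    fix Z assume "Z \<in> ?F"
    then obtain k where k: "k \<in> K" "Z = k <# H" unfolding fiber_K by auto
    then have "E Z H = \<psi> k * of_real s" using equivariant_ent_K[OF eq k(1)] e unfolding ent_def by simp
    then show "(cmod (E Z H))\<^sup>2 = s\<^sup>2" using unit[OF k(1)] by (simp add: norm_mult)
  qed
  then have "(\<Sum>Z\<in>?F. (cmod (E Z H))\<^sup>2) = r * s\<^sup>2" using cF by simp
  moreover have "s = (\<Sum>Z\<in>?F. (cmod (E Z H))\<^sup>2) + (\<Sum>Z\<in>\<I> - ?F. (cmod (E Z H))\<^sup>2)"
    unfolding s_def using finite_cosets by (subst sum.subset_diff[of ?F]) auto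
  moreover have "(cmod (E (b <# H) H))\<^sup>2 \<le> (\<Sum>Z\<in>\<I> - ?F. (cmod (E Z H))\<^sup>2)"
    using bF finite_cosets by (intro member_le_sum) auto
  moreover have "(cmod (E (b <# H) H))\<^sup>2 > 0" using Eb unfolding ent_def by simp
  ultimately have lt: "r * s\<^sup>2 < s" by linarith
  moreover have "0 \<le> real r * s\<^sup>2" by simp
  ultimately have s0: "s > 0" by linarith
  then show "0 < Re (ent E \<one>)" using e by simp
  have "(r * s) * s < 1 * s" using lt by (simp add: power2_eq_square mult.assoc)
  then have "r * s < 1" using s0 mult_less_cancel_right_pos[of s] by simp
  then show "real r * Re (ent E \<one>) < 1" using e by simp
qed

lemma trace_eq: "invariant E \<Longrightarrow> (\<Sum>X\<in>\<I>. E X X) = of_nat (n * r) * ent E \<one>"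
proof -
  assume E: "invariant E"
  have "(\<Sum>X\<in>\<I>. E X X) = (\<Sum>X\<in>\<I>. ent E \<one>)"
    by (intro sum.cong refl) (auto elim!: coset_cases simp: invariant_entry[OF E])
  then show ?thesis using card_cosets by simp
qed

text \<open>Only the real entry at \<open>b\<close> can spoil the root of unity, and its sign is the
  same for all pairs over different cosets of \<open>K\<close>.\<close>

lemma entry_phase:
  assumes eq: "equivariant \<psi> E" and pow: "\<And>k. k \<in> K \<Longrightarrow> \<psi> k ^ r = 1"
    and e: "ent E \<one> = of_real e" "e > 0" and f: "ent E b = of_real f" "f \<noteq> 0"
    and X: "X \<in> \<I>" and Y: "Y \<in> \<I>"
  shows "(if X <#> K = Y <#> K then sgn (E X Y) else of_real (sgn f) * sgn (E X Y)) ^ r = 1"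
proof -
  obtain x y where xy: "x \<in> carrier G" "X = x <# H" "y \<in> carrier G" "Y = y <# H"
    using coset_cases X Y by metis
  let ?g = "inv y \<otimes> x"
  have g: "?g \<in> carrier G" using xy by simp
  have E: "E X Y = ent E ?g" using invariant_entry[OF equivariant_invariant[OF eq]] xy by simp
  have XY: "X <#> K = Y <#> K \<longleftrightarrow> ?g \<in> K"
    using xy coset_set_mult_K l_coset_eq_iff[OF K_subgroup] by simp
  have unit: "sgn (\<psi> k) = \<psi> k" if "k \<in> K" for k
  proof -
    have "cmod (\<psi> k) ^ r = 1 ^ r" using pow[OF that] by (simp add: norm_power[symmetric])
    then have "cmod (\<psi> k) = 1" using power_eq_imp_eq_base[of "cmod (\<psi> k)" r 1] r_pos by simp
    then show ?thesis by (simp add: sgn_eq)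
  qed
  show ?thesis
  proof (cases "?g \<in> K")
    case True
    then have "sgn (E X Y) = \<psi> ?g"
      using E equivariant_ent_K[OF eq True] unit[OF True] e
      by (simp add: sgn_mult) (simp add: sgn_of_real)
    then show ?thesis using XY True pow by simp
  next
    case False
    obtain h k where hk: "h \<in> H" "k \<in> K" "?g = h \<otimes> b \<otimes> k" using outside_K[OF g False] .
    have "sgn (E X Y) = \<psi> k * of_real (sgn f)"
      using E equivariant_ent_outside[OF eq hk(1,2)] hk(3) unit[OF hk(2)] f by (simp add: sgn_mult sgn_of_real)
    moreover have "complex_of_real (sgn f) * of_real (sgn f) = 1" using f(2) by (simp add: sgn_if)
    ultimately have "of_real (sgn f) * sgn (E X Y) = \<psi> k" by (simp add: mult.left_commute)
    then show ?thesis using XY False pow hk(2) by simp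
  qed
qed

end

section \<open>Frames and unitary matrices\<close>

text \<open>Rank-one deflation: a normalized nonzero column \<open>u\<close> of \<open>M\<close> is
  fixed by \<open>M\<close>, and subtracting its outer product leaves a projection whose trace is
  smaller by one. Traces of projections are nonnegative, so a natural number above the trace serves
  as induction measure.\<close>

lemma projection_decomposition:
  fixes M :: "'i cmatrix"
  assumes "finite I" "\<And>i j. M i j \<noteq> 0 \<Longrightarrow> i \<in> I \<and> j \<in> I"
    and "mtimes I M M = M" "madjoint M = M"
  shows "\<exists>d w. (\<forall>k<d. \<forall>l<d. (\<Sum>i\<in>I. w k i * cnj (w l i)) = (if k = l then 1 else 0)) \<and>
    (\<forall>i j. M i j = (\<Sum>k<d. w k i * cnj (w k j))) \<and> (\<Sum>i\<in>I. M i i) = of_nat d"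
proof -
  have tr: "(\<Sum>i\<in>I. M i i) = of_real (\<Sum>i\<in>I. \<Sum>k\<in>I. (cmod (M k i))\<^sup>2)"
    if "mtimes I M M = M" "madjoint M = M" for M
    unfolding of_real_sum[of _ I] using mtimes_self_diag[OF that(2), of I] that(1) by simp
  have ex: "\<exists>d w. (\<forall>k<d. \<forall>l<d. (\<Sum>i\<in>I. w k i * cnj (w l i)) = (if k = l then 1 else 0)) \<and>
      (\<forall>i j. M i j = (\<Sum>k<d. w k i * cnj (w k j))) \<and> (\<Sum>i\<in>I. M i i) = of_nat d"
    if "\<forall>i j. M i j \<noteq> 0 \<longrightarrow> i \<in> I \<and> j \<in> I" "mtimes I M M = M" "madjoint M = M"
      "Re (\<Sum>i\<in>I. M i i) < real N" for N :: nat and M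
    using that
  proof (induction N arbitrary: M)
    case 0
    have "(\<Sum>i\<in>I. \<Sum>k\<in>I. (cmod (M k i))\<^sup>2) \<ge> 0" by (intro sum_nonneg) auto
    then show ?case using 0(4) unfolding tr[OF 0(2,3)] Re_complex_of_real by simp
  next
    case (Suc N)
    show ?case
    proof (cases "M = (\<lambda>i j. 0)")
      case True
      then show ?thesis by (intro exI[of _ 0]) auto
    next
      case False
      then obtain i0 j where ij: "M i0 j \<noteq> 0" by (auto simp: fun_eq_iff)
      then have I: "i0 \<in> I" "j \<in> I" using Suc.prems(1) by auto
      have sym: "cnj (M k i) = M i k" for i k
        using fun_cong[OF fun_cong[OF Suc.prems(3)], of i k] by (simp add: madjoint_def)
      have idem: "(\<Sum>k\<in>I. M i k * M k l) = M i l" for i l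
        using fun_cong[OF fun_cong[OF Suc.prems(2)], of i l] by (simp add: mtimes_def)
      define c where "c = (\<Sum>k\<in>I. (cmod (M k j))\<^sup>2)"
      have c: "M j j = of_real c"
        unfolding c_def using mtimes_self_diag[OF Suc.prems(3), of I j] Suc.prems(2) by simp
      have "(cmod (M i0 j))\<^sup>2 \<le> c" unfolding c_def using I assms(1) by (intro member_le_sum) auto
      moreover have "(cmod (M i0 j))\<^sup>2 > 0" using ij by simp
      ultimately have c0: "c > 0" by linarith
      \<comment> \<open>The squared norm of column \<open>j\<close> is the diagonal entry
        \<open>M j j\<close>, so division by \<open>s\<close> makes the column a unit
        vector.\<close>
      define s where "s = complex_of_real (sqrt c)"
      have s: "s * s = M j j" "s \<noteq> 0" "cnj s = s"
        unfolding s_def c using c0 by (simp_all add: of_real_mult[symmetric] del: of_real_mult)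
      define u where "u i = M i j / s" for i
      have Mu: "(\<Sum>k\<in>I. M i k * u k) = u i" for i
        unfolding u_def using idem[of i j] by (simp add: sum_divide_distrib[symmetric])
      have uM: "(\<Sum>k\<in>I. cnj (u k) * M k i) = cnj (u i)" for i
        unfolding u_def using idem[of j i] by (simp add: sum_divide_distrib[symmetric] sym s)
      have uu: "(\<Sum>k\<in>I. cnj (u k) * u k) = 1"
      proof -
        have "(\<Sum>k\<in>I. cnj (u k) * u k) = (\<Sum>k\<in>I. M j k * M k j) / (s * s)"
          unfolding u_def by (simp add: sum_divide_distrib sym s)
        then show ?thesis using idem[of j j] s(1)[symmetric] s(2) by simp
      qed
      define P where "P i k = M i k - u i * cnj (u k)" for i k
      have Pu: "(\<Sum>k\<in>I. P i k * u k) = 0" for i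
      proof -
        have "(\<Sum>k\<in>I. P i k * u k) = (\<Sum>k\<in>I. M i k * u k) - u i * (\<Sum>k\<in>I. cnj (u k) * u k)"
          unfolding P_def by (simp add: left_diff_distrib sum_subtractf sum_distrib_left mult.assoc)
        then show ?thesis using Mu uu by simp
      qed
      have P_supp: "\<forall>i k. P i k \<noteq> 0 \<longrightarrow> i \<in> I \<and> k \<in> I"
      proof (intro allI impI)
        fix i k assume "P i k \<noteq> 0"
        then have "M i k \<noteq> 0 \<or> M i j \<noteq> 0 \<and> M k j \<noteq> 0" unfolding P_def u_def by auto
        then show "i \<in> I \<and> k \<in> I" using Suc.prems(1) by blast
      qed
      have P_idem: "mtimes I P P = P"
      proof (intro ext)
        fix i l
        have "mtimes I P P i l = (\<Sum>k\<in>I. P i k * M k l) - (\<Sum>k\<in>I. P i k * u k) * cnj (u l)"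
          unfolding mtimes_def P_def[of _ l]
          by (simp add: right_diff_distrib sum_subtractf sum_distrib_right mult.assoc)
        also have "\<dots> = (\<Sum>k\<in>I. P i k * M k l)" using Pu by simp
        also have "\<dots> = (\<Sum>k\<in>I. M i k * M k l) - u i * (\<Sum>k\<in>I. cnj (u k) * M k l)"
          unfolding P_def by (simp add: left_diff_distrib sum_subtractf sum_distrib_left mult.assoc)
        also have "\<dots> = P i l" unfolding idem uM P_def ..
        finally show "mtimes I P P i l = P i l" .
      qed
      have P_adj: "madjoint P = P" unfolding madjoint_def P_def by (simp add: sym mult.commute)
      have trP: "(\<Sum>i\<in>I. P i i) = (\<Sum>i\<in>I. M i i) - 1"
        using uu unfolding P_def by (simp add: sum_subtractf mult.commute)
      have "Re (\<Sum>i\<in>I. P i i) < real N" using Suc.prems(4) unfolding trP by simp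
      from Suc.IH[OF P_supp P_idem P_adj this] obtain d w
        where w: "\<forall>k<d. \<forall>l<d. (\<Sum>i\<in>I. w k i * cnj (w l i)) = (if k = l then 1 else 0)"
          "\<forall>i j. P i j = (\<Sum>k<d. w k i * cnj (w k j))" "(\<Sum>i\<in>I. P i i) = of_nat d" by blast
      \<comment> \<open>The matrix \<open>P\<close> annihilates \<open>u\<close>, and the vectors
        \<open>w l\<close> span its range; pairing \<open>P u = 0\<close> with \<open>w l\<close>
        isolates one coefficient by orthonormality.\<close>
      have ort: "(\<Sum>i\<in>I. u i * cnj (w l i)) = 0" if l: "l < d" for l
      proof -
        have "0 = (\<Sum>i\<in>I. cnj (w l i) * (\<Sum>k\<in>I. P i k * u k))" using Pu by simp
        also have "\<dots> = (\<Sum>i\<in>I. \<Sum>k\<in>I. \<Sum>m<d. cnj (w l i) * w m i * (cnj (w m k) * u k))"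
          unfolding w(2)[rule_format] by (simp add: sum_distrib_left sum_distrib_right mult_ac)
        also have "\<dots> = (\<Sum>k\<in>I. \<Sum>i\<in>I. \<Sum>m<d. cnj (w l i) * w m i * (cnj (w m k) * u k))"
          by (rule sum.swap)
        also have "\<dots> = (\<Sum>k\<in>I. \<Sum>m<d. \<Sum>i\<in>I. cnj (w l i) * w m i * (cnj (w m k) * u k))"
          by (intro sum.cong refl sum.swap)
        also have "\<dots> = (\<Sum>k\<in>I. \<Sum>m<d. (\<Sum>i\<in>I. w m i * cnj (w l i)) * (cnj (w m k) * u k))"
          by (simp add: sum_distrib_left sum_distrib_right mult_ac)
        also have "\<dots> = (\<Sum>k\<in>I. \<Sum>m<d. if m = l then cnj (w m k) * u k else 0)"
          using w(1) l by (intro sum.cong refl) auto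
        also have "\<dots> = (\<Sum>k\<in>I. u k * cnj (w l k))" using l by (simp add: mult.commute)
        finally show ?thesis by simp
      qed
      have ort': "(\<Sum>i\<in>I. w l i * cnj (u i)) = 0" if l: "l < d" for l
        using arg_cong[OF ort[OF l], of cnj] by (simp add: mult.commute)
      define w' where "w' = w(d := u)"
      have "(\<Sum>i\<in>I. w' k i * cnj (w' l i)) = (if k = l then 1 else 0)" if "k < Suc d" "l < Suc d" for k l
        using that w(1) ort ort' uu unfolding w'_def by (auto simp: less_Suc_eq mult.commute)
      moreover have "M i j = (\<Sum>k<Suc d. w' k i * cnj (w' k j))" for i j
      proof -
        have "(\<Sum>k<d. w' k i * cnj (w' k j)) = P i j"
          unfolding w(2)[rule_format] w'_def by (intro sum.cong) auto
        then show ?thesis by (simp add: P_def w'_def)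
      qed
      moreover have "(\<Sum>i\<in>I. M i i) = of_nat (Suc d)" using trP w(3) by (simp add: algebra_simps)
      ultimately show ?thesis by (intro exI[of _ "Suc d"] exI[of _ w']) blast
    qed
  qed
  obtain N where N: "Re (\<Sum>i\<in>I. M i i) < real N" using reals_Archimedean2 by blast
  have "\<forall>i j. M i j \<noteq> 0 \<longrightarrow> i \<in> I \<and> j \<in> I" using assms(2) by blast
  from ex[OF this assms(3,4) N] show ?thesis .
qed

section \<open>Adjoints and unitary matrices\<close>

lemma index_mat_adjoint:
  "i < dim_col A \<Longrightarrow> j < dim_row A \<Longrightarrow> mat_adjoint A $$ (i, j) = conjugate (A $$ (j, i))"
  unfolding mat_adjoint_def mat_of_rows_def by simp

lemma mat_adjoint_carrier: "A \<in> carrier_mat m k \<Longrightarrow> mat_adjoint A \<in> carrier_mat k m"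
  unfolding mat_adjoint_def mat_of_rows_def by auto

lemma cscalar_prod_sum:
  fixes u w :: "complex vec"
  shows "w \<in> carrier_vec d \<Longrightarrow> u \<bullet>c w = (\<Sum>i<d. u $ i * cnj (w $ i))"
  unfolding scalar_prod_def by (auto simp: lessThan_atLeast0)

lemma unitary_matI:
  assumes "Q \<in> carrier_mat d d"
    and "\<And>k l. k < d \<Longrightarrow> l < d \<Longrightarrow> (\<Sum>m<d. cnj (Q $$ (m, k)) * Q $$ (m, l)) = (if k = l then 1 else 0)"
  shows "unitary_mat d Q"
  unfolding unitary_mat_def
proof (intro conjI assms(1) eq_matI)
  fix i j assume "i < dim_row (1\<^sub>m d)" "j < dim_col (1\<^sub>m d)"
  then show "(mat_adjoint Q * Q) $$ (i, j) = 1\<^sub>m d $$ (i, j)"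
    using assms mat_adjoint_carrier[OF assms(1)]
    by (simp add: scalar_prod_def index_mat_adjoint lessThan_atLeast0)
qed (use assms(1) mat_adjoint_carrier[OF assms(1)] in auto)

lemma mat_adjoint_mat_adjoint: "mat_adjoint (mat_adjoint A) = (A :: complex mat)"
  using mat_adjoint_carrier[of A "dim_row A" "dim_col A"]
    mat_adjoint_carrier[OF mat_adjoint_carrier[of A "dim_row A" "dim_col A"]]
  by (intro eq_matI) (auto simp: index_mat_adjoint)

lemma mat_adjoint_mult:
  fixes A B :: "complex mat"
  assumes "A \<in> carrier_mat m k" "B \<in> carrier_mat k l"
  shows "mat_adjoint (A * B) = mat_adjoint B * mat_adjoint A"
proof (rule eq_matI)
  note car = mat_adjoint_carrier[OF assms(1)] mat_adjoint_carrier[OF assms(2)]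
    mat_adjoint_carrier[OF mult_carrier_mat[OF assms]]
  fix i j assume "i < dim_row (mat_adjoint B * mat_adjoint A)" "j < dim_col (mat_adjoint B * mat_adjoint A)"
  then show "mat_adjoint (A * B) $$ (i, j) = (mat_adjoint B * mat_adjoint A) $$ (i, j)"
    using assms car by (simp add: index_mat_adjoint scalar_prod_def mult.commute)
qed (use mat_adjoint_carrier[OF assms(1)] mat_adjoint_carrier[OF assms(2)]
    mat_adjoint_carrier[OF mult_carrier_mat[OF assms]] in auto)

lemma unitary_carrier: "unitary_mat d Q \<Longrightarrow> Q \<in> carrier_mat d d"
  unfolding unitary_mat_def by simp

text \<open>A one-sided inverse of a square matrix is two-sided.\<close>

lemma unitary_adjoint: "unitary_mat d Q \<Longrightarrow> unitary_mat d (mat_adjoint Q)"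
  unfolding unitary_mat_def
  using mat_mult_left_right_inverse[of "mat_adjoint Q" d Q] mat_adjoint_carrier[of Q d d]
  by (simp add: mat_adjoint_mat_adjoint)

lemma unitary_mult:
  assumes "unitary_mat d Q" "unitary_mat d R"
  shows "unitary_mat d (Q * R)"
proof -
  note Q = unitary_carrier[OF assms(1)] and R = unitary_carrier[OF assms(2)]
  note c = mat_adjoint_carrier[OF Q] mat_adjoint_carrier[OF R]
  have "mat_adjoint (Q * R) * (Q * R) = mat_adjoint R * (mat_adjoint Q * (Q * R))"
    unfolding mat_adjoint_mult[OF Q R] by (rule assoc_mult_mat[OF c(2) c(1) mult_carrier_mat[OF Q R]])
  also have "mat_adjoint Q * (Q * R) = (mat_adjoint Q * Q) * R"
    using assoc_mult_mat[OF c(1) Q R] by simp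
  also have "\<dots> = R" using assms(1) R unfolding unitary_mat_def by simp
  also have "mat_adjoint R * R = 1\<^sub>m d" using assms(2) unfolding unitary_mat_def by simp
  finally show ?thesis unfolding unitary_mat_def using mult_carrier_mat[OF Q R] by simp
qed

lemma unitary_one: "unitary_mat d (1\<^sub>m d)"
proof -
  have "mat_adjoint (1\<^sub>m d) = (1\<^sub>m d :: complex mat)"
    using mat_adjoint_carrier[OF one_carrier_mat, of d]
    by (intro eq_matI) (auto simp: index_mat_adjoint)
  then show ?thesis unfolding unitary_mat_def by simp
qed

lemma unitary_inverse_image:
  assumes "unitary_mat d Q" "v \<in> carrier_vec d"
  shows "mat_adjoint Q *\<^sub>v (Q *\<^sub>v v) = v"
proof -
  note Q = unitary_carrier[OF assms(1)]
  have "mat_adjoint Q *\<^sub>v (Q *\<^sub>v v) = (mat_adjoint Q * Q) *\<^sub>v v"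
    using assoc_mult_mat_vec[OF mat_adjoint_carrier[OF Q] Q assms(2)] by simp
  then show ?thesis using assms unfolding unitary_mat_def by simp
qed

section \<open>Unitary matrices that permute a sequence of lines\<close>

lemma is_line_carrier: "is_line d S \<Longrightarrow> S \<subseteq> carrier_vec d"
  unfolding is_line_def by auto

text \<open>The set \<open>line_automorphisms\<close> hides the matrix behind an existential; here
  matrix and permutation stay together, so that products and inverses can be taken of both at
  once.\<close>

definition permutes_lines ::
    "nat \<Rightarrow> 'x set \<Rightarrow> ('x \<Rightarrow> complex vec set) \<Rightarrow> complex mat \<Rightarrow> ('x \<Rightarrow> 'x) \<Rightarrow> bool" where
  "permutes_lines d X L Q \<sigma> \<longleftrightarrow>
     unitary_mat d Q \<and> \<sigma> \<in> Bij X \<and> (\<forall>i\<in>X. (\<lambda>v. Q *\<^sub>v v) ` L i = L (\<sigma> i))"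

lemma line_automorphisms_iff: "\<sigma> \<in> line_automorphisms d X L \<longleftrightarrow> (\<exists>Q. permutes_lines d X L Q \<sigma>)"
  unfolding line_automorphisms_def permutes_lines_def by auto

lemma permutes_lines_one:
  assumes lines: "\<And>i. i \<in> X \<Longrightarrow> is_line d (L i)"
  shows "permutes_lines d X L (1\<^sub>m d) (\<lambda>x\<in>X. x)"
proof -
  have "(\<lambda>v. 1\<^sub>m d *\<^sub>v v) ` L i = L i" if "i \<in> X" for i
  proof -
    have "(\<lambda>v. 1\<^sub>m d *\<^sub>v v) ` L i = (\<lambda>v. v) ` L i"
      using is_line_carrier[OF lines[OF that]] by (intro image_cong) auto
    then show ?thesis by simp
  qed
  then show ?thesis
    unfolding permutes_lines_def using id_Bij[of X] unitary_one[of d] by auto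
qed

lemma permutes_lines_inverse:
  assumes lines: "\<And>i. i \<in> X \<Longrightarrow> is_line d (L i)" and Q: "permutes_lines d X L Q \<sigma>"
  shows "permutes_lines d X L (mat_adjoint Q) (\<lambda>x\<in>X. inv_into X \<sigma> x)"
proof -
  let ?t = "\<lambda>x\<in>X. inv_into X \<sigma> x"
  have Q: "unitary_mat d Q" "\<sigma> \<in> Bij X" "\<And>i. i \<in> X \<Longrightarrow> (\<lambda>v. Q *\<^sub>v v) ` L i = L (\<sigma> i)"
    using Q unfolding permutes_lines_def by auto
  have bij: "bij_betw \<sigma> X X" using Q(2) unfolding Bij_def by simp
  have "(\<lambda>v. mat_adjoint Q *\<^sub>v v) ` L i = L (?t i)" if i: "i \<in> X" for i
  proof -
    have j: "?t i \<in> X" "\<sigma> (?t i) = i"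
      using i bij bij_betw_imp_surj_on[OF bij] by (auto simp: inv_into_into f_inv_into_f)
    have "L i = (\<lambda>v. Q *\<^sub>v v) ` L (?t i)" using Q(3)[OF j(1)] j(2) by simp
    then have "(\<lambda>v. mat_adjoint Q *\<^sub>v v) ` L i = (\<lambda>v. mat_adjoint Q *\<^sub>v (Q *\<^sub>v v)) ` L (?t i)"
      by (simp add: image_image)
    also have "\<dots> = (\<lambda>v. v) ` L (?t i)"
      using is_line_carrier[OF lines[OF j(1)]] unitary_inverse_image[OF Q(1)] by (intro image_cong) auto
    finally show ?thesis by simp
  qed
  then show ?thesis
    unfolding permutes_lines_def using restrict_inv_into_Bij[OF Q(2)] unitary_adjoint[OF Q(1)] by blast
qed

lemma permutes_lines_mult:
  assumes lines: "\<And>i. i \<in> X \<Longrightarrow> is_line d (L i)"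
    and Q: "permutes_lines d X L Q \<sigma>" and R: "permutes_lines d X L R \<tau>"
  shows "permutes_lines d X L (Q * R) (compose X \<sigma> \<tau>)"
proof -
  have Q: "unitary_mat d Q" "\<sigma> \<in> Bij X" "\<And>i. i \<in> X \<Longrightarrow> (\<lambda>v. Q *\<^sub>v v) ` L i = L (\<sigma> i)"
    and R: "unitary_mat d R" "\<tau> \<in> Bij X" "\<And>i. i \<in> X \<Longrightarrow> (\<lambda>v. R *\<^sub>v v) ` L i = L (\<tau> i)"
    using Q R unfolding permutes_lines_def by auto
  have "(\<lambda>v. (Q * R) *\<^sub>v v) ` L i = L (compose X \<sigma> \<tau> i)" if i: "i \<in> X" for i
  proof -
    have "\<tau> i \<in> X" using R(2) i Bij_imp_funcset by blast
    then have "L (compose X \<sigma> \<tau> i) = (\<lambda>v. Q *\<^sub>v (R *\<^sub>v v)) ` L i"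
      using Q(3) R(3)[OF i] i by (simp add: compose_def image_image[symmetric])
    also have "\<dots> = (\<lambda>v. (Q * R) *\<^sub>v v) ` L i"
      using is_line_carrier[OF lines[OF i]] assoc_mult_mat_vec[OF unitary_carrier[OF Q(1)] unitary_carrier[OF R(1)]]
      by (intro image_cong) auto
    finally show ?thesis by simp
  qed
  then show ?thesis
    unfolding permutes_lines_def using compose_Bij[OF Q(2) R(2)] unitary_mult[OF Q(1) R(1)] by blast
qed

lemma line_automorphisms_subgroup:
  assumes lines: "\<And>i. i \<in> X \<Longrightarrow> is_line d (L i)"
  shows "subgroup (line_automorphisms d X L) (BijGroup X)"
proof (rule group.subgroupI[OF group_BijGroup])
  show "line_automorphisms d X L \<subseteq> carrier (BijGroup X)"
    unfolding line_automorphisms_def BijGroup_def by auto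
  have "permutes_lines d X L (1\<^sub>m d) (\<lambda>x\<in>X. x)" using lines by (rule permutes_lines_one)
  then show "line_automorphisms d X L \<noteq> {}" using line_automorphisms_iff by blast
next
  fix \<sigma> assume "\<sigma> \<in> line_automorphisms d X L"
  then obtain Q where Q: "permutes_lines d X L Q \<sigma>" using line_automorphisms_iff by blast
  have "permutes_lines d X L (mat_adjoint Q) (\<lambda>x\<in>X. inv_into X \<sigma> x)"
    using lines Q by (rule permutes_lines_inverse)
  then show "inv\<^bsub>BijGroup X\<^esub> \<sigma> \<in> line_automorphisms d X L"
    using inv_BijGroup[of \<sigma> X] Q line_automorphisms_iff unfolding permutes_lines_def by metis
next
  fix \<sigma> \<tau> assume "\<sigma> \<in> line_automorphisms d X L" "\<tau> \<in> line_automorphisms d X L"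
  then obtain Q R where Q: "permutes_lines d X L Q \<sigma>" and R: "permutes_lines d X L R \<tau>"
    using line_automorphisms_iff by blast
  have "permutes_lines d X L (Q * R) (compose X \<sigma> \<tau>)"
    using lines Q R by (rule permutes_lines_mult)
  moreover have "\<sigma> \<otimes>\<^bsub>BijGroup X\<^esub> \<tau> = compose X \<sigma> \<tau>"
    using Q R unfolding permutes_lines_def BijGroup_def by simp
  ultimately show "\<sigma> \<otimes>\<^bsub>BijGroup X\<^esub> \<tau> \<in> line_automorphisms d X L"
    using line_automorphisms_iff by metis
qed

lemma line_automorphisms_action:
  assumes "\<And>i. i \<in> X \<Longrightarrow> is_line d (L i)"
  shows "group_action (BijGroup X\<lparr>carrier := line_automorphisms d X L\<rparr>) X (\<lambda>\<sigma>. \<sigma>)"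
proof -
  have "subgroup (line_automorphisms d X L) (BijGroup X)"
    using assms by (rule line_automorphisms_subgroup)
  then have "group_hom (BijGroup X\<lparr>carrier := line_automorphisms d X L\<rparr>) (BijGroup X) id"
    by (rule group.canonical_inj_is_hom[OF group_BijGroup])
  then show ?thesis by (simp add: group_action_def id_def)
qed

section \<open>Parseval frames\<close>

lemma frame_expand:
  fixes f :: "'i \<Rightarrow> nat \<Rightarrow> complex"
  assumes frame: "\<And>k l. k < d \<Longrightarrow> l < d \<Longrightarrow> (\<Sum>X\<in>I. f X k * cnj (f X l)) = (if k = l then 1 else 0)"
    and k: "k < d"
  shows "(\<Sum>X\<in>I. f X k * (\<Sum>m<d. a m * cnj (f X m))) = a k"
proof -
  have "(\<Sum>X\<in>I. f X k * (\<Sum>m<d. a m * cnj (f X m))) = (\<Sum>X\<in>I. \<Sum>m<d. a m * (f X k * cnj (f X m)))"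
    by (simp add: sum_distrib_left mult_ac)
  also have "\<dots> = (\<Sum>m<d. \<Sum>X\<in>I. a m * (f X k * cnj (f X m)))" by (rule sum.swap)
  also have "\<dots> = (\<Sum>m<d. if m = k then a m else 0)"
    using frame[OF k] by (intro sum.cong refl) (auto simp: sum_distrib_left[symmetric])
  also have "\<dots> = a k" using k by simp
  finally show ?thesis .
qed

text \<open>The matrix is explicit: the sum of the outer products of \<open>f (\<tau> X)\<close>
  with \<open>f X\<close>. Applied to a frame vector it involves \<open>f\<close> only through Gram
  entries, which \<open>\<tau>\<close> preserves, so the frame expansion identifies the
  image.\<close>

lemma frame_unitary:
  fixes f :: "'i \<Rightarrow> nat \<Rightarrow> complex"
  assumes \<tau>: "bij_betw \<tau> I I"
    and frame: "\<And>k l. k < d \<Longrightarrow> l < d \<Longrightarrow> (\<Sum>X\<in>I. f X k * cnj (f X l)) = (if k = l then 1 else 0)"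
    and gram: "\<And>X Y. X \<in> I \<Longrightarrow> Y \<in> I \<Longrightarrow>
      (\<Sum>m<d. f (\<tau> Y) m * cnj (f (\<tau> X) m)) = (\<Sum>m<d. f Y m * cnj (f X m))"
  shows "\<exists>Q. unitary_mat d Q \<and> (\<forall>X\<in>I. Q *\<^sub>v vec d (f X) = vec d (f (\<tau> X)))"
proof (intro exI conjI ballI)
  define Q where "Q = mat d d (\<lambda>(k, l). \<Sum>X\<in>I. f (\<tau> X) k * cnj (f X l))"
  note expand = frame_expand[of d f I, OF frame]
  have Qf: "(\<Sum>l<d. Q $$ (k, l) * f Z l) = f (\<tau> Z) k" if k: "k < d" and Z: "Z \<in> I" for k Z
  proof -
    have "(\<Sum>l<d. Q $$ (k, l) * f Z l) = (\<Sum>l<d. \<Sum>X\<in>I. f (\<tau> X) k * (f Z l * cnj (f X l)))"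
      unfolding Q_def using k by (simp add: sum_distrib_left sum_distrib_right mult_ac)
    also have "\<dots> = (\<Sum>X\<in>I. \<Sum>l<d. f (\<tau> X) k * (f Z l * cnj (f X l)))" by (rule sum.swap)
    also have "\<dots> = (\<Sum>X\<in>I. f (\<tau> X) k * (\<Sum>l<d. f (\<tau> Z) l * cnj (f (\<tau> X) l)))"
      using gram Z by (intro sum.cong) (simp_all add: sum_distrib_left)
    also have "\<dots> = (\<Sum>W\<in>I. f W k * (\<Sum>l<d. f (\<tau> Z) l * cnj (f W l)))"
      by (rule sum.reindex_bij_betw[OF \<tau>])
    also have "\<dots> = f (\<tau> Z) k" using expand[OF _ _ k] by simp
    finally show ?thesis .
  qed
  show "Q *\<^sub>v vec d (f X) = vec d (f (\<tau> X))" if "X \<in> I" for X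
    using Qf[OF _ that] by (intro eq_vecI) (auto simp: Q_def scalar_prod_def lessThan_atLeast0)
  show "unitary_mat d Q"
  proof (rule unitary_matI)
    show "Q \<in> carrier_mat d d" unfolding Q_def by simp
    fix k l assume k: "k < d" and l: "l < d"
    have "(\<Sum>m<d. cnj (Q $$ (m, k)) * Q $$ (m, l))
        = (\<Sum>m<d. \<Sum>X\<in>I. f X k * (Q $$ (m, l) * cnj (f (\<tau> X) m)))"
      unfolding Q_def using k by (simp add: sum_distrib_left sum_distrib_right mult_ac)
    also have "\<dots> = (\<Sum>X\<in>I. f X k * (\<Sum>m<d. Q $$ (m, l) * cnj (f (\<tau> X) m)))"
      by (subst sum.swap) (simp add: sum_distrib_left)
    also have "\<dots> = (\<Sum>X\<in>I. f X k * cnj (f X l))"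
    proof (intro sum.cong refl)
      fix X assume X: "X \<in> I"
      have "(\<Sum>m<d. Q $$ (m, l) * cnj (f (\<tau> X) m))
          = (\<Sum>m<d. \<Sum>Y\<in>I. cnj (f Y l) * (f (\<tau> Y) m * cnj (f (\<tau> X) m)))"
        unfolding Q_def using l by (simp add: sum_distrib_left sum_distrib_right mult_ac)
      also have "\<dots> = (\<Sum>Y\<in>I. cnj (f Y l) * (\<Sum>m<d. f Y m * cnj (f X m)))"
        using gram[OF X] by (subst sum.swap) (simp add: sum_distrib_left[symmetric])
      also have "\<dots> = cnj (\<Sum>Y\<in>I. f Y l * (\<Sum>m<d. f X m * cnj (f Y m)))"
        by (simp add: mult.commute)
      also have "\<dots> = cnj (f X l)" using expand[OF _ _ l] by simp
      finally show "f X k * (\<Sum>m<d. Q $$ (m, l) * cnj (f (\<tau> X) m)) = f X k * cnj (f X l)" by simp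
    qed
    also have "\<dots> = (if k = l then 1 else 0)" by (rule frame[OF k l])
    finally show "(\<Sum>m<d. cnj (Q $$ (m, k)) * Q $$ (m, l)) = (if k = l then 1 else 0)" .
  qed
qed

section \<open>Lines from primitive idempotents\<close>

lemma span_of_frame:
  fixes f :: "'i \<Rightarrow> nat \<Rightarrow> complex"
  assumes fin: "finite I"
    and frame: "\<And>k l. k < d \<Longrightarrow> l < d \<Longrightarrow> (\<Sum>X\<in>I. f X k * cnj (f X l)) = (if k = l then 1 else 0)"
    and S: "S \<subseteq> carrier_vec d" "\<And>X. X \<in> I \<Longrightarrow> vec d (f X) \<in> S"
  shows "LinearCombinations.module.span class_ring (module_vec TYPE(complex) d) S = carrier_vec d"
proof -
  interpret vec_space "TYPE(complex)" d .
  have part: "vec d (\<lambda>k. \<Sum>X\<in>J. f X k * a X) \<in> span S" if "finite J" "J \<subseteq> I" for J a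
    using that
  proof (induction J rule: finite_induct)
    case empty
    have "vec d (\<lambda>k. \<Sum>X\<in>{}. f X k * a X) = 0\<^sub>v d" by (intro eq_vecI) auto
    then show ?case using span_zero[of S] by simp
  next
    case (insert X J)
    have "vec d (\<lambda>k. \<Sum>X\<in>insert X J. f X k * a X) = a X \<cdot>\<^sub>v vec d (f X) + vec d (\<lambda>k. \<Sum>X\<in>J. f X k * a X)"
      using insert by (intro eq_vecI) auto
    moreover have "vec d (f X) \<in> span S" using S insert.prems span_mem[of S "vec d (f X)"] by auto
    ultimately show ?case using span_add1[OF S(1) smult_in_span[OF S(1)]] insert by auto
  qed
  have "u \<in> span S" if u: "u \<in> carrier_vec d" for u
  proof -
    have "u = vec d (\<lambda>k. \<Sum>X\<in>I. f X k * (\<Sum>m<d. u $ m * cnj (f X m)))"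
      using u frame_expand[of d f I, OF frame] by (intro eq_vecI) auto
    then show ?thesis using part[OF assms(1) order.refl, of "\<lambda>X. \<Sum>m<d. u $ m * cnj (f X m)"] by simp
  qed
  then show ?thesis using span_is_subset2[OF S(1)] by auto
qed

context key_pair
begin

theorem primitive_idempotent_lines:
  assumes E: "primitive_idempotent G H E"
  shows "\<exists>d<n. \<exists>(L :: 'a set \<Rightarrow> complex vec set) v.
      doubly_transitive_lines d (lcosets K) L \<and> lines_span_space d (lcosets K) L \<and>
      equal_norm_representatives (lcosets K) L d r \<I> (\<lambda>X. X <#> K) v \<and>
      E = gram_matrix \<I> v \<and> coset_action G K ` carrier G \<subseteq> line_automorphisms d (lcosets K) L"
    and "\<exists>\<epsilon>\<in>{1, -1}. \<forall>X\<in>\<I>. \<forall>Y\<in>\<I>.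
      (if X <#> K = Y <#> K then sgn (E X Y) else \<epsilon> * sgn (E X Y)) ^ r = 1"
proof -
  have inv: "invariant E" and idem: "mtimes \<I> E E = E" and adj: "madjoint E = E"
    and nz: "E \<noteq> (\<lambda>X Y. 0)"
    using E scheme_algebra_iff unfolding primitive_idempotent_def scheme_projection_def by auto
  obtain \<psi> where eq: "equivariant \<psi> E" using primitive_equivariant[OF E] .
  note pow = equivariant_pow[OF eq nz]
  have unit: "cmod (\<psi> k) = 1" if "k \<in> K" for k
    using power_eq_imp_eq_base[of "cmod (\<psi> k)" r 1] r_pos pow[OF that] by (simp add: norm_power[symmetric])
  note Eb = primitive_ent_b[OF E eq]
  define e where "e = Re (ent E \<one>)"
  have e: "ent E \<one> = of_real e" "e > 0" "real r * e < 1"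
    unfolding e_def using r_ent_one_less[OF inv idem adj eq unit Eb] by auto
  obtain b' where b': "ent E b = of_real b'" "b' \<noteq> 0"
    using selfadjoint_real(2)[OF inv adj] Eb unfolding Reals_def by auto
  have "sgn b' = 1 \<or> sgn b' = -1" using b'(2) by (simp add: sgn_if)
  then have "complex_of_real (sgn b') \<in> {1, -1}" by auto
  then show "\<exists>\<epsilon>\<in>{1, -1}. \<forall>X\<in>\<I>. \<forall>Y\<in>\<I>.
      (if X <#> K = Y <#> K then sgn (E X Y) else \<epsilon> * sgn (E X Y)) ^ r = 1"
    using entry_phase[OF eq pow e(1,2) b'] by (intro bexI[of _ "complex_of_real (sgn b')"]) auto
  obtain d w where w: "\<forall>k<d. \<forall>l<d. (\<Sum>i\<in>\<I>. w k i * cnj (w l i)) = (if k = l then 1 else 0)"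
      "\<forall>i j. E i j = (\<Sum>k<d. w k i * cnj (w k j))" "(\<Sum>i\<in>\<I>. E i i) = of_nat d"
    using projection_decomposition[OF finite_cosets _ idem adj] invariant_outside[OF inv] by blast
  \<comment> \<open>The rank equals the trace, which is the constant diagonal entry \<open>e\<close>
    times the number \<open>n * r\<close> of cosets; hence \<open>r * e < 1\<close> yields
    \<open>d < n\<close>.\<close>
  have "complex_of_nat d = of_real (real (n * r) * e)"
    using w(3) trace_eq[OF inv] e(1) by simp
  then have "real d = real n * (real r * e)"
    by (metis mult.assoc of_nat_mult of_real_eq_iff of_real_of_nat_eq)
  moreover have "n > 0"
    unfolding n_eq using finite_K_cosets K_coset_mem[OF one_closed] by (auto simp: card_gt_0_iff)
  moreover have "real n * (real r * e) < real n * 1"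
    using e(3) \<open>n > 0\<close> by (intro mult_strict_left_mono) auto
  ultimately have "real d < real n" by simp
  then have dn: "d < n" by simp
  \<comment> \<open>Conjugated because \<open>gram_matrix\<close> has
    \<open>v j \<bullet>c v i\<close> in position \<open>i\<close>, \<open>j\<close>, while the
    decomposition of \<open>E\<close> has its conjugate on the second index.\<close>
  define f where "f X k = cnj (w k X)" for X k
  define v where "v X = vec d (f X)" for X
  have frame: "(\<Sum>X\<in>\<I>. f X k * cnj (f X l)) = (if k = l then 1 else 0)" if "k < d" "l < d" for k l
  proof -
    have "(\<Sum>X\<in>\<I>. f X k * cnj (f X l)) = (\<Sum>X\<in>\<I>. w l X * cnj (w k X))"
      unfolding f_def by (simp add: mult.commute)
    then show ?thesis using w(1) that by auto
  qed
  have Ef: "E X Y = (\<Sum>k<d. f Y k * cnj (f X k))" for X Y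
    using w(2) unfolding f_def by (simp add: mult.commute)
  have vc: "v X \<in> carrier_vec d" for X unfolding v_def by simp
  have gram: "v Y \<bullet>c v X = E X Y" for X Y
    using cscalar_prod_sum[OF vc, of "v Y" X] unfolding Ef by (simp add: v_def)
  have EXX: "E X X = of_real e" if "X \<in> \<I>" for X
    using that by (auto elim!: coset_cases simp: invariant_entry[OF inv] e(1))
  have v0: "v X \<noteq> 0\<^sub>v d" if "X \<in> \<I>" for X
    using gram[of X X] EXX[OF that] e(2) by auto
  \<comment> \<open>The frame expansion recovers a frame vector from a column of \<open>E\<close>,
    so it inherits the eigenvalue, conjugated because the translation acts on the column
    index.\<close>
  have fk: "f (X #> k) m = cnj (\<psi> k) * f X m" if X: "X \<in> \<I>" and k: "k \<in> K" and m: "m < d" for X k m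
  proof -
    have f: "f Z m = (\<Sum>W\<in>\<I>. f W m * E W Z)" for Z
      unfolding Ef using frame_expand[of d f \<I> m "f Z"] frame m by simp
    have sym: "E W Z = cnj (E Z W)" for W Z
      using fun_cong[OF fun_cong[OF adj], of W Z] by (simp add: madjoint_def)
    have "E W (X #> k) = cnj (\<psi> k) * E W X" if "W \<in> \<I>" for W
      using eq that X k unfolding sym[of W] equivariant_def by auto
    then have "(\<Sum>W\<in>\<I>. f W m * E W (X #> k)) = (\<Sum>W\<in>\<I>. cnj (\<psi> k) * (f W m * E W X))"
      by (intro sum.cong refl) simp
    then show ?thesis unfolding f[of "X #> k"] f[of X] by (simp add: sum_distrib_left)
  qed
  \<comment> \<open>Any representative would do: vectors over the same coset of \<open>K\<close>
    differ by unimodular factors, which is what the next fact uses.\<close>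
  define L where "L C = {c \<cdot>\<^sub>v v (SOME X. X \<in> \<I> \<and> X <#> K = C) | c. True}" for C
  have L: "L (X <#> K) = {c \<cdot>\<^sub>v v X | c. True}" if X: "X \<in> \<I>" for X
  proof -
    define Y where "Y = (SOME Y. Y \<in> \<I> \<and> Y <#> K = X <#> K)"
    have Y: "Y \<in> \<I>" "Y <#> K = X <#> K"
      using someI[of "\<lambda>Y. Y \<in> \<I> \<and> Y <#> K = X <#> K" X] X unfolding Y_def by auto
    obtain x y where xy: "x \<in> carrier G" "X = x <# H" "y \<in> carrier G" "Y = y <# H"
      using coset_cases X Y(1) by metis
    define k where "k = inv y \<otimes> x"
    have k: "k \<in> K"
      unfolding k_def using Y(2) xy coset_set_mult_K l_coset_eq_iff[OF K_subgroup xy(1,3)] by simp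
    have "X = Y #> k" using xy k unfolding k_def by (simp add: rt_coset inv_cancel_left)
    then have vX: "v X = cnj (\<psi> k) \<cdot>\<^sub>v v Y"
      using fk[OF Y(1) k] unfolding v_def by (intro eq_vecI) auto
    have psi: "\<psi> k \<noteq> 0" using unit[OF k] by auto
    have "L (X <#> K) = {c \<cdot>\<^sub>v v Y | c. True}" unfolding L_def Y_def ..
    also have "\<dots> = {c \<cdot>\<^sub>v v X | c. True}"
    proof (intro equalityI subsetI)
      fix u assume "u \<in> {c \<cdot>\<^sub>v v Y | c. True}"
      then obtain c where "u = c \<cdot>\<^sub>v v Y" by auto
      then have "u = (c / cnj (\<psi> k)) \<cdot>\<^sub>v v X"
        using psi unfolding vX by (simp add: smult_smult_assoc)
      then show "u \<in> {c \<cdot>\<^sub>v v X | c. True}" by blast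
    next
      fix u assume "u \<in> {c \<cdot>\<^sub>v v X | c. True}"
      then obtain c where "u = c \<cdot>\<^sub>v v X" by auto
      then have "u = (c * cnj (\<psi> k)) \<cdot>\<^sub>v v Y" unfolding vX by (simp add: smult_smult_assoc)
      then show "u \<in> {c \<cdot>\<^sub>v v Y | c. True}" by blast
    qed
    finally show ?thesis .
  qed
  have rep: "\<exists>X\<in>\<I>. C = X <#> K" if "C \<in> lcosets K" for C
    using that coset_mem coset_set_mult_K unfolding LCOSETS_def[of G K] by fastforce
  have vL: "v X \<in> L (X <#> K)" if "X \<in> \<I>" for X
    unfolding L[OF that] by (intro CollectI exI[of _ 1]) simp
  have line: "is_line d (L C)" if "C \<in> lcosets K" for C
    using rep[OF that] L v0 vc unfolding is_line_def by metis
  have aut: "coset_action G K g \<in> line_automorphisms d (lcosets K) L" if g: "g \<in> carrier G" for g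
  proof -
    have bij: "bij_betw (\<lambda>X. g <# X) \<I> \<I>" using bij_lt[OF g] .
    have gr: "(\<Sum>m<d. f (g <# Y) m * cnj (f (g <# X) m)) = (\<Sum>m<d. f Y m * cnj (f X m))"
      if "X \<in> \<I>" "Y \<in> \<I>" for X Y
      using invariant_lt[OF inv g that] unfolding Ef .
    obtain Q where Q: "unitary_mat d Q" "\<forall>X\<in>\<I>. Q *\<^sub>v v X = v (g <# X)"
      using frame_unitary[of "\<lambda>X. g <# X" \<I> d f, OF bij frame gr] unfolding v_def by blast
    have "(\<lambda>v. Q *\<^sub>v v) ` L C = L (coset_action G K g C)" if C: "C \<in> lcosets K" for C
    proof -
      obtain X where X: "X \<in> \<I>" "C = X <#> K" using rep[OF C] by blast
      obtain x where x: "x \<in> carrier G" "X = x <# H" using coset_cases[OF X(1)] .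
      have "g <# C = (g <# X) <#> K"
        using X(2) x g coset_set_mult_K lcos_m_assoc[OF subgroup.subset[OF K_subgroup] g x(1)]
        by (simp add: lt_coset)
      then have "L (coset_action G K g C) = {c \<cdot>\<^sub>v v (g <# X) | c. True}"
        using C L[OF lt_mem[OF g X(1)]] unfolding coset_action_def by simp
      also have "\<dots> = (\<lambda>v. Q *\<^sub>v v) ` {c \<cdot>\<^sub>v v X | c. True}"
        using Q(2) X(1) mult_mat_vec[OF unitary_carrier[OF Q(1)] vc] by (auto simp: image_def)
      finally show ?thesis using L[OF X(1)] X(2) by simp
    qed
    moreover have "coset_action G K g \<in> Bij (lcosets K)"
      using group_hom.hom_closed[of G "BijGroup (lcosets K)" "coset_action G K" g] doubly_transitive g
      unfolding doubly_transitive_action_def group_action_def by (simp add: BijGroup_def)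
    ultimately show ?thesis unfolding line_automorphisms_def using Q(1) by blast
  qed
  have "doubly_transitive_lines d (lcosets K) L"
    unfolding doubly_transitive_lines_def doubly_transitive_action_def
  proof (intro conjI ballI impI)
    show "group_action (BijGroup (lcosets K)\<lparr>carrier := line_automorphisms d (lcosets K) L\<rparr>)
        (lcosets K) (\<lambda>\<sigma>. \<sigma>)"
      using line by (rule line_automorphisms_action)
    fix x y x' y' assume "x \<in> lcosets K" "y \<in> lcosets K" "x' \<in> lcosets K" "y' \<in> lcosets K" "x \<noteq> y" "x' \<noteq> y'"
    from doubly_transitive_actionD[OF doubly_transitive this] obtain g
      where "g \<in> carrier G" "coset_action G K g x = x'" "coset_action G K g y = y'" .
    then show "\<exists>g\<in>carrier (BijGroup (lcosets K)\<lparr>carrier := line_automorphisms d (lcosets K) L\<rparr>).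
        g x = x' \<and> g y = y'"
      using aut by (auto intro!: bexI[of _ "coset_action G K g"])
  qed (rule line)
  moreover have "lines_span_space d (lcosets K) L"
    unfolding lines_span_space_def
  proof (rule span_of_frame[OF finite_cosets frame])
    show "(\<Union>i\<in>lcosets K. L i) \<subseteq> carrier_vec d" using is_line_carrier[OF line] by blast
    show "vec d (f X) \<in> (\<Union>i\<in>lcosets K. L i)" if "X \<in> \<I>" for X
      using vL[OF that] set_mult_K_mem[OF that] unfolding v_def by blast
  qed
  moreover have "equal_norm_representatives (lcosets K) L d r \<I> (\<lambda>X. X <#> K) v"
    unfolding equal_norm_representatives_def
    using set_mult_K_mem card_K_fiber vL v0 gram EXX by auto
  moreover have "E = gram_matrix \<I> v"
    unfolding gram_matrix_def gram using invariant_outside[OF inv] by (auto simp: fun_eq_iff)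
  ultimately show "\<exists>d<n. \<exists>(L :: 'a set \<Rightarrow> complex vec set) v.
      doubly_transitive_lines d (lcosets K) L \<and> lines_span_space d (lcosets K) L \<and>
      equal_norm_representatives (lcosets K) L d r \<I> (\<lambda>X. X <#> K) v \<and>
      E = gram_matrix \<I> v \<and> coset_action G K ` carrier G \<subseteq> line_automorphisms d (lcosets K) L"
    using dn aut by blast
qed

end

lemma higman_pair_key: "higman_pair G H \<Longrightarrow> \<exists>b. key_pair G H b"
  unfolding higman_pair_def key_pair_def key_pair_axioms_def finite_pair_def finite_pair_axioms_def by blast

section \<open>Primitivity from singularity\<close>

context key_pair
begin

text \<open>A vanishing entry at \<open>b\<close> makes \<open>N\<close> block diagonal, and
  \<open>u\<close> has at most one nonzero coordinate per block. The kernel equation in row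
  \<open>X\<close> thus reduces to the single term \<open>N X X * u X\<close>, which kills the entry
  at \<open>\<one>\<close> too.\<close>

lemma block_eq_zero:
  assumes N: "equivariant \<psi> N" and Nb: "ent N b = 0"
    and ker: "\<And>X. X \<in> \<I> \<Longrightarrow> (\<Sum>Z\<in>\<I>. N X Z * u Z) = 0"
    and transversal: "\<And>X Y. X \<in> \<I> \<Longrightarrow> Y \<in> \<I> \<Longrightarrow> u X \<noteq> 0 \<Longrightarrow> u Y \<noteq> 0 \<Longrightarrow> X <#> K = Y <#> K \<Longrightarrow> X = Y"
    and X: "X \<in> \<I>" "u X \<noteq> 0"
  shows "N = (\<lambda>X Y. 0)"
proof -
  have inv: "invariant N" using equivariant_invariant[OF N] .
  have out: "ent N g = 0" if g: "g \<in> carrier G" "g \<notin> K" for g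
  proof -
    obtain h k where hk: "h \<in> H" "k \<in> K" "g = h \<otimes> b \<otimes> k" using outside_K[OF g] .
    show ?thesis unfolding hk(3) using equivariant_ent_outside[OF N hk(1,2)] Nb by simp
  qed
  have "N X Z * u Z = (if Z = X then N X X * u X else 0)" if Z: "Z \<in> \<I>" for Z
  proof (cases "Z = X \<or> u Z = 0")
    case False
    then have ne: "X <#> K \<noteq> Z <#> K" using transversal[OF X(1) Z X(2)] by auto
    obtain x where x: "x \<in> carrier G" "X = x <# H" using coset_cases[OF X(1)] .
    obtain z where z: "z \<in> carrier G" "Z = z <# H" using coset_cases[OF Z] .
    have "inv z \<otimes> x \<notin> K" using ne x z coset_set_mult_K l_coset_eq_iff[OF K_subgroup x(1) z(1)] by simp
    then have "N X Z = 0" using out[of "inv z \<otimes> x"] x z by (simp add: invariant_entry[OF inv])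
    then show ?thesis using False by simp
  qed auto
  then have "(\<Sum>Z\<in>\<I>. N X Z * u Z) = (\<Sum>Z\<in>\<I>. if Z = X then N X X * u X else 0)"
    by (intro sum.cong refl)
  then have "N X X * u X = 0" using ker[OF X(1)] finite_cosets X(1) by simp
  then have "N X X = 0" using X(2) by simp
  then have N1: "ent N \<one> = 0" using X(1) by (auto elim!: coset_cases simp: invariant_entry[OF inv])
  have zero: "equivariant \<psi> (\<lambda>X Y. 0)" unfolding equivariant_def invariant_def by simp
  show ?thesis by (rule equivariant_eqI[OF N zero]) (use N1 Nb in \<open>simp_all add: ent_def\<close>)
qed

lemma mtimes_kernel:
  assumes "\<And>X. X \<in> \<I> \<Longrightarrow> (\<Sum>Z\<in>\<I>. M X Z * u Z) = 0"
  shows "(\<Sum>Z\<in>\<I>. mtimes \<I> N M X Z * u Z) = (0::complex)"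
proof -
  have "(\<Sum>Z\<in>\<I>. mtimes \<I> N M X Z * u Z) = (\<Sum>Z\<in>\<I>. \<Sum>W\<in>\<I>. N X W * (M W Z * u Z))"
    unfolding mtimes_def by (simp add: sum_distrib_right mult.assoc)
  also have "\<dots> = (\<Sum>W\<in>\<I>. \<Sum>Z\<in>\<I>. N X W * (M W Z * u Z))" by (rule sum.swap)
  also have "\<dots> = 0" using assms by (simp add: sum_distrib_left[symmetric])
  finally show ?thesis .
qed

lemma lincomb_kernel:
  assumes "(\<Sum>Z\<in>\<I>. A X Z * u Z) = 0" "(\<Sum>Z\<in>\<I>. B X Z * u Z) = (0::complex)"
  shows "(\<Sum>Z\<in>\<I>. (s * A X Z + t * B X Z) * u Z) = 0"
proof -
  have "(\<Sum>Z\<in>\<I>. (s * A X Z + t * B X Z) * u Z) = s * (\<Sum>Z\<in>\<I>. A X Z * u Z) + t * (\<Sum>Z\<in>\<I>. B X Z * u Z)"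
    by (simp add: sum_distrib_left sum.distrib algebra_simps)
  then show ?thesis using assms by simp
qed

text \<open>Subtracting from the square the multiple of \<open>M\<close> that agrees with it at
  \<open>b\<close> stays in the eigenspace and still annihilates \<open>u\<close>, so nothing
  remains. The factor is positive because the square has a column norm as its entry at
  \<open>\<one>\<close>.\<close>

lemma singular_square:
  assumes M: "equivariant \<psi> M" and adj: "madjoint M = M" and Mb: "ent M b \<noteq> 0"
    and M1: "ent M \<one> = of_real m" "m > 0"
    and ker: "\<And>X. X \<in> \<I> \<Longrightarrow> (\<Sum>Z\<in>\<I>. M X Z * u Z) = 0"
    and transversal: "\<And>X Y. X \<in> \<I> \<Longrightarrow> Y \<in> \<I> \<Longrightarrow> u X \<noteq> 0 \<Longrightarrow> u Y \<noteq> 0 \<Longrightarrow> X <#> K = Y <#> K \<Longrightarrow> X = Y"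
    and X: "X \<in> \<I>" "u X \<noteq> 0"
  obtains t where "t > 0" "mtimes \<I> M M = (\<lambda>X Y. of_real t * M X Y)"
proof -
  have inv: "invariant M" using equivariant_invariant[OF M] .
  define C where "C = mtimes \<I> M M"
  have Ceq: "equivariant \<psi> C" unfolding C_def using equivariant_mtimes[OF M inv] .
  define s where "s = ent C b / ent M b"
  define N where "N = (\<lambda>X Y. 1 * C X Y + (- s) * M X Y)"
  have Neq: "equivariant \<psi> N" unfolding N_def using equivariant_lincomb[OF Ceq M] .
  have Nb: "ent N b = 0" unfolding N_def s_def using Mb by (simp add: ent_def)
  have Nker: "(\<Sum>Z\<in>\<I>. N X Z * u Z) = 0" if "X \<in> \<I>" for X
    unfolding N_def
    by (rule lincomb_kernel[of C X u M]) (use mtimes_kernel[OF ker] ker[OF that] C_def in auto)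
  have "N = (\<lambda>X Y. 0)" by (rule block_eq_zero[OF Neq Nb Nker transversal X])
  then have C: "C X Y = s * M X Y" for X Y using fun_cong[of "N X" "\<lambda>Y. 0" Y] unfolding N_def by (simp add: fun_eq_iff)
  define q where "q = (\<Sum>Z\<in>\<I>. (cmod (M Z H))\<^sup>2)"
  have Cq: "ent C \<one> = of_real q"
    unfolding q_def C_def using mtimes_self_diag[OF adj, of \<I> H] by (simp add: ent_def one_coset)
  have "(cmod (M (b <# H) H))\<^sup>2 \<le> q"
    unfolding q_def using finite_cosets coset_mem[OF b_carrier] by (intro member_le_sum) auto
  moreover have "(cmod (M (b <# H) H))\<^sup>2 > 0" using Mb by (simp add: ent_def)
  ultimately have q: "q > 0" by linarith
  have "s * of_real m = of_real q" using C[of "\<one> <# H" H] Cq M1(1) by (simp add: ent_def)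
  then have "s = of_real (q / m)" using M1(2) by (simp add: field_simps)
  then show ?thesis using that[of "q / m"] q M1(2) C unfolding C_def by (simp add: fun_eq_iff)
qed

text \<open>By commutativity \<open>P M = P\<close>, so \<open>P\<close> annihilates
  \<open>u\<close>; by \<open>M P = P\<close> it lies in the eigenspace of \<open>M\<close>.
  Matching the entry at \<open>b\<close> then shows that \<open>P\<close> is a multiple of
  \<open>M\<close>, and a nonzero idempotent multiple of \<open>M\<close> is
  \<open>M\<close>.\<close>

lemma singular_primitive:
  assumes M: "equivariant \<psi> M" and adj: "madjoint M = M" and Mb: "ent M b \<noteq> 0"
    and idem: "mtimes \<I> M M = M"
    and ker: "\<And>X. X \<in> \<I> \<Longrightarrow> (\<Sum>Z\<in>\<I>. M X Z * u Z) = 0"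
    and transversal: "\<And>X Y. X \<in> \<I> \<Longrightarrow> Y \<in> \<I> \<Longrightarrow> u X \<noteq> 0 \<Longrightarrow> u Y \<noteq> 0 \<Longrightarrow> X <#> K = Y <#> K \<Longrightarrow> X = Y"
    and X: "X \<in> \<I>" "u X \<noteq> 0"
  shows "primitive_idempotent G H M"
  unfolding primitive_idempotent_def
proof (intro conjI allI impI)
  have inv: "invariant M" using equivariant_invariant[OF M] .
  show "scheme_projection G H M" unfolding scheme_projection_def using inv idem adj scheme_algebra_iff by simp
  show "M \<noteq> (\<lambda>X Y. 0)" using Mb by (auto simp: ent_def)
  fix P assume "scheme_projection G H P \<and> P \<noteq> (\<lambda>X Y. 0) \<and> mtimes \<I> M P = P"
  then have Pinv: "invariant P" and PP: "mtimes \<I> P P = P" and Pnz: "P \<noteq> (\<lambda>X Y. 0)" and MP: "mtimes \<I> M P = P"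
    unfolding scheme_projection_def using scheme_algebra_iff by auto
  have PM: "mtimes \<I> P M = P" using invariant_commute[OF inv Pinv] MP by simp
  have Peq: "equivariant \<psi> P" using equivariant_mtimes[OF M Pinv] MP by simp
  define t where "t = ent P b / ent M b"
  define N where "N = (\<lambda>X Y. 1 * P X Y + (- t) * M X Y)"
  have Neq: "equivariant \<psi> N" unfolding N_def using equivariant_lincomb[OF Peq M] .
  have Nb: "ent N b = 0" unfolding N_def t_def using Mb by (simp add: ent_def)
  have Pker: "(\<Sum>Z\<in>\<I>. mtimes \<I> P M X Z * u Z) = 0" for X
    using ker by (rule mtimes_kernel)
  have Nker: "(\<Sum>Z\<in>\<I>. N X Z * u Z) = 0" if "X \<in> \<I>" for X
    unfolding N_def using Pker[of X] ker[OF that] unfolding PM by (rule lincomb_kernel)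
  have "N = (\<lambda>X Y. 0)" by (rule block_eq_zero[OF Neq Nb Nker transversal X])
  then have P: "P = (\<lambda>X Y. t * M X Y)" unfolding N_def by (simp add: fun_eq_iff)
  have "mtimes \<I> P P = (\<lambda>X Y. t * t * mtimes \<I> M M X Y)"
    unfolding P mtimes_def by (simp add: sum_distrib_left mult_ac)
  then have "P = (\<lambda>X Y. t * t * M X Y)" unfolding PP idem .
  from fun_cong[OF fun_cong[OF this]] fun_cong[OF fun_cong[OF P]]
  have "t * t * M (b <# H) H = t * M (b <# H) H" by metis
  then have "t * t = t" using Mb by (simp add: ent_def)
  moreover have "t \<noteq> 0" using Pnz P by auto
  ultimately have "t = 1" by simp
  then show "P = M" using P by simp
qed

lemma carries_schemeI:
  assumes M: "invariant M"
    and sep: "\<And>g g'. g \<in> carrier G \<Longrightarrow> g' \<in> carrier G \<Longrightarrow> ent M g = ent M g' \<Longrightarrow> double_coset G H g = double_coset G H g'"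
  shows "carries_scheme G H M"
proof -
  define c where "c D = ent M (SOME x. x \<in> D)" for D
  have c: "c (double_coset G H g) = ent M g" if "g \<in> carrier G" for g
    unfolding c_def using ent_double_coset[OF M that] someI[of "\<lambda>x. x \<in> double_coset G H g", OF double_coset_self[OF that]]
    by simp
  have "inj_on c (double_cosets G H)"
  proof (rule inj_onI)
    fix D D' assume "D \<in> double_cosets G H" "D' \<in> double_cosets G H" and eq: "c D = c D'"
    then obtain g g' where "g \<in> carrier G" "D = double_coset G H g" "g' \<in> carrier G" "D' = double_coset G H g'"
      unfolding double_cosets_def by auto
    then show "D = D'" using sep[of g g'] c eq by simp
  qed
  moreover have "M = scheme_combination G H c" using M c by (rule scheme_combination_eq)
  ultimately show ?thesis unfolding carries_scheme_def by blast
qed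

end

section \<open>Coset actions, inner products and linear dependence\<close>

lemma coset_group_action:
  fixes G (structure)
  assumes "group G" "subgroup K G"
  shows "group_action G (lcosets\<^bsub>G\<^esub> K) (coset_action G K)"
proof -
  interpret group G by fact
  have KG: "K \<subseteq> carrier G" using subgroup.subset[OF assms(2)] .
  have mem: "g <# C \<in> lcosets K" if "g \<in> carrier G" "C \<in> lcosets K" for g C
    using that KG by (auto simp: LCOSETS_def lcos_m_assoc)
  have assoc: "g <# (h <# C) = (g \<otimes> h) <# C" if "g \<in> carrier G" "h \<in> carrier G" "C \<in> lcosets K" for g h C
    using that lcos_m_assoc[of C g h] subgroup.lcosets_carrier[OF assms(2) is_group] by auto
  have one: "\<one> <# C = C" if "C \<in> lcosets K" for C
    using lcos_mult_one subgroup.lcosets_carrier[OF assms(2) is_group that] by auto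
  have Bij: "coset_action G K g \<in> Bij (lcosets K)" if g: "g \<in> carrier G" for g
  proof -
    have "bij_betw (coset_action G K g) (lcosets K) (lcosets K)"
      by (rule bij_betw_byWitness[where f' = "\<lambda>C. inv g <# C"])
        (use g mem in \<open>auto simp: coset_action_def assoc one\<close>)
    then show ?thesis unfolding Bij_def coset_action_def by auto
  qed
  have "group_hom G (BijGroup (lcosets K)) (coset_action G K)"
  proof (rule group_hom.intro[OF is_group group_BijGroup], unfold group_hom_axioms_def, rule homI)
    show "coset_action G K g \<in> carrier (BijGroup (lcosets K))" if "g \<in> carrier G" for g
      using Bij[OF that] by (simp add: BijGroup_def)
    show "coset_action G K (g \<otimes> h) = coset_action G K g \<otimes>\<^bsub>BijGroup (lcosets K)\<^esub> coset_action G K h"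
      if "g \<in> carrier G" "h \<in> carrier G" for g h
      using that Bij mem by (auto simp: BijGroup_def compose_def coset_action_def assoc fun_eq_iff)
  qed
  then show ?thesis unfolding group_action_def .
qed

lemma cinner_smult_left:
  fixes x y :: "complex vec"
  shows "x \<in> carrier_vec d \<Longrightarrow> y \<in> carrier_vec d \<Longrightarrow> (c \<cdot>\<^sub>v x) \<bullet>c y = c * (x \<bullet>c y)"
  by (simp add: cscalar_prod_sum[of y d] sum_distrib_left mult.assoc)

lemma cinner_smult_right:
  fixes x y :: "complex vec"
  shows "x \<in> carrier_vec d \<Longrightarrow> y \<in> carrier_vec d \<Longrightarrow> x \<bullet>c (c \<cdot>\<^sub>v y) = cnj c * (x \<bullet>c y)"
  by (simp add: cscalar_prod_sum[of _ d] sum_distrib_left mult_ac)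

lemma cinner_swap:
  fixes x y :: "complex vec"
  shows "x \<in> carrier_vec d \<Longrightarrow> y \<in> carrier_vec d \<Longrightarrow> y \<bullet>c x = cnj (x \<bullet>c y)"
  by (simp add: cscalar_prod_sum[of _ d] mult.commute)

lemma cinner_minus_left:
  fixes x y z :: "complex vec"
  shows "x \<in> carrier_vec d \<Longrightarrow> y \<in> carrier_vec d \<Longrightarrow> z \<in> carrier_vec d \<Longrightarrow> (x - y) \<bullet>c z = x \<bullet>c z - y \<bullet>c z"
  by (simp add: cscalar_prod_sum[of _ d] sum_subtractf left_diff_distrib)

lemma cinner_self:
  fixes x :: "complex vec"
  assumes "x \<in> carrier_vec d"
  shows "x \<bullet>c x = of_real (Re (x \<bullet>c x))" "x \<noteq> 0\<^sub>v d \<Longrightarrow> Re (x \<bullet>c x) > 0"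
proof -
  have e: "x \<bullet>c x = of_real (\<Sum>i<d. (cmod (x $ i))\<^sup>2)"
    using assms by (simp only: cscalar_prod_sum complex_norm_square of_real_sum)
  then show "x \<bullet>c x = of_real (Re (x \<bullet>c x))" by simp
  assume "x \<noteq> 0\<^sub>v d"
  then obtain i where i: "i < d" "x $ i \<noteq> 0" using assms by (metis eq_vecI carrier_vecD index_zero_vec)
  have "(cmod (x $ i))\<^sup>2 \<le> (\<Sum>i<d. (cmod (x $ i))\<^sup>2)" using i(1) by (intro member_le_sum) auto
  moreover have "(cmod (x $ i))\<^sup>2 > 0" using i(2) by simp
  ultimately have "(\<Sum>i<d. (cmod (x $ i))\<^sup>2) > 0" by linarith
  then show "Re (x \<bullet>c x) > 0" unfolding e Re_complex_of_real .
qed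

lemma unitary_cinner:
  assumes Q: "unitary_mat d Q" and x: "x \<in> carrier_vec d" and y: "y \<in> carrier_vec d"
  shows "(Q *\<^sub>v x) \<bullet>c (Q *\<^sub>v y) = x \<bullet>c y"
proof -
  have Qc: "Q \<in> carrier_mat d d" using unitary_carrier[OF Q] .
  have ent: "(\<Sum>m<d. Q $$ (m, k) * cnj (Q $$ (m, l))) = (if k = l then 1 else 0)" if "k < d" "l < d" for k l
  proof -
    have "(\<Sum>m<d. Q $$ (m, k) * cnj (Q $$ (m, l))) = (mat_adjoint Q * Q) $$ (l, k)"
      using that Qc mat_adjoint_carrier[OF Qc]
      by (simp add: scalar_prod_def index_mat_adjoint lessThan_atLeast0 mult.commute)
    then show ?thesis using Q that unfolding unitary_mat_def by auto
  qed
  have Qv: "(Q *\<^sub>v z) $ m = (\<Sum>k<d. Q $$ (m, k) * z $ k)" if "m < d" "z \<in> carrier_vec d" for m z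
    using that Qc by (simp add: scalar_prod_def lessThan_atLeast0)
  have "(Q *\<^sub>v x) \<bullet>c (Q *\<^sub>v y) = (\<Sum>m<d. (\<Sum>k<d. Q $$ (m, k) * x $ k) * cnj (\<Sum>l<d. Q $$ (m, l) * y $ l))"
    using mult_mat_vec_carrier[OF Qc y] x y Qv by (simp add: cscalar_prod_sum[of _ d] del: index_mult_mat_vec)
  also have "\<dots> = (\<Sum>m<d. \<Sum>k<d. \<Sum>l<d. x $ k * cnj (y $ l) * (Q $$ (m, k) * cnj (Q $$ (m, l))))"
    by (simp add: sum_product mult_ac)
  also have "\<dots> = (\<Sum>k<d. \<Sum>m<d. \<Sum>l<d. x $ k * cnj (y $ l) * (Q $$ (m, k) * cnj (Q $$ (m, l))))"
    by (rule sum.swap)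
  also have "\<dots> = (\<Sum>k<d. \<Sum>l<d. \<Sum>m<d. x $ k * cnj (y $ l) * (Q $$ (m, k) * cnj (Q $$ (m, l))))"
    by (intro sum.cong refl sum.swap)
  also have "\<dots> = (\<Sum>k<d. \<Sum>l<d. if l = k then x $ k * cnj (y $ l) else 0)"
    using ent by (intro sum.cong refl) (auto simp: sum_distrib_left[symmetric])
  also have "\<dots> = x \<bullet>c y" using y by (simp add: cscalar_prod_sum[of y d])
  finally show ?thesis .
qed

lemma is_line_eq:
  assumes "is_line d S" "x \<in> S" "x \<noteq> 0\<^sub>v d"
  shows "S = {c \<cdot>\<^sub>v x | c. True}"
proof -
  obtain y where y: "y \<in> carrier_vec d" "S = {c \<cdot>\<^sub>v y | c. True}" using assms(1) unfolding is_line_def by auto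
  then obtain a where a: "x = a \<cdot>\<^sub>v y" using assms(2) by auto
  have a0: "a \<noteq> 0" using assms(3) a y(1) by auto
  show ?thesis
  proof (intro equalityI subsetI)
    fix z assume "z \<in> S"
    then obtain c where "z = c \<cdot>\<^sub>v y" using y by auto
    then have "z = (c / a) \<cdot>\<^sub>v x" using a a0 by (simp add: smult_smult_assoc)
    then show "z \<in> {c \<cdot>\<^sub>v x | c. True}" by blast
  next
    fix z assume "z \<in> {c \<cdot>\<^sub>v x | c. True}"
    then obtain c where "z = (c * a) \<cdot>\<^sub>v y" using a by (auto simp: smult_smult_assoc)
    then show "z \<in> S" using y by blast
  qed
qed

text \<open>The \<open>d\<close> coordinates are padded with zero rows to a square matrix; row
  \<open>d\<close> exists because \<open>d < n\<close> and makes the determinant vanish.\<close>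

lemma linear_dependence:
  fixes y :: "nat \<Rightarrow> complex vec"
  assumes "d < n" "\<And>i. i < n \<Longrightarrow> y i \<in> carrier_vec d"
  obtains a where "\<exists>i<n. a i \<noteq> 0" "\<And>k. k < d \<Longrightarrow> (\<Sum>i<n. a i * y i $ k) = 0"
proof -
  define A where "A = mat n n (\<lambda>(k, i). if k < d then y i $ k else 0)"
  have A: "A \<in> carrier_mat n n" unfolding A_def by simp
  have "A = mat\<^sub>r n n (\<lambda>k. if k = d then 0\<^sub>v n else row A k)"
    unfolding A_def by (intro eq_matI) auto
  then have "det A = 0"
    using det_row_0[OF assms(1), of "\<lambda>k. row A k"] A by auto
  then obtain v where v: "v \<in> carrier_vec n" "v \<noteq> 0\<^sub>v n" "A *\<^sub>v v = 0\<^sub>v n"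
    using det_0_iff_vec_prod_zero_field[OF A] by auto
  have "\<exists>i<n. v $ i \<noteq> 0" using v(1,2) by (metis eq_vecI carrier_vecD index_zero_vec)
  moreover have "(\<Sum>i<n. v $ i * y i $ k) = 0" if k: "k < d" for k
  proof -
    have "(A *\<^sub>v v) $ k = (\<Sum>i<n. v $ i * y i $ k)"
      using k assms(1) v(1) unfolding A_def by (simp add: scalar_prod_def lessThan_atLeast0 mult.commute)
    then show ?thesis using v(3) k assms(1) by simp
  qed
  ultimately show ?thesis using that[of "\<lambda>i. v $ i"] by blast
qed

section \<open>The Higman pair of a group of unitary matrices\<close>

text \<open>An abstract finite group is represented by unitary matrices \<open>\<rho>\<close>, and
  \<open>\<sigma>\<close> records how they permute the lines. By \<open>scalars\<close>, each
  eigenvalue at \<open>u\<close> is realized by a scalar matrix in the group, so that stabilizer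
  elements can be corrected to fix \<open>u\<close>; \<open>b_real\<close> is the source of the
  symmetry of the key.\<close>

locale line_group = group G for G (structure) +
  fixes n d :: nat and L :: "nat \<Rightarrow> complex vec set"
    and \<rho> :: "'a \<Rightarrow> complex mat" and \<sigma> :: "'a \<Rightarrow> nat \<Rightarrow> nat" and b :: 'a and u :: "complex vec"
  assumes finite_carrier: "finite (carrier G)"
    and n3: "3 \<le> n" and dn: "d < n" and L_inj: "inj_on L {..<n}"
    and line: "i < n \<Longrightarrow> is_line d (L i)"
    and unitary: "g \<in> carrier G \<Longrightarrow> unitary_mat d (\<rho> g)"
    and \<rho>_mult: "g \<in> carrier G \<Longrightarrow> h \<in> carrier G \<Longrightarrow> \<rho> (g \<otimes> h) = \<rho> g * \<rho> h"
    and \<sigma>_less: "g \<in> carrier G \<Longrightarrow> i < n \<Longrightarrow> \<sigma> g i < n"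
    and \<sigma>_line: "g \<in> carrier G \<Longrightarrow> i < n \<Longrightarrow> (\<lambda>v. \<rho> g *\<^sub>v v) ` L i = L (\<sigma> g i)"
    and transitive2: "\<lbrakk>i < n; j < n; i' < n; j' < n; i \<noteq> j; i' \<noteq> j'\<rbrakk> \<Longrightarrow>
      \<exists>g\<in>carrier G. \<sigma> g i = i' \<and> \<sigma> g j = j'"
    and u_line: "u \<in> L 0" and u_nonzero: "u \<noteq> 0\<^sub>v d"
    and scalars: "g \<in> carrier G \<Longrightarrow> \<rho> g *\<^sub>v u = c \<cdot>\<^sub>v u \<Longrightarrow> \<exists>z\<in>carrier G. \<rho> z = c \<cdot>\<^sub>m 1\<^sub>m d"
    and not_orthogonal: "\<lbrakk>i < n; j < n; x \<in> L i; y \<in> L j; x \<noteq> 0\<^sub>v d; y \<noteq> 0\<^sub>v d\<rbrakk> \<Longrightarrow> x \<bullet>c y \<noteq> 0"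
    and b_mem: "b \<in> carrier G" and b_moves: "\<sigma> b 0 \<noteq> 0" and b_real: "(\<rho> b *\<^sub>v u) \<bullet>c u \<in> \<real>"
begin

definition "w g = \<rho> g *\<^sub>v u"

text \<open>On the stabilizer \<open>S\<close> this is the eigenvalue at \<open>u\<close>; elsewhere
  it is the normalized inner product that separates the remaining double cosets of
  \<open>H\<close>.\<close>

definition "\<chi> g = (w g \<bullet>c u) / (u \<bullet>c u)"

definition "S = {g \<in> carrier G. \<sigma> g 0 = 0}"

definition "H = {g \<in> carrier G. w g = u}"

lemma n_pos: "0 < n" using n3 by simp

lemma u_carrier: "u \<in> carrier_vec d"
  using u_line is_line_carrier[OF line[OF n_pos]] by auto

lemma w_line: "g \<in> carrier G \<Longrightarrow> w g \<in> L (\<sigma> g 0)"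
  unfolding w_def using \<sigma>_line[of g 0] n_pos u_line by blast

lemma w_carrier: "g \<in> carrier G \<Longrightarrow> w g \<in> carrier_vec d"
  unfolding w_def using mult_mat_vec_carrier[OF unitary_carrier[OF unitary] u_carrier] .

lemma w_mult: "g \<in> carrier G \<Longrightarrow> h \<in> carrier G \<Longrightarrow> w (g \<otimes> h) = \<rho> g *\<^sub>v w h"
  unfolding w_def \<rho>_mult
  using assoc_mult_mat_vec[OF unitary_carrier[OF unitary] unitary_carrier[OF unitary] u_carrier] by simp

lemma w_cinner:
  "\<lbrakk>g \<in> carrier G; x \<in> carrier G; y \<in> carrier G\<rbrakk> \<Longrightarrow> w (g \<otimes> x) \<bullet>c w (g \<otimes> y) = w x \<bullet>c w y"
  using unitary_cinner[OF unitary w_carrier w_carrier] by (simp add: w_mult)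

text \<open>Multiplicativity gives only an idempotent, but an idempotent unitary matrix is the
  identity.\<close>

lemma \<rho>_one: "\<rho> \<one> = 1\<^sub>m d"
proof -
  note Q = unitary[OF one_closed]
  note c = unitary_carrier[OF Q] mat_adjoint_carrier[OF unitary_carrier[OF Q]]
  have i: "mat_adjoint (\<rho> \<one>) * \<rho> \<one> = 1\<^sub>m d" using Q unfolding unitary_mat_def by simp
  have "\<rho> \<one> = (mat_adjoint (\<rho> \<one>) * \<rho> \<one>) * \<rho> \<one>" using i c by simp
  also have "\<dots> = mat_adjoint (\<rho> \<one>) * (\<rho> \<one> * \<rho> \<one>)" using c by (simp add: assoc_mult_mat)
  also have "\<dots> = 1\<^sub>m d" using \<rho>_mult[OF one_closed one_closed] i by simp
  finally show ?thesis .
qed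

lemma w_one: "w \<one> = u"
  unfolding w_def \<rho>_one using u_carrier by simp

lemma w_norm: "g \<in> carrier G \<Longrightarrow> w g \<bullet>c w g = u \<bullet>c u"
  using w_cinner[of g \<one> \<one>] by (simp add: w_one)

lemma uu: "u \<bullet>c u = of_real (Re (u \<bullet>c u))" "Re (u \<bullet>c u) > 0" "u \<bullet>c u \<noteq> 0"
proof -
  show a: "u \<bullet>c u = of_real (Re (u \<bullet>c u))" "Re (u \<bullet>c u) > 0"
    using cinner_self[OF u_carrier] u_nonzero by auto
  then show "u \<bullet>c u \<noteq> 0" by auto
qed

lemma w_nonzero: "g \<in> carrier G \<Longrightarrow> w g \<noteq> 0\<^sub>v d"
  using w_norm[of g] uu(3) by auto

lemma line_eqI:
  assumes "i < n" "j < n" "x \<in> L i" "x \<in> L j" "x \<noteq> 0\<^sub>v d"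
  shows "i = j"
proof -
  have "L i = L j" using is_line_eq[OF line[OF assms(1)]] is_line_eq[OF line[OF assms(2)]] assms by metis
  then show ?thesis using L_inj assms(1,2) by (simp add: inj_on_def)
qed

text \<open>Distinct lines share no nonzero vector, so one nonzero image vector determines the image
  line.\<close>

lemma \<sigma>_eqI:
  assumes "g \<in> carrier G" "i < n" "j < n" "x \<in> L i" "x \<noteq> 0\<^sub>v d" "\<rho> g *\<^sub>v x \<in> L j"
  shows "\<sigma> g i = j"
proof (rule line_eqI[OF \<sigma>_less[OF assms(1,2)] assms(3) _ assms(6)])
  have x: "x \<in> carrier_vec d" using assms is_line_carrier[OF line[OF assms(2)]] by auto
  show "\<rho> g *\<^sub>v x \<in> L (\<sigma> g i)" using \<sigma>_line[OF assms(1,2)] assms(4) by blast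
  have "(\<rho> g *\<^sub>v x) \<bullet>c (\<rho> g *\<^sub>v x) = x \<bullet>c x" using unitary_cinner[OF unitary[OF assms(1)] x x] .
  moreover have "x \<bullet>c x \<noteq> 0" using cinner_self[OF x] assms(5) by force
  ultimately show "\<rho> g *\<^sub>v x \<noteq> 0\<^sub>v d" by auto
qed

lemma \<sigma>_mult:
  assumes g: "g \<in> carrier G" and h: "h \<in> carrier G"
  shows "\<sigma> (g \<otimes> h) 0 = \<sigma> g (\<sigma> h 0)"
proof (rule line_eqI[OF _ _ _ _ w_nonzero])
  show gh: "g \<otimes> h \<in> carrier G" using g h by simp
  show "\<sigma> (g \<otimes> h) 0 < n" "\<sigma> g (\<sigma> h 0) < n" using gh g h \<sigma>_less n_pos by auto
  show "w (g \<otimes> h) \<in> L (\<sigma> (g \<otimes> h) 0)" using w_line[OF gh] .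
  show "w (g \<otimes> h) \<in> L (\<sigma> g (\<sigma> h 0))"
    unfolding w_mult[OF g h] using \<sigma>_line[OF g \<sigma>_less[OF h n_pos]] w_line[OF h] by blast
qed

lemma stabilizer_iff:
  assumes "g \<in> carrier G"
  shows "g \<in> S \<longleftrightarrow> (\<exists>c. w g = c \<cdot>\<^sub>v u)"
proof
  assume "g \<in> S"
  then have "w g \<in> L 0" using w_line[OF assms] unfolding S_def by simp
  then show "\<exists>c. w g = c \<cdot>\<^sub>v u" using is_line_eq[OF line[OF n_pos] u_line u_nonzero] by auto
next
  assume "\<exists>c. w g = c \<cdot>\<^sub>v u"
  then have "w g \<in> L 0" using is_line_eq[OF line[OF n_pos] u_line u_nonzero] by auto
  then have "\<sigma> g 0 = 0"
    using \<sigma>_eqI[OF assms n_pos n_pos u_line u_nonzero] unfolding w_def by simp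
  then show "g \<in> S" unfolding S_def using assms by simp
qed

lemma stabilizer_eigen: "g \<in> S \<Longrightarrow> w g = \<chi> g \<cdot>\<^sub>v u"
proof -
  assume g: "g \<in> S"
  then obtain c where c: "w g = c \<cdot>\<^sub>v u" using stabilizer_iff unfolding S_def by auto
  then have "\<chi> g = c" unfolding \<chi>_def using uu(3) u_carrier by (simp add: cinner_smult_left[of _ d])
  then show ?thesis using c by simp
qed

lemma S_carrier: "g \<in> S \<Longrightarrow> g \<in> carrier G"
  unfolding S_def by simp

lemma H_iff: "g \<in> carrier G \<Longrightarrow> g \<in> H \<longleftrightarrow> g \<in> S \<and> \<chi> g = 1"
proof
  assume g: "g \<in> carrier G" "g \<in> H"
  then have w: "w g = 1 \<cdot>\<^sub>v u" unfolding H_def by simp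
  then have "g \<in> S" using stabilizer_iff[OF g(1)] by blast
  moreover have "\<chi> g = 1" unfolding \<chi>_def w using uu(3) by simp
  ultimately show "g \<in> S \<and> \<chi> g = 1" by simp
next
  assume "g \<in> carrier G" "g \<in> S \<and> \<chi> g = 1"
  then show "g \<in> H" unfolding H_def using stabilizer_eigen[of g] by simp
qed

lemma w_mult_S: "g \<in> carrier G \<Longrightarrow> k \<in> S \<Longrightarrow> w (g \<otimes> k) = \<chi> k \<cdot>\<^sub>v w g"
  using w_mult[OF _ S_carrier] stabilizer_eigen[of k] mult_mat_vec[OF unitary_carrier[OF unitary] u_carrier]
  by (simp add: w_def[of g])

lemma \<chi>_mult_right: "g \<in> carrier G \<Longrightarrow> k \<in> S \<Longrightarrow> \<chi> (g \<otimes> k) = \<chi> k * \<chi> g"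
  unfolding \<chi>_def[of "g \<otimes> k"] \<chi>_def[of g] w_mult_S
  by (simp add: cinner_smult_left[OF w_carrier u_carrier])

lemma \<chi>_unit: "k \<in> S \<Longrightarrow> \<chi> k * cnj (\<chi> k) = 1"
proof -
  assume k: "k \<in> S"
  have "u \<bullet>c u = (\<chi> k \<cdot>\<^sub>v u) \<bullet>c (\<chi> k \<cdot>\<^sub>v u)" using w_norm[OF S_carrier[OF k]] stabilizer_eigen[OF k] by simp
  also have "\<dots> = \<chi> k * cnj (\<chi> k) * (u \<bullet>c u)"
    using u_carrier by (simp add: cinner_smult_left[of _ d] cinner_smult_right[of _ d])
  finally show ?thesis using uu(3) by simp
qed

text \<open>No two lines are orthogonal. This holds on all of \<open>G\<close> and permits the
  cancellation of \<open>\<chi> b\<close> in the last condition on the key.\<close>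

lemma \<chi>_nonzero: "g \<in> carrier G \<Longrightarrow> \<chi> g \<noteq> 0"
  unfolding \<chi>_def using not_orthogonal[OF \<sigma>_less n_pos w_line u_line w_nonzero u_nonzero] n_pos uu(3) by simp

text \<open>Unlike multiplication from the right, this needs unitarity: \<open>\<rho> k\<close>
  passes to the other side of the inner product, where \<open>u\<close> is an eigenvector with
  unimodular eigenvalue.\<close>

lemma \<chi>_mult_left:
  assumes k: "k \<in> S" and g: "g \<in> carrier G"
  shows "\<chi> (k \<otimes> g) = \<chi> k * \<chi> g"
proof -
  note kc = S_carrier[OF k]
  have "w g \<bullet>c u = w (k \<otimes> g) \<bullet>c w k" using w_cinner[OF kc g one_closed] kc by (simp add: w_one)
  also have "\<dots> = cnj (\<chi> k) * (w (k \<otimes> g) \<bullet>c u)"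
    unfolding stabilizer_eigen[OF k] using cinner_smult_right[OF w_carrier u_carrier] kc g by simp
  finally have "\<chi> k * (w g \<bullet>c u) = (\<chi> k * cnj (\<chi> k)) * (w (k \<otimes> g) \<bullet>c u)" by simp
  then show ?thesis unfolding \<chi>_def[of g] \<chi>_def[of "k \<otimes> g"] \<chi>_unit[OF k] by simp
qed

lemma S_subgroup: "subgroup S G"
proof (rule subgroupI)
  show "S \<subseteq> carrier G" unfolding S_def by auto
  have "\<one> \<in> S" using stabilizer_iff[OF one_closed] w_one by (metis one_smult_vec)
  then show "S \<noteq> {}" by blast
  show "a \<otimes> c \<in> S" if "a \<in> S" "c \<in> S" for a c
    using that \<sigma>_mult unfolding S_def by auto
  fix a assume a: "a \<in> S"
  then have ac: "a \<in> carrier G" using S_carrier by simp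
  have "u = w (inv a \<otimes> a)" using ac w_one by simp
  also have "\<dots> = \<chi> a \<cdot>\<^sub>v w (inv a)" using w_mult_S[OF inv_closed[OF ac] a] .
  finally have "(1 / \<chi> a) \<cdot>\<^sub>v u = (1 / \<chi> a) \<cdot>\<^sub>v (\<chi> a \<cdot>\<^sub>v w (inv a))" by (rule arg_cong)
  then have "w (inv a) = (1 / \<chi> a) \<cdot>\<^sub>v u"
    using \<chi>_nonzero[OF ac] by (simp add: smult_smult_assoc)
  then show "inv a \<in> S" using stabilizer_iff[OF inv_closed[OF ac]] by blast
qed

lemma S_mult: "a \<in> S \<Longrightarrow> c \<in> S \<Longrightarrow> a \<otimes> c \<in> S"
  using subgroup.m_closed[OF S_subgroup] .

lemma S_inv: "a \<in> S \<Longrightarrow> inv a \<in> S"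
  using subgroup.m_inv_closed[OF S_subgroup] .

lemma \<chi>_one: "\<chi> \<one> = 1" unfolding \<chi>_def w_one using uu(3) by simp

lemma \<chi>_inv: "a \<in> S \<Longrightarrow> \<chi> (inv a) * \<chi> a = 1"
  using \<chi>_mult_right[OF inv_closed[OF S_carrier], of a a] S_carrier[of a] \<chi>_one by (simp add: mult.commute)

lemma H_eq: "H = {g \<in> S. \<chi> g = 1}"
  using H_iff S_carrier unfolding H_def by blast

lemma H_subgroup: "subgroup H G"
proof (rule subgroupI)
  show "H \<subseteq> carrier G" unfolding H_def by auto
  show "H \<noteq> {}" unfolding H_def using w_one one_closed by blast
  show "a \<otimes> c \<in> H" if "a \<in> H" "c \<in> H" for a c
    using that S_mult \<chi>_mult_left S_carrier unfolding H_eq by auto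
  show "inv a \<in> H" if "a \<in> H" for a
    using that S_inv \<chi>_inv[of a] unfolding H_eq by auto
qed

text \<open>Dividing \<open>k\<close> by the scalar matrix with its eigenvalue leaves an element
  that fixes \<open>u\<close>. Since \<open>z\<close> scales all vectors alike, \<open>k\<close> and
  \<open>h\<close> move the lines in the same way.\<close>

lemma scalar_factor:
  assumes k: "k \<in> S"
  obtains z h where "z \<in> carrier G" "h \<in> H" "k = z \<otimes> h" "\<forall>g\<in>carrier G. w (z \<otimes> g) = \<chi> k \<cdot>\<^sub>v w g"
proof -
  note kc = S_carrier[OF k]
  obtain z where z: "z \<in> carrier G" "\<rho> z = \<chi> k \<cdot>\<^sub>m 1\<^sub>m d"
    using scalars[OF kc] stabilizer_eigen[OF k] unfolding w_def by blast
  have zg: "w (z \<otimes> g) = \<chi> k \<cdot>\<^sub>v w g" if "g \<in> carrier G" for g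
    unfolding w_mult[OF z(1) that] z(2) using w_carrier[OF that] by (intro eq_vecI) auto
  have wz: "w z = \<chi> k \<cdot>\<^sub>v u" using zg[OF one_closed] z(1) by (simp add: w_one)
  then have zS: "z \<in> S" using stabilizer_iff[OF z(1)] by blast
  have chz: "\<chi> z = \<chi> k" unfolding \<chi>_def[of z] wz
    using uu(3) u_carrier by (simp add: cinner_smult_left[of _ d])
  have "\<chi> (inv z \<otimes> k) = 1" using \<chi>_mult_left[OF S_inv[OF zS] kc] \<chi>_inv[OF zS] chz by simp
  then have "inv z \<otimes> k \<in> H" unfolding H_eq using S_mult[OF S_inv[OF zS] k] by simp
  moreover have "k = z \<otimes> (inv z \<otimes> k)" using z(1) kc by (simp add: inv_cancel_left)
  ultimately show ?thesis using that z(1) zg by blast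
qed

text \<open>Conjugation by \<open>S\<close> preserves \<open>H\<close> because \<open>\<chi>\<close>
  is multiplicative there. Conversely, an element of the normalizer that moves line \<open>0\<close>
  to line \<open>j\<close> forces \<open>H\<close> to fix line \<open>j\<close>; by the scalar
  factorization so does all of \<open>S\<close>, against double transitivity.\<close>

lemma normalizer_H: "normalizer G H = S"
proof (intro equalityI subsetI)
  fix a assume a: "a \<in> S"
  then have ac: "a \<in> carrier G" using S_carrier by simp
  have "a \<otimes> h \<otimes> inv a \<in> H" if a: "a \<in> S" and h: "h \<in> H" for a h
  proof -
    have hS: "h \<in> S" "\<chi> h = 1" using h unfolding H_eq by auto
    have "\<chi> (a \<otimes> h \<otimes> inv a) = \<chi> (inv a) * \<chi> a"
      using a hS S_carrier S_inv by (simp add: \<chi>_mult_right)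
    then show ?thesis using \<chi>_inv[OF a] S_mult[OF S_mult[OF a hS(1)] S_inv[OF a]] unfolding H_eq by simp
  qed
  from this[OF a] this[OF S_inv[OF a]] show "a \<in> normalizer G H"
    unfolding mem_normalizer_iff[OF H_subgroup] using ac by simp
next
  fix g assume "g \<in> normalizer G H"
  then have g: "g \<in> carrier G" "\<And>h. h \<in> H \<Longrightarrow> inv g \<otimes> h \<otimes> g \<in> H"
    unfolding mem_normalizer_iff[OF H_subgroup] by auto
  define j where "j = \<sigma> g 0"
  have j: "j < n" unfolding j_def using \<sigma>_less g n_pos by simp
  show "g \<in> S"
  proof (rule ccontr)
    assume "g \<notin> S"
    then have j0: "j \<noteq> 0" unfolding j_def S_def using g by simp
    \<comment> \<open>A third line is needed: with only two, the stabilizer of one would fix the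
      other.\<close>
    obtain m where m: "m < n" "m \<noteq> 0" "m \<noteq> j"
      using that[of 1] that[of 2] n3 by (cases "j = 1") auto
    obtain k where k: "k \<in> carrier G" "\<sigma> k 0 = 0" "\<sigma> k j = m"
      using transitive2[OF n_pos j n_pos m(1)] j0 m(2) by metis
    have kS: "k \<in> S" unfolding S_def using k by simp
    obtain z h where zh: "z \<in> carrier G" "h \<in> H" "k = z \<otimes> h"
        "\<forall>g\<in>carrier G. w (z \<otimes> g) = \<chi> k \<cdot>\<^sub>v w g"
      using scalar_factor[OF kS] .
    have hc: "h \<in> carrier G" using zh(2) unfolding H_def by simp
    have "w (h \<otimes> g) = w (g \<otimes> (inv g \<otimes> h \<otimes> g))" using g(1) hc by (simp add: m_assoc inv_cancel_left)
    also have "\<dots> = w g"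
      using g(2)[OF zh(2)] w_mult_S[OF g(1), of "inv g \<otimes> h \<otimes> g"] unfolding H_eq by simp
    finally have hg: "w (h \<otimes> g) = w g" .
    have "w (k \<otimes> g) = \<chi> k \<cdot>\<^sub>v w g" using zh g(1) hc hg by (simp add: m_assoc)
    then have "w (k \<otimes> g) \<in> L j"
      using is_line_eq[OF line[OF j] _ w_nonzero[OF g(1)]] w_line[OF g(1)] unfolding j_def by auto
    then have "\<sigma> k j = j"
      using \<sigma>_eqI[OF k(1) j j _ w_nonzero[OF g(1)]] w_line[OF g(1)] w_mult[OF k(1) g(1)] unfolding j_def by simp
    then show False using k(3) m(3) by simp
  qed
qed

text \<open>Some \<open>k\<close> in \<open>S\<close> takes the line of \<open>g\<close> to the line
  of \<open>g'\<close>, and only its factor \<open>h\<close> in \<open>H\<close> matters for lines.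
  Hence \<open>h \<otimes> g\<close> and \<open>g'\<close> differ on the right by an element of
  \<open>S\<close>, which equality of the values of \<open>\<chi>\<close> puts into
  \<open>H\<close>.\<close>

lemma \<chi>_separates:
  assumes g: "g \<in> carrier G" "g \<notin> S" and g': "g' \<in> carrier G" "g' \<notin> S" and eq: "\<chi> g = \<chi> g'"
  obtains h h' where "h \<in> H" "h' \<in> H" "g' = h \<otimes> g \<otimes> h'"
proof -
  have ne: "\<sigma> g 0 \<noteq> 0" "\<sigma> g' 0 \<noteq> 0" using g g' unfolding S_def by auto
  obtain k where k: "k \<in> carrier G" "\<sigma> k 0 = 0" "\<sigma> k (\<sigma> g 0) = \<sigma> g' 0"
    using transitive2[OF n_pos \<sigma>_less[OF g(1) n_pos] n_pos \<sigma>_less[OF g'(1) n_pos]] ne by metis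
  have kS: "k \<in> S" unfolding S_def using k by simp
  obtain z h where zh: "z \<in> carrier G" "h \<in> H" "k = z \<otimes> h"
      "\<forall>g\<in>carrier G. w (z \<otimes> g) = \<chi> k \<cdot>\<^sub>v w g"
    using scalar_factor[OF kS] .
  have hc: "h \<in> carrier G" and hS: "h \<in> S" "\<chi> h = 1" using zh(2) unfolding H_eq using S_carrier by auto
  have "w (k \<otimes> g) = \<chi> k \<cdot>\<^sub>v w (h \<otimes> g)" using zh g(1) hc by (simp add: m_assoc)
  then have hg: "w (h \<otimes> g) = (1 / \<chi> k) \<cdot>\<^sub>v w (k \<otimes> g)" using \<chi>_nonzero[OF k(1)] by (simp add: smult_smult_assoc)
  have "w (k \<otimes> g) \<in> L (\<sigma> g' 0)" using w_line[of "k \<otimes> g"] k g(1) by (simp add: \<sigma>_mult)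
  then have "\<exists>c. w (k \<otimes> g) = c \<cdot>\<^sub>v w g'"
    using is_line_eq[OF line[OF \<sigma>_less[OF g'(1) n_pos]] w_line[OF g'(1)] w_nonzero[OF g'(1)]] by auto
  then obtain c where c: "w (k \<otimes> g) = c \<cdot>\<^sub>v w g'" by blast
  define h' where "h' = inv g' \<otimes> (h \<otimes> g)"
  have h'c: "h' \<in> carrier G" unfolding h'_def using g g' hc by simp
  have gh': "g' \<otimes> h' = h \<otimes> g" unfolding h'_def using g(1) g'(1) hc by (simp add: inv_cancel_left)
  have ig: "inv g' \<in> carrier G" using g'(1) by simp
  have "w h' = \<rho> (inv g') *\<^sub>v w (h \<otimes> g)" unfolding h'_def using w_mult[OF ig] hc g(1) by simp
  also have "w (h \<otimes> g) = (1 / \<chi> k * c) \<cdot>\<^sub>v w g'" unfolding hg c by (simp add: smult_smult_assoc)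
  also have "\<rho> (inv g') *\<^sub>v ((1 / \<chi> k * c) \<cdot>\<^sub>v w g') = (1 / \<chi> k * c) \<cdot>\<^sub>v (\<rho> (inv g') *\<^sub>v w g')"
    by (rule mult_mat_vec[OF unitary_carrier[OF unitary[OF ig]] w_carrier[OF g'(1)]])
  also have "\<rho> (inv g') *\<^sub>v w g' = u" using w_mult[OF ig g'(1)] g'(1) by (simp add: w_one)
  finally have h'S: "h' \<in> S" using stabilizer_iff[OF h'c] by blast
  have "\<chi> h' * \<chi> g' = \<chi> (g' \<otimes> h')" using \<chi>_mult_right[OF g'(1) h'S] by simp
  also have "\<dots> = \<chi> g" unfolding gh' using \<chi>_mult_left[OF hS(1) g(1)] hS(2) by simp
  finally have "\<chi> h' = 1" using eq \<chi>_nonzero[OF g'(1)] by simp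
  then have h'H: "h' \<in> H" using h'S unfolding H_eq by simp
  have "g' = (g' \<otimes> h') \<otimes> inv h'" using g'(1) h'c by (simp add: m_assoc)
  then have "g' = h \<otimes> g \<otimes> inv h'" unfolding gh' .
  then show ?thesis using that zh(2) subgroup.m_inv_closed[OF H_subgroup h'H] by blast
qed

lemma coset_S_iff:
  assumes "g \<in> carrier G" "h \<in> carrier G"
  shows "g <# S = h <# S \<longleftrightarrow> \<sigma> g 0 = \<sigma> h 0"
proof -
  have "g <# S = h <# S \<longleftrightarrow> inv h \<otimes> g \<in> S" using l_coset_eq_iff[OF S_subgroup assms] .
  also have "\<dots> \<longleftrightarrow> \<sigma> g 0 = \<sigma> h 0"
  proof
    assume "inv h \<otimes> g \<in> S"
    then have "\<sigma> (h \<otimes> (inv h \<otimes> g)) 0 = \<sigma> h 0" using \<sigma>_mult[OF assms(2), of "inv h \<otimes> g"] assms unfolding S_def by simp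
    then show "\<sigma> g 0 = \<sigma> h 0" using assms by (simp add: inv_cancel_left)
  next
    assume "\<sigma> g 0 = \<sigma> h 0"
    then have "\<sigma> (inv h \<otimes> g) 0 = \<sigma> (inv h) (\<sigma> h 0)" using assms \<sigma>_mult by simp
    also have "\<dots> = \<sigma> (inv h \<otimes> h) 0" using \<sigma>_mult[OF inv_closed[OF assms(2)] assms(2)] by (rule sym)
    also have "\<dots> = 0" using assms subgroup.one_closed[OF S_subgroup] unfolding S_def by simp
    finally show "inv h \<otimes> g \<in> S" unfolding S_def using assms by simp
  qed
  finally show ?thesis .
qed

lemma doubly_transitive_S: "doubly_transitive_action G (lcosets S) (coset_action G S)"
  unfolding doubly_transitive_action_def
proof (intro conjI ballI impI)
  show "group_action G (lcosets S) (coset_action G S)"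
    using coset_group_action[OF is_group S_subgroup] .
  fix x y x' y' assume xy: "x \<in> lcosets S" "y \<in> lcosets S" "x' \<in> lcosets S" "y' \<in> lcosets S" "x \<noteq> y" "x' \<noteq> y'"
  then obtain g h g' h' where g: "g \<in> carrier G" "x = g <# S" "h \<in> carrier G" "y = h <# S"
      "g' \<in> carrier G" "x' = g' <# S" "h' \<in> carrier G" "y' = h' <# S"
    unfolding LCOSETS_def by auto
  obtain t where t: "t \<in> carrier G" "\<sigma> t (\<sigma> g 0) = \<sigma> g' 0" "\<sigma> t (\<sigma> h 0) = \<sigma> h' 0"
    using transitive2[of "\<sigma> g 0" "\<sigma> h 0" "\<sigma> g' 0" "\<sigma> h' 0"] g xy(5,6) \<sigma>_less n_pos coset_S_iff by auto
  have "coset_action G S t (f <# S) = (t \<otimes> f) <# S" if "f \<in> carrier G" for f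
    using that t(1) lcos_m_assoc[OF subgroup.subset[OF S_subgroup]] unfolding coset_action_def LCOSETS_def by auto
  then have "coset_action G S t x = x'" "coset_action G S t y = y'"
    using g t coset_S_iff by (simp_all add: \<sigma>_mult)
  then show "\<exists>g\<in>carrier G. coset_action G S g x = x' \<and> coset_action G S g y = y'" using t(1) by blast
qed

lemma b_notin: "b \<notin> S"
  unfolding S_def using b_moves by simp

lemma inv_b_notin: "inv b \<notin> S"
  using S_inv[of "inv b"] b_mem b_notin by auto

text \<open>Inversion conjugates the inner product with \<open>u\<close>, and at \<open>b\<close>
  this product is real.\<close>

lemma \<chi>_inv_b: "\<chi> (inv b) = \<chi> b"
proof -
  have "w (inv b) \<bullet>c u = w (b \<otimes> inv b) \<bullet>c w (b \<otimes> \<one>)"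
    using w_cinner[OF b_mem inv_closed[OF b_mem] one_closed] by (simp add: w_one)
  also have "\<dots> = u \<bullet>c w b" using b_mem by (simp add: w_one)
  also have "\<dots> = w b \<bullet>c u"
    using cinner_swap[OF w_carrier[OF b_mem] u_carrier] b_real unfolding w_def by (simp add: Reals_cnj_iff)
  finally show ?thesis unfolding \<chi>_def by simp
qed

lemma double_coset_eq_if:
  assumes "g \<in> carrier G" "g \<notin> S" "g' \<in> carrier G" "g' \<notin> S" "\<chi> g = \<chi> g'"
  shows "g' \<in> double_coset G H g"
  using \<chi>_separates[OF assms] mem_double_coset[OF H_subgroup assms(1)] by metis

lemma \<chi>_double_coset:
  assumes "g \<in> carrier G" "x \<in> double_coset G H g"
  shows "\<chi> x = \<chi> g"
proof -
  obtain h h' where "h \<in> H" "h' \<in> H" "x = h \<otimes> g \<otimes> h'" using assms mem_double_coset[OF H_subgroup] by blast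
  then show ?thesis using assms(1) S_carrier \<chi>_mult_left \<chi>_mult_right unfolding H_eq by simp
qed

lemma comm_quotient: "comm_group (G\<lparr>carrier := S\<rparr> Mod H)"
proof -
  let ?S = "G\<lparr>carrier := S\<rparr>"
  interpret N: normal H ?S using subgroup_in_normalizer[OF H_subgroup] unfolding normalizer_H .
  show ?thesis
  proof (rule group.group_comm_groupI[OF N.factorgroup_is_group])
    fix x y assume "x \<in> carrier (?S Mod H)" "y \<in> carrier (?S Mod H)"
    then obtain a c where a: "a \<in> S" "x = H #>\<^bsub>?S\<^esub> a" and c: "c \<in> S" "y = H #>\<^bsub>?S\<^esub> c"
      by (auto simp: FactGroup_def RCOSETS_def)
    have "\<chi> ((a \<otimes> c) \<otimes> inv (c \<otimes> a)) = \<chi> (inv (c \<otimes> a)) * \<chi> (c \<otimes> a)"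
      using a c S_carrier S_mult S_inv by (simp add: \<chi>_mult_right mult.commute)
    then have "\<chi> ((a \<otimes> c) \<otimes> inv (c \<otimes> a)) = 1" using \<chi>_inv[OF S_mult[OF c(1) a(1)]] by simp
    moreover have "(a \<otimes> c) \<otimes> inv (c \<otimes> a) \<in> S" using S_mult S_inv a c by simp
    ultimately have h: "(a \<otimes> c) \<otimes> inv (c \<otimes> a) \<in> H" unfolding H_eq by simp
    have "a \<otimes> c = ((a \<otimes> c) \<otimes> inv (c \<otimes> a)) \<otimes> (c \<otimes> a)"
      using a c S_carrier by (simp add: m_assoc inv_mult_group inv_cancel_left)
    then have "a \<otimes> c \<in> H #> (c \<otimes> a)" using h unfolding r_coset_def by blast
    then have "H #> (c \<otimes> a) = H #> (a \<otimes> c)"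
      using repr_independence[OF _ _ H_subgroup] a c S_carrier by simp
    then have "H #>\<^bsub>?S\<^esub> (a \<otimes> c) = H #>\<^bsub>?S\<^esub> (c \<otimes> a)" by (simp add: r_coset_def)
    then show "x \<otimes>\<^bsub>?S Mod H\<^esub> y = y \<otimes>\<^bsub>?S Mod H\<^esub> x"
      using a c N.rcos_sum[of a c] N.rcos_sum[of c a] by (simp add: FactGroup_def)
  qed
qed

text \<open>Outside \<open>S\<close> the value of \<open>\<chi>\<close> determines the double coset,
  so the conditions on \<open>inv b\<close> and on conjugates of \<open>b\<close> become equalities
  of numbers; the last condition is cancellation of the nonzero \<open>\<chi> b\<close>.\<close>

lemma higman_key_b: "higman_key G H b"
  unfolding higman_key_def Let_def normalizer_H
proof (intro conjI ballI impI)
  show "b \<in> carrier G - S" using b_mem b_notin by simp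
  show "doubly_transitive_action G (lcosets S) (coset_action G S)" using doubly_transitive_S .
  show "comm_group (G\<lparr>carrier := S\<rparr> Mod H)" using comm_quotient .
  interpret F: finite_pair G H
    by (intro finite_pair.intro finite_pair_axioms.intro is_group finite_carrier H_subgroup)
  have "inv b \<in> double_coset G H b"
    using double_coset_eq_if[OF b_mem b_notin inv_closed[OF b_mem] inv_b_notin] \<chi>_inv_b by simp
  then show "double_coset G H b = double_coset G H (inv b)"
    using F.double_coset_eqI[OF b_mem] by simp
  fix a assume a: "a \<in> S"
  note ac = S_carrier[OF a]
  have "\<chi> (a \<otimes> b \<otimes> inv a) = \<chi> b"
    using \<chi>_mult_right[OF _ S_inv[OF a], of "a \<otimes> b"] \<chi>_mult_left[OF a b_mem] \<chi>_inv[OF a] ac b_mem by simp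
  moreover have "a \<otimes> b \<otimes> inv a \<notin> S"
  proof
    assume "a \<otimes> b \<otimes> inv a \<in> S"
    then have "inv a \<otimes> (a \<otimes> b \<otimes> inv a) \<otimes> a \<in> S" using a S_mult S_inv by simp
    then show False using ac b_mem b_notin by (simp add: m_assoc inv_cancel_left)
  qed
  ultimately show "a \<otimes> b \<otimes> inv a \<in> double_coset G H b"
    using double_coset_eq_if[OF b_mem b_notin] ac b_mem by simp
  assume "a \<otimes> b \<in> double_coset G H b"
  then have "\<chi> a * \<chi> b = \<chi> b" using \<chi>_double_coset[OF b_mem] \<chi>_mult_left[OF a b_mem] by simp
  then show "a \<in> H" unfolding H_eq using a \<chi>_nonzero[OF b_mem] by simp
qed

lemma higman_pair_H: "higman_pair G H"
  unfolding higman_pair_def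
  using is_group finite_carrier H_subgroup higman_key_b b_mem b_notin H_eq by auto

text \<open>Equality in the Cauchy-Schwarz inequality: the component of \<open>w g\<close>
  orthogonal to \<open>u\<close> would vanish. Thus values of \<open>\<chi>\<close> on
  \<open>S\<close> never occur outside \<open>S\<close>, which is needed for distinct coefficients
  on all double cosets.\<close>

lemma \<chi>_not_unit:
  assumes g: "g \<in> carrier G" "g \<notin> S"
  shows "cmod (\<chi> g) \<noteq> 1"
proof
  assume unit: "cmod (\<chi> g) = 1"
  define x where "x = w g - \<chi> g \<cdot>\<^sub>v u"
  have c: "w g \<in> carrier_vec d" "\<chi> g \<cdot>\<^sub>v u \<in> carrier_vec d" using w_carrier[OF g(1)] u_carrier by auto
  have xc: "x \<in> carrier_vec d" unfolding x_def using c by simp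
  have wu: "w g \<bullet>c u = \<chi> g * (u \<bullet>c u)" unfolding \<chi>_def using uu(3) by simp
  have xu: "x \<bullet>c u = 0"
    unfolding x_def using cinner_minus_left[OF c u_carrier] cinner_smult_left[OF u_carrier u_carrier] wu by simp
  have uw: "u \<bullet>c w g = cnj (\<chi> g) * (u \<bullet>c u)"
    using cinner_swap[OF c(1) u_carrier] wu uu(1) by (metis complex_cnj_complex_of_real complex_cnj_mult)
  have "x \<bullet>c w g = w g \<bullet>c w g - \<chi> g * (u \<bullet>c w g)"
    unfolding x_def using cinner_minus_left[OF c c(1)] cinner_smult_left[OF u_carrier c(1)] by simp
  also have "\<dots> = (1 - \<chi> g * cnj (\<chi> g)) * (u \<bullet>c u)" unfolding w_norm[OF g(1)] uw by (simp add: algebra_simps)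
  also have "\<dots> = 0" using unit complex_norm_square[of "\<chi> g"] by simp
  finally have xw: "x \<bullet>c w g = 0" .
  have sw: "w g \<bullet>c x = 0" "u \<bullet>c x = 0"
    using cinner_swap[OF xc c(1)] cinner_swap[OF xc u_carrier] xw xu by simp_all
  have "x \<bullet>c x = w g \<bullet>c x - \<chi> g * (u \<bullet>c x)"
    using cinner_minus_left[OF c xc] cinner_smult_left[OF u_carrier xc] unfolding x_def by simp
  then have "x \<bullet>c x = 0" using sw by simp
  then have "x = 0\<^sub>v d" using cinner_self(2)[OF xc] by force
  then have x0: "(w g - \<chi> g \<cdot>\<^sub>v u) $ i = 0" if "i < d" for i using that unfolding x_def by simp
  have "w g = \<chi> g \<cdot>\<^sub>v u" by (rule eq_vecI) (use c x0 u_carrier in auto)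
  then show False using stabilizer_iff[OF g(1)] g(2) by blast
qed

lemma \<chi>_double_coset_inj:
  assumes g: "g \<in> carrier G" and g': "g' \<in> carrier G" and eq: "\<chi> g = \<chi> g'"
  shows "double_coset G H g = double_coset G H g'"
proof -
  interpret F: finite_pair G H
    by (intro finite_pair.intro finite_pair_axioms.intro is_group finite_carrier H_subgroup)
  have unit: "cmod (\<chi> k) = 1" if "k \<in> S" for k
    using power_eq_imp_eq_base[of "cmod (\<chi> k)" 2 1] arg_cong[OF \<chi>_unit[OF that], of cmod]
    by (simp add: norm_mult power2_eq_square)
  have "g \<in> double_coset G H g'"
  proof (cases "g \<in> S")
    case True
    then have g'S: "g' \<in> S" using \<chi>_not_unit[OF g'] unit eq by metis
    have "\<chi> (inv g' \<otimes> g) = 1" using \<chi>_mult_left[OF S_inv[OF g'S] g] \<chi>_inv[OF g'S] eq by simp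
    then have "inv g' \<otimes> g \<in> H" using S_mult[OF S_inv[OF g'S] True] unfolding H_eq by simp
    moreover have "g = \<one> \<otimes> g' \<otimes> (inv g' \<otimes> g)" using g g' by (simp add: inv_cancel_left)
    ultimately show ?thesis using mem_double_coset[OF H_subgroup g'] F.H_one by blast
  next
    case False
    then have "g' \<notin> S" using \<chi>_not_unit[OF g] unit eq by metis
    then show ?thesis using double_coset_eq_if[OF g' _ g False] eq by simp
  qed
  then show ?thesis using F.double_coset_eqI[OF g'] by simp
qed

end

section \<open>The Gram matrix of the orbit of a line representative\<close>

context line_group
begin

sublocale P: key_pair G H b
  by (intro key_pair.intro finite_pair.intro finite_pair_axioms.intro key_pair_axioms.intro
      is_group finite_carrier H_subgroup higman_key_b)

lemma P_K: "P.K = S"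
  unfolding P.K_def normalizer_H ..

text \<open>As \<open>w\<close> is constant on cosets of \<open>H\<close>, any representative would
  do; a fixed choice turns \<open>w\<close> into a function on \<open>G/H\<close>.\<close>

definition "rep X = (SOME x. x \<in> carrier G \<and> X = x <# H)"

lemma rep: "X \<in> P.\<I> \<Longrightarrow> rep X \<in> carrier G \<and> X = rep X <# H"
  unfolding rep_def by (rule someI_ex) (auto elim!: P.coset_cases)

lemma rep_coset:
  assumes x: "x \<in> carrier G"
  shows "w (rep (x <# H)) = w x" "\<sigma> (rep (x <# H)) 0 = \<sigma> x 0"
proof -
  define y where "y = rep (x <# H)"
  have y: "y \<in> carrier G" "x <# H = y <# H" using rep[OF P.coset_mem[OF x]] unfolding y_def by auto
  then have "inv x \<otimes> y \<in> H" using l_coset_eq_iff[OF H_subgroup y(1) x] by simp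
  then have h: "inv x \<otimes> y \<in> S" "\<chi> (inv x \<otimes> y) = 1" unfolding H_eq by auto
  have xy: "y = x \<otimes> (inv x \<otimes> y)" using x y by (simp add: inv_cancel_left)
  have "w (x \<otimes> (inv x \<otimes> y)) = w x" using w_mult_S[OF x h(1)] h(2) by simp
  then show "w (rep (x <# H)) = w x" using xy unfolding y_def by simp
  have "\<sigma> (x \<otimes> (inv x \<otimes> y)) 0 = \<sigma> x 0" using \<sigma>_mult[OF x S_carrier[OF h(1)]] h(1) unfolding S_def by simp
  then show "\<sigma> (rep (x <# H)) 0 = \<sigma> x 0" using xy unfolding y_def by simp
qed

definition "M\<^sub>0 = gram_matrix P.\<I> (\<lambda>X. w (rep X))"

lemma M0_entry: "x \<in> carrier G \<Longrightarrow> y \<in> carrier G \<Longrightarrow> M\<^sub>0 (x <# H) (y <# H) = w y \<bullet>c w x"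
  unfolding M\<^sub>0_def gram_matrix_def by (simp add: rep_coset P.coset_mem)

lemma M0_invariant: "P.invariant M\<^sub>0"
  unfolding P.invariant_def
proof (intro conjI allI ballI impI)
  fix X Y assume "M\<^sub>0 X Y \<noteq> 0"
  then show "X \<in> P.\<I>" "Y \<in> P.\<I>" unfolding M\<^sub>0_def gram_matrix_def by presburger+
next
  fix g X Y assume g: "g \<in> carrier G" and X: "X \<in> P.\<I>" and Y: "Y \<in> P.\<I>"
  obtain x where x: "x \<in> carrier G" "X = x <# H" using P.coset_cases[OF X] .
  obtain y where y: "y \<in> carrier G" "Y = y <# H" using P.coset_cases[OF Y] .
  show "M\<^sub>0 (g <# X) (g <# Y) = M\<^sub>0 X Y"
    using g x y by (simp add: P.lt_coset M0_entry w_cinner)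
qed

text \<open>The conjugate appears because \<open>gram_matrix\<close> takes the inner products in
  reversed order; accordingly \<open>M\<^sub>0\<close> belongs to the conjugate of
  \<open>\<chi>\<close>.\<close>

lemma M0_ent: "g \<in> carrier G \<Longrightarrow> P.ent M\<^sub>0 g = cnj (\<chi> g) * (u \<bullet>c u)"
proof -
  assume g: "g \<in> carrier G"
  have "P.ent M\<^sub>0 g = u \<bullet>c w g"
    unfolding P.ent_def using M0_entry[OF g one_closed] by (simp add: P.one_coset w_one)
  also have "\<dots> = cnj (\<chi> g * (u \<bullet>c u))"
    using cinner_swap[OF w_carrier[OF g] u_carrier] uu(3) unfolding \<chi>_def by simp
  also have "\<dots> = cnj (\<chi> g) * (u \<bullet>c u)" using uu(1) by (metis complex_cnj_complex_of_real complex_cnj_mult)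
  finally show ?thesis .
qed

lemma M0_equivariant: "P.equivariant (\<lambda>k. cnj (\<chi> k)) M\<^sub>0"
  unfolding P.equivariant_def
proof (intro conjI ballI)
  show "P.invariant M\<^sub>0" using M0_invariant .
  fix k X Y assume k: "k \<in> P.K" and X: "X \<in> P.\<I>" and Y: "Y \<in> P.\<I>"
  obtain x where x: "x \<in> carrier G" "X = x <# H" using P.coset_cases[OF X] .
  obtain y where y: "y \<in> carrier G" "Y = y <# H" using P.coset_cases[OF Y] .
  have kS: "k \<in> S" using k P_K by simp
  have "w (x \<otimes> k) = \<chi> k \<cdot>\<^sub>v w x" using w_mult_S[OF x(1) kS] .
  then show "M\<^sub>0 (X #> k) Y = cnj (\<chi> k) * M\<^sub>0 X Y"
    using x y k S_carrier[OF kS] w_carrier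
    by (simp add: P.rt_coset M0_entry cinner_smult_right[of _ d])
qed

lemma M0_selfadjoint: "madjoint M\<^sub>0 = M\<^sub>0"
proof (intro ext)
  fix X Y
  show "madjoint M\<^sub>0 X Y = M\<^sub>0 X Y"
  proof (cases "X \<in> P.\<I> \<and> Y \<in> P.\<I>")
    case True
    have "w (rep Y) \<bullet>c w (rep X) = cnj (w (rep X) \<bullet>c w (rep Y))"
      using True rep by (intro cinner_swap[of _ d] w_carrier) auto
    then show ?thesis using True unfolding madjoint_def M\<^sub>0_def gram_matrix_def by simp
  qed (auto simp: madjoint_def M\<^sub>0_def gram_matrix_def)
qed

definition "line_rep i = (SOME g. g \<in> carrier G \<and> \<sigma> g 0 = i)"

lemma line_rep: "i < n \<Longrightarrow> line_rep i \<in> carrier G \<and> \<sigma> (line_rep i) 0 = i"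
proof -
  assume i: "i < n"
  obtain j where j: "j < n" "j \<noteq> i"
    using that[of 0] that[of 1] n3 by (cases "i = 0") auto
  have "\<exists>g\<in>carrier G. \<sigma> g 0 = i \<and> \<sigma> g 1 = j" using transitive2[of 0 1 i j] n3 i j by simp
  then show ?thesis unfolding line_rep_def by (intro someI_ex[of "\<lambda>g. g \<in> carrier G \<and> \<sigma> g 0 = i"]) blast
qed

text \<open>A linear dependence among one vector per line, which exists as \<open>d < n\<close>, is
  spread over \<open>G/H\<close>: each line receives its coefficient on one chosen coset and zero on
  the others above it.\<close>

lemma M0_kernel:
  obtains v X where "\<And>X. X \<in> P.\<I> \<Longrightarrow> (\<Sum>Z\<in>P.\<I>. M\<^sub>0 X Z * v Z) = 0"
    and "\<And>X Y. X \<in> P.\<I> \<Longrightarrow> Y \<in> P.\<I> \<Longrightarrow> v X \<noteq> 0 \<Longrightarrow> v Y \<noteq> 0 \<Longrightarrow> X <#> P.K = Y <#> P.K \<Longrightarrow> X = Y"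
    and "X \<in> P.\<I>" "v X \<noteq> (0::complex)"
proof -
  have yc: "w (line_rep i) \<in> carrier_vec d" if "i < n" for i using w_carrier line_rep[OF that] by simp
  obtain a where a: "\<exists>i<n. a i \<noteq> 0" "\<And>k. k < d \<Longrightarrow> (\<Sum>i<n. a i * w (line_rep i) $ k) = 0"
    using linear_dependence[OF dn, of "\<lambda>i. w (line_rep i)"] yc by blast
  define c where "c i = line_rep i <# H" for i
  define \<pi> where "\<pi> X = \<sigma> (rep X) 0" for X
  define v where "v X = (if X = c (\<pi> X) then a (\<pi> X) else 0)" for X
  have \<pi>: "\<pi> X < n" if "X \<in> P.\<I>" for X unfolding \<pi>_def using rep[OF that] \<sigma>_less n_pos by blast
  have \<pi>c: "\<pi> (c i) = i" if "i < n" for i unfolding \<pi>_def c_def using line_rep[OF that] rep_coset(2) by simp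
  have cI: "c i \<in> P.\<I>" if "i < n" for i unfolding c_def using line_rep[OF that] P.coset_mem by simp
  have vc: "v (c i) = a i" if "i < n" for i unfolding v_def using \<pi>c[OF that] by simp
  have inj: "inj_on c {..<n}" using \<pi>c by (metis inj_on_inverseI lessThan_iff)
  have ker: "(\<Sum>Z\<in>P.\<I>. M\<^sub>0 X Z * v Z) = 0" if X: "X \<in> P.\<I>" for X
  proof -
    have r: "rep X \<in> carrier G" "rep X <# H = X" using rep[OF X] by auto
    have "(\<Sum>Z\<in>P.\<I>. M\<^sub>0 X Z * v Z) = (\<Sum>Z\<in>c ` {..<n}. M\<^sub>0 X Z * v Z)"
    proof (rule sum.mono_neutral_right[OF P.finite_cosets])
      show "c ` {..<n} \<subseteq> P.\<I>" using cI by auto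
      show "\<forall>Z\<in>P.\<I> - c ` {..<n}. M\<^sub>0 X Z * v Z = 0" using \<pi> unfolding v_def by auto
    qed
    also have "\<dots> = (\<Sum>i<n. M\<^sub>0 X (c i) * v (c i))" using sum.reindex[OF inj] by simp
    also have "\<dots> = (\<Sum>i<n. \<Sum>k<d. cnj (w (rep X) $ k) * (a i * w (line_rep i) $ k))"
    proof (intro sum.cong refl)
      fix i assume "i \<in> {..<n}"
      then have i: "i < n" by simp
      have "M\<^sub>0 X (c i) = (\<Sum>k<d. w (line_rep i) $ k * cnj (w (rep X) $ k))"
        using M0_entry[OF r(1), of "line_rep i"] line_rep[OF i] r
          cscalar_prod_sum[OF w_carrier[OF r(1)], of "w (line_rep i)"] unfolding c_def by simp
      then show "M\<^sub>0 X (c i) * v (c i) = (\<Sum>k<d. cnj (w (rep X) $ k) * (a i * w (line_rep i) $ k))"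
        using vc[OF i] by (simp add: sum_distrib_left sum_distrib_right mult_ac)
    qed
    also have "\<dots> = (\<Sum>k<d. \<Sum>i<n. cnj (w (rep X) $ k) * (a i * w (line_rep i) $ k))" by (rule sum.swap)
    also have "\<dots> = 0" using a(2) by (simp add: sum_distrib_left[symmetric])
    finally show ?thesis .
  qed
  have tr: "X = Y" if X: "X \<in> P.\<I>" and Y: "Y \<in> P.\<I>" and v: "v X \<noteq> 0" "v Y \<noteq> 0" and eq: "X <#> P.K = Y <#> P.K" for X Y
  proof -
    have x: "rep X \<in> carrier G" "X = rep X <# H" and y: "rep Y \<in> carrier G" "Y = rep Y <# H"
      using rep[OF X] rep[OF Y] by auto
    have "rep X <# S = rep Y <# S"
      using eq P.coset_set_mult_K[OF x(1)] P.coset_set_mult_K[OF y(1)] x(2) y(2) P_K by metis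
    then have "\<pi> X = \<pi> Y" unfolding \<pi>_def using coset_S_iff x y by simp
    moreover have "X = c (\<pi> X)" "Y = c (\<pi> Y)" using v unfolding v_def by metis+
    ultimately show ?thesis by simp
  qed
  obtain i where i: "i < n" "a i \<noteq> 0" using a(1) by blast
  have vi: "v (c i) \<noteq> 0" using vc[OF i(1)] i(2) by simp
  show ?thesis by (rule that[OF ker tr cI[OF i(1)] vi])
qed

lemma card_lcosets_S: "card (lcosets S) = n"
proof -
  have "lcosets S = (\<lambda>i. line_rep i <# S) ` {..<n}"
  proof (intro equalityI subsetI)
    fix C assume "C \<in> lcosets S"
    then obtain g where g: "g \<in> carrier G" "C = g <# S" unfolding LCOSETS_def by auto
    then have "C = line_rep (\<sigma> g 0) <# S"
      using coset_S_iff line_rep[OF \<sigma>_less[OF g(1) n_pos]] by simp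
    then show "C \<in> (\<lambda>i. line_rep i <# S) ` {..<n}" using \<sigma>_less[OF g(1) n_pos] by blast
  next
    fix C assume "C \<in> (\<lambda>i. line_rep i <# S) ` {..<n}"
    then show "C \<in> lcosets S" using line_rep unfolding LCOSETS_def by auto
  qed
  moreover have "inj_on (\<lambda>i. line_rep i <# S) {..<n}"
    using coset_S_iff line_rep by (intro inj_onI) (metis lessThan_iff)
  ultimately show ?thesis by (simp add: card_image)
qed

text \<open>The square of \<open>M\<^sub>0\<close> is \<open>t\<close> times
  \<open>M\<^sub>0\<close>, so division by \<open>t\<close> makes it idempotent; on the vectors this
  is the scaling by \<open>1 / sqrt t\<close>.\<close>

theorem higman_representatives:
  "\<exists>r H \<pi> v. higman_pair G H \<and>
     r = subgroup_index G (normalizer G H) H \<and>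
     n = subgroup_index G (carrier G) (normalizer G H) \<and>
     equal_norm_representatives {..<n} L d r (lcosets\<^bsub>G\<^esub> H) \<pi> v \<and>
     carries_scheme G H (gram_matrix (lcosets\<^bsub>G\<^esub> H) v) \<and>
     primitive_idempotent G H (gram_matrix (lcosets\<^bsub>G\<^esub> H) v)"
proof -
  define N where "N = Re (u \<bullet>c u)"
  have N: "u \<bullet>c u = of_real N" "N > 0" using uu unfolding N_def by auto
  have b0: "P.ent M\<^sub>0 b \<noteq> 0" unfolding M0_ent[OF b_mem] using \<chi>_nonzero[OF b_mem] uu(3) by simp
  have M1: "P.ent M\<^sub>0 \<one> = of_real N" using M0_ent[OF one_closed] \<chi>_one N(1) by simp
  obtain z X0 where ker: "\<And>X. X \<in> P.\<I> \<Longrightarrow> (\<Sum>Z\<in>P.\<I>. M\<^sub>0 X Z * z Z) = 0"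
    and tr: "\<And>X Y. X \<in> P.\<I> \<Longrightarrow> Y \<in> P.\<I> \<Longrightarrow> z X \<noteq> 0 \<Longrightarrow> z Y \<noteq> 0 \<Longrightarrow> X <#> P.K = Y <#> P.K \<Longrightarrow> X = Y"
    and X0: "X0 \<in> P.\<I>" "z X0 \<noteq> 0"
    using M0_kernel by blast
  obtain t where t: "t > 0" "mtimes P.\<I> M\<^sub>0 M\<^sub>0 = (\<lambda>X Y. of_real t * M\<^sub>0 X Y)"
    using P.singular_square[OF M0_equivariant M0_selfadjoint b0 M1 N(2) ker tr X0] by blast
  define s where "s = complex_of_real (1 / sqrt t)"
  have s: "s * s = of_real (1 / t)" "cnj s = s" "s \<noteq> 0"
    unfolding s_def using t(1) by (simp_all add: of_real_mult[symmetric] del: of_real_mult of_real_divide)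
  define v where "v X = s \<cdot>\<^sub>v w (rep X)" for X
  define M where "M = gram_matrix P.\<I> v"
  have wc: "w (rep X) \<in> carrier_vec d" if "X \<in> P.\<I>" for X using rep[OF that] w_carrier by simp
  have vv: "v Y \<bullet>c v X = of_real (1 / t) * (w (rep Y) \<bullet>c w (rep X))" if X: "X \<in> P.\<I>" and Y: "Y \<in> P.\<I>" for X Y
  proof -
    have "v Y \<bullet>c v X = s * (cnj s * (w (rep Y) \<bullet>c w (rep X)))"
      unfolding v_def using wc[OF X] wc[OF Y] by (simp add: cinner_smult_left[of _ d] cinner_smult_right[of _ d])
    then show ?thesis using s by (simp add: mult.assoc[symmetric])
  qed
  have M: "M = (\<lambda>X Y. of_real (1 / t) * M\<^sub>0 X Y)"
    unfolding M_def M\<^sub>0_def gram_matrix_def using vv by (auto simp: fun_eq_iff)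
  have Meq: "P.equivariant (\<lambda>k. cnj (\<chi> k)) M"
    using P.equivariant_lincomb[OF M0_equivariant M0_equivariant, of "of_real (1 / t)" 0] unfolding M by simp
  have Madj: "madjoint M = M"
    using fun_cong[OF fun_cong[OF M0_selfadjoint]] unfolding M madjoint_def by (simp add: fun_eq_iff)
  have Mb: "P.ent M b \<noteq> 0" using b0 t(1) unfolding M P.ent_def by simp
  have Mker: "(\<Sum>Z\<in>P.\<I>. M X Z * z Z) = 0" if "X \<in> P.\<I>" for X
    using ker[OF that] unfolding M by (simp add: mult.assoc sum_distrib_left[symmetric] del: of_real_divide)
  have Midem: "mtimes P.\<I> M M = M"
  proof (intro ext)
    fix X Y
    have "mtimes P.\<I> M M X Y = of_real (1 / t) * (of_real (1 / t) * mtimes P.\<I> M\<^sub>0 M\<^sub>0 X Y)"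
      unfolding M mtimes_def by (simp add: sum_distrib_left mult_ac)
    also have "\<dots> = M X Y" unfolding t(2) M using t(1) by simp
    finally show "mtimes P.\<I> M M X Y = M X Y" .
  qed
  have prim: "primitive_idempotent G H M"
    using P.singular_primitive[OF Meq Madj Mb Midem Mker tr X0] .
  have "carries_scheme G H M"
  proof (rule P.carries_schemeI[OF P.equivariant_invariant[OF Meq]])
    fix g g' assume g: "g \<in> carrier G" "g' \<in> carrier G" "P.ent M g = P.ent M g'"
    then have "P.ent M\<^sub>0 g = P.ent M\<^sub>0 g'" unfolding M P.ent_def using t(1) by simp
    then have "\<chi> g = \<chi> g'" unfolding M0_ent[OF g(1)] M0_ent[OF g(2)] using uu(3) by simp
    then show "double_coset G H g = double_coset G H g'" by (rule \<chi>_double_coset_inj[OF g(1,2)])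
  qed
  moreover have "n = subgroup_index G (carrier G) (normalizer G H)"
    unfolding normalizer_H subgroup_index_def using card_lcosets_S by simp
  moreover have "equal_norm_representatives {..<n} L d P.r P.\<I> (\<lambda>X. \<sigma> (rep X) 0) v"
    unfolding equal_norm_representatives_def
  proof (intro conjI ballI)
    show "(\<lambda>X. \<sigma> (rep X) 0) \<in> P.\<I> \<rightarrow> {..<n}" using rep \<sigma>_less n_pos by auto
    fix X Y assume X: "X \<in> P.\<I>" and Y: "Y \<in> P.\<I>"
    show "v X \<bullet>c v X = v Y \<bullet>c v Y" using vv[OF X X] vv[OF Y Y] w_norm rep[OF X] rep[OF Y] by simp
  next
    fix X assume X: "X \<in> P.\<I>"
    then have r: "rep X \<in> carrier G" using rep by simp
    show "v X \<in> L (\<sigma> (rep X) 0)"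
      unfolding v_def is_line_eq[OF line[OF \<sigma>_less[OF r n_pos]] w_line[OF r] w_nonzero[OF r]] by blast
    show "v X \<noteq> 0\<^sub>v d"
    proof
      assume "v X = 0\<^sub>v d"
      then have "v X \<bullet>c v X = 0" by simp
      then show False using vv[OF X X] t(1) w_norm[OF r] uu(3) by simp
    qed
  next
    fix i assume "i \<in> {..<n}"
    then have i: "i < n" by simp
    have "\<sigma> (rep X) 0 = i \<longleftrightarrow> X <#> P.K = line_rep i <# S" if X: "X \<in> P.\<I>" for X
    proof -
      have "X <#> P.K = rep X <# S" using rep[OF X] P.coset_set_mult_K[of "rep X"] P_K by metis
      then show ?thesis using coset_S_iff[of "rep X" "line_rep i"] rep[OF X] line_rep[OF i] by simp
    qed
    then have "{X \<in> P.\<I>. \<sigma> (rep X) 0 = i} = {X \<in> P.\<I>. X <#> P.K = line_rep i <# S}" by blast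
    moreover have "line_rep i <# S \<in> lcosets P.K" unfolding P_K LCOSETS_def using line_rep[OF i] by blast
    ultimately show "card {X \<in> P.\<I>. \<sigma> (rep X) 0 = i} = P.r" using P.card_K_fiber by simp
  qed
  moreover have "P.r = subgroup_index G (normalizer G H) H" unfolding P.r_def P.K_def ..
  ultimately show ?thesis using higman_pair_H prim unfolding M_def by blast
qed

end

section \<open>A finite group of unitary matrices for given lines\<close>

lemma finite_Bij: "finite X \<Longrightarrow> finite (Bij X)"
  by (rule finite_subset[OF _ finite_PiE[of X "\<lambda>_. X"]])
    (auto simp: Bij_def PiE_def Pi_def dest: bij_betwE)

text \<open>Multiplication by \<open>x\<close> permutes \<open>R\<close>, so it multiplies the
  product of all elements by \<open>x ^ card R\<close> and leaves it unchanged.\<close>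

lemma power_card_of_finite_mult_closed:
  fixes R :: "complex set"
  assumes "finite R" "1 \<in> R" "0 \<notin> R" "\<And>x y. x \<in> R \<Longrightarrow> y \<in> R \<Longrightarrow> x * y \<in> R" "x \<in> R"
  shows "x ^ card R = 1"
proof -
  have x: "x \<noteq> 0" using assms by auto
  have inj: "inj_on (\<lambda>y. x * y) R" using x by (auto simp: inj_on_def)
  have "(\<lambda>y. x * y) ` R = R"
    using assms inj by (intro endo_inj_surj) auto
  then have "(\<Prod>y\<in>R. y) = (\<Prod>y\<in>R. x * y)" using prod.reindex[OF inj, of "\<lambda>y. y"] by simp
  also have "\<dots> = x ^ card R * (\<Prod>y\<in>R. y)" by (simp add: prod.distrib)
  finally show ?thesis using assms(1,3) by auto
qed

lemma unimodular_root:
  assumes "d > 0" "cmod z = 1"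
  obtains c where "cmod c = 1" "c ^ d = z"
proof -
  have "cis (Arg z / real d) ^ d = cis (Arg z)" using assms(1) by (simp add: Complex.DeMoivre)
  also have "\<dots> = z"
  proof -
    have "z \<noteq> 0" using assms(2) by auto
    then show ?thesis using assms(2) cis_Arg[of z] by (simp add: sgn_eq)
  qed
  finally show ?thesis using that[of "cis (Arg z / real d)"] by simp
qed

lemma det_mat_adjoint:
  fixes Q :: "complex mat"
  assumes "Q \<in> carrier_mat d d"
  shows "det (mat_adjoint Q) = cnj (det Q)"
proof -
  interpret cnj: comm_ring_hom cnj by unfold_locales auto
  have "mat_adjoint Q = map_mat cnj (transpose_mat Q)"
    using assms mat_adjoint_carrier[OF assms] by (intro eq_matI) (auto simp: index_mat_adjoint)
  then have "det (mat_adjoint Q) = cnj (det (transpose_mat Q))" by simp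
  then show ?thesis using det_transpose[OF assms] by simp
qed

lemma unitary_det:
  assumes "unitary_mat d Q"
  shows "cmod (det Q) = 1"
proof -
  note Q = unitary_carrier[OF assms]
  have "cnj (det Q) * det Q = det (mat_adjoint Q * Q)"
    using det_mult[OF mat_adjoint_carrier[OF Q] Q] det_mat_adjoint[OF Q] by simp
  then have "cnj (det Q) * det Q = 1" using assms unfolding unitary_mat_def by simp
  from arg_cong[OF this, of cmod] show ?thesis
    using power_eq_imp_eq_base[of "cmod (det Q)" 2 1] by (simp add: norm_mult power2_eq_square)
qed

lemma line_smult_image:
  assumes "is_line d S" "c \<noteq> 0"
  shows "(\<lambda>v. c \<cdot>\<^sub>v v) ` S = S"
proof -
  obtain x where x: "x \<in> carrier_vec d" "S = {a \<cdot>\<^sub>v x | a. True}" using assms(1) unfolding is_line_def by auto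
  show ?thesis
  proof (intro equalityI subsetI)
    fix y assume "y \<in> (\<lambda>v. c \<cdot>\<^sub>v v) ` S"
    then obtain a where "y = (c * a) \<cdot>\<^sub>v x" using x by (auto simp: smult_smult_assoc)
    then show "y \<in> S" using x by blast
  next
    fix y assume "y \<in> S"
    then obtain a where "y = a \<cdot>\<^sub>v x" using x by auto
    then have "y = c \<cdot>\<^sub>v ((a / c) \<cdot>\<^sub>v x)" using assms(2) by (simp add: smult_smult_assoc)
    then show "y \<in> (\<lambda>v. c \<cdot>\<^sub>v v) ` S" using x by blast
  qed
qed

lemma smult_mat_mult_vec:
  fixes Q :: "complex mat"
  assumes "Q \<in> carrier_mat d d" "v \<in> carrier_vec d"
  shows "(c \<cdot>\<^sub>m Q) *\<^sub>v v = c \<cdot>\<^sub>v (Q *\<^sub>v v)"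
  using assms by (intro eq_vecI) (auto simp: scalar_prod_def sum_distrib_left mult.assoc)

lemma one_smult_mat: "(1 :: complex) \<cdot>\<^sub>m A = A"
  by (intro eq_matI) auto

lemma unitary_smult:
  assumes "unitary_mat d Q" "cmod c = 1"
  shows "unitary_mat d (c \<cdot>\<^sub>m Q)"
proof -
  note Q = unitary_carrier[OF assms(1)]
  have "cnj c * c = 1" using complex_norm_square[of c] assms(2) by (simp add: mult.commute)
  moreover have "mat_adjoint (c \<cdot>\<^sub>m Q) = cnj c \<cdot>\<^sub>m mat_adjoint Q"
    using Q mat_adjoint_carrier[OF Q] mat_adjoint_carrier[of "c \<cdot>\<^sub>m Q" d d]
    by (intro eq_matI) (auto simp: index_mat_adjoint)
  moreover have "(cnj c \<cdot>\<^sub>m mat_adjoint Q) * (c \<cdot>\<^sub>m Q) = (cnj c * c) \<cdot>\<^sub>m (mat_adjoint Q * Q)"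
    using Q mat_adjoint_carrier[OF Q]
    by (simp add: mult_smult_distrib[of _ d d _ d] mult_smult_assoc_mat[of _ d d _ d])
      (intro eq_matI, auto)
  ultimately show ?thesis using assms(1) Q unfolding unitary_mat_def by (simp add: one_smult_mat)
qed

lemma permutes_lines_smult:
  assumes lines: "\<And>i. i \<in> X \<Longrightarrow> is_line d (L i)" and Q: "permutes_lines d X L Q \<sigma>" and c: "cmod c = 1"
  shows "permutes_lines d X L (c \<cdot>\<^sub>m Q) \<sigma>"
proof -
  have U: "unitary_mat d Q" "\<sigma> \<in> Bij X" "\<And>i. i \<in> X \<Longrightarrow> (\<lambda>v. Q *\<^sub>v v) ` L i = L (\<sigma> i)"
    using Q unfolding permutes_lines_def by auto
  have "(\<lambda>v. (c \<cdot>\<^sub>m Q) *\<^sub>v v) ` L i = L (\<sigma> i)" if i: "i \<in> X" for i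
  proof -
    have "\<sigma> i \<in> X" using U(2) i Bij_imp_funcset by blast
    have "(\<lambda>v. (c \<cdot>\<^sub>m Q) *\<^sub>v v) ` L i = (\<lambda>v. c \<cdot>\<^sub>v v) ` (\<lambda>v. Q *\<^sub>v v) ` L i"
      unfolding image_image using is_line_carrier[OF lines[OF i]] smult_mat_mult_vec[OF unitary_carrier[OF U(1)]]
      by (intro image_cong) auto
    also have "\<dots> = L (\<sigma> i)" unfolding U(3)[OF i]
      by (rule line_smult_image[OF lines[OF \<open>\<sigma> i \<in> X\<close>]]) (use c in auto)
    finally show ?thesis .
  qed
  then show ?thesis unfolding permutes_lines_def using U(2) unitary_smult[OF U(1) c] by blast
qed

section \<open>Unitary symmetries of spanning doubly transitive lines\<close>

locale spanning_lines =
  fixes n d :: nat and L :: "nat \<Rightarrow> complex vec set"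
  assumes n3: "3 \<le> n" and dn: "d < n" and L_inj: "inj_on L {..<n}"
    and doubly_transitive: "doubly_transitive_lines d {..<n} L"
    and span: "lines_span_space d {..<n} L"
begin

lemma line: "i < n \<Longrightarrow> is_line d (L i)"
  using doubly_transitive unfolding doubly_transitive_lines_def by simp

lemma line_nonzero:
  assumes "i < n"
  obtains x where "x \<in> L i" "x \<noteq> 0\<^sub>v d" "x \<in> carrier_vec d"
proof -
  obtain x where x: "x \<in> carrier_vec d" "x \<noteq> 0\<^sub>v d" "L i = {c \<cdot>\<^sub>v x | c. True}"
    using line[OF assms] unfolding is_line_def by auto
  then have "x = 1 \<cdot>\<^sub>v x" by simp
  then have "x \<in> L i" using x(3) by blast
  then show ?thesis using that x by blast
qed

lemma line_carrier: "i < n \<Longrightarrow> x \<in> L i \<Longrightarrow> x \<in> carrier_vec d"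
  using is_line_carrier[OF line] by blast

lemma n_pos: "0 < n" using n3 by simp

text \<open>Without nonzero vectors there are no lines. Positivity is needed to extract
  \<open>d\<close>th roots when determinants are normalized.\<close>

lemma d_pos: "0 < d"
proof (rule ccontr)
  assume "\<not> 0 < d"
  then have d: "d = 0" by simp
  obtain x where x: "x \<in> L 0" "x \<noteq> 0\<^sub>v d" "x \<in> carrier_vec d" using line_nonzero[OF n_pos] .
  have "x = 0\<^sub>v d" using x(3) unfolding d by (intro eq_vecI) auto
  then show False using x(2) by simp
qed

abbreviation "acts \<equiv> permutes_lines d {..<n} L"

lemma acts_one: "acts (1\<^sub>m d) (\<lambda>x\<in>{..<n}. x)"
  by (rule permutes_lines_one) (use line in auto)

lemma acts_mult: "acts Q s \<Longrightarrow> acts R t \<Longrightarrow> acts (Q * R) (compose {..<n} s t)"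
  by (rule permutes_lines_mult) (use line in auto)

lemma acts_inverse: "acts Q s \<Longrightarrow> acts (mat_adjoint Q) (\<lambda>x\<in>{..<n}. inv_into {..<n} s x)"
  by (rule permutes_lines_inverse) (use line in auto)

lemma acts_smult: "acts Q s \<Longrightarrow> cmod c = 1 \<Longrightarrow> acts (c \<cdot>\<^sub>m Q) s"
  by (rule permutes_lines_smult) (use line in auto)

lemma acts_unitary: "acts Q s \<Longrightarrow> unitary_mat d Q"
  unfolding permutes_lines_def by simp

lemma acts_image: "acts Q s \<Longrightarrow> i < n \<Longrightarrow> (\<lambda>v. Q *\<^sub>v v) ` L i = L (s i)"
  unfolding permutes_lines_def by simp

lemma acts_less: "acts Q s \<Longrightarrow> i < n \<Longrightarrow> s i < n"
  using Bij_imp_funcset[of s "{..<n}"] unfolding permutes_lines_def by auto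

lemma acts_mem: "acts Q s \<Longrightarrow> i < n \<Longrightarrow> x \<in> L i \<Longrightarrow> Q *\<^sub>v x \<in> L (s i)"
  using acts_image by blast

lemma acts_cinner: "acts Q s \<Longrightarrow> x \<in> carrier_vec d \<Longrightarrow> y \<in> carrier_vec d \<Longrightarrow> (Q *\<^sub>v x) \<bullet>c (Q *\<^sub>v y) = x \<bullet>c y"
  using unitary_cinner[OF acts_unitary] .

lemma acts_nonzero:
  assumes "acts Q s" "x \<in> carrier_vec d" "x \<noteq> 0\<^sub>v d"
  shows "Q *\<^sub>v x \<noteq> 0\<^sub>v d"
proof
  assume "Q *\<^sub>v x = 0\<^sub>v d"
  then have "(Q *\<^sub>v x) \<bullet>c (Q *\<^sub>v x) = 0" by simp
  then have "x \<bullet>c x = 0" using acts_cinner[OF assms(1,2,2)] by simp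
  then show False using cinner_self(2)[OF assms(2,3)] by simp
qed

lemma transitive2:
  assumes "i < n" "j < n" "i' < n" "j' < n" "i \<noteq> j" "i' \<noteq> j'"
  obtains Q s where "acts Q s" "s i = i'" "s j = j'"
proof -
  have "doubly_transitive_action (BijGroup {..<n}\<lparr>carrier := line_automorphisms d {..<n} L\<rparr>) {..<n} (\<lambda>\<sigma>. \<sigma>)"
    using doubly_transitive unfolding doubly_transitive_lines_def by simp
  from doubly_transitive_actionD[OF this, of i j i' j'] assms obtain s
    where s: "s \<in> line_automorphisms d {..<n} L" "s i = i'" "s j = j'" by auto
  then show ?thesis using that line_automorphisms_iff by blast
qed

lemma line_multiple:
  "i < n \<Longrightarrow> x \<in> L i \<Longrightarrow> x \<noteq> 0\<^sub>v d \<Longrightarrow> y \<in> L i \<Longrightarrow> \<exists>c. y = c \<cdot>\<^sub>v x"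
  using is_line_eq[OF line] by blast

text \<open>Nonzero vectors on pairwise orthogonal lines would be independent, and there are more
  lines than dimensions.\<close>

lemma exists_not_orthogonal:
  "\<exists>i<n. \<exists>j<n. i \<noteq> j \<and> (\<exists>x\<in>L i. \<exists>y\<in>L j. x \<bullet>c y \<noteq> 0)"
proof (rule ccontr)
  assume neg: "\<not> ?thesis"
  define v where "v i = (SOME x. x \<in> L i \<and> x \<noteq> 0\<^sub>v d)" for i
  have v: "v i \<in> L i" "v i \<noteq> 0\<^sub>v d" if "i < n" for i
  proof -
    have "\<exists>x. x \<in> L i \<and> x \<noteq> 0\<^sub>v d" using line_nonzero[OF that] by blast
    then have "v i \<in> L i \<and> v i \<noteq> 0\<^sub>v d" unfolding v_def by (rule someI_ex)
    then show "v i \<in> L i" "v i \<noteq> 0\<^sub>v d" by auto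
  qed
  have vc: "v i \<in> carrier_vec d" if "i < n" for i using v[OF that] line_carrier[OF that] by blast
  obtain a where a: "\<exists>i<n. a i \<noteq> 0" "\<And>k. k < d \<Longrightarrow> (\<Sum>i<n. a i * v i $ k) = 0"
    using linear_dependence[OF dn, of v] vc by blast
  obtain j where j: "j < n" "a j \<noteq> 0" using a(1) by blast
  have "0 = (\<Sum>k<d. (\<Sum>i<n. a i * v i $ k) * cnj (v j $ k))" using a(2) by simp
  also have "\<dots> = (\<Sum>k<d. \<Sum>i<n. a i * (v i $ k * cnj (v j $ k)))" by (simp add: sum_distrib_right mult.assoc)
  also have "\<dots> = (\<Sum>i<n. \<Sum>k<d. a i * (v i $ k * cnj (v j $ k)))" by (rule sum.swap)
  also have "\<dots> = (\<Sum>i<n. a i * (v i \<bullet>c v j))"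
    using cscalar_prod_sum[OF vc[OF j(1)]] by (simp add: sum_distrib_left)
  also have "\<dots> = (\<Sum>i<n. if i = j then a j * (v j \<bullet>c v j) else 0)"
  proof (intro sum.cong refl)
    fix i assume "i \<in> {..<n}"
    then have "i \<noteq> j \<Longrightarrow> v i \<bullet>c v j = 0" using neg v j(1) by blast
    then show "a i * (v i \<bullet>c v j) = (if i = j then a j * (v j \<bullet>c v j) else 0)" by auto
  qed
  also have "\<dots> = a j * (v j \<bullet>c v j)" using j(1) by simp
  finally have "v j \<bullet>c v j = 0" using j(2) by simp
  then show False using cinner_self(2)[OF vc[OF j(1)] v(2)[OF j(1)]] by simp
qed

text \<open>Double transitivity and unitarity transfer the claim from the one pair of distinct lines
  for which it is known.\<close>

lemma not_orthogonal:
  assumes "i < n" "j < n" "x \<in> L i" "y \<in> L j" "x \<noteq> 0\<^sub>v d" "y \<noteq> 0\<^sub>v d"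
  shows "x \<bullet>c y \<noteq> 0"
proof (cases "i = j")
  case True
  have xc: "x \<in> carrier_vec d" using line_carrier assms by blast
  obtain c where c: "y = c \<cdot>\<^sub>v x" using line_multiple[OF assms(1,3,5)] assms(4) True by blast
  then have "c \<noteq> 0" using assms(6) xc by auto
  moreover have "x \<bullet>c x \<noteq> 0" using cinner_self(2)[OF xc assms(5)] by auto
  ultimately show ?thesis unfolding c using cinner_smult_right[OF xc xc] by simp
next
  case False
  obtain i' j' x' y' where ij: "i' < n" "j' < n" "i' \<noteq> j'" "x' \<in> L i'" "y' \<in> L j'" "x' \<bullet>c y' \<noteq> 0"
    using exists_not_orthogonal by blast
  obtain Q s where Q: "acts Q s" "s i = i'" "s j = j'" using transitive2[OF assms(1,2) ij(1,2) False ij(3)] .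
  have c: "x \<in> carrier_vec d" "y \<in> carrier_vec d" "x' \<in> carrier_vec d" "y' \<in> carrier_vec d"
    using line_carrier assms ij by blast+
  obtain a where a: "x' = a \<cdot>\<^sub>v (Q *\<^sub>v x)"
    using line_multiple[OF ij(1) _ acts_nonzero[OF Q(1) c(1) assms(5)] ij(4)] acts_mem[OF Q(1) assms(1,3)] Q(2) by auto
  obtain b where b: "y' = b \<cdot>\<^sub>v (Q *\<^sub>v y)"
    using line_multiple[OF ij(2) _ acts_nonzero[OF Q(1) c(2) assms(6)] ij(5)] acts_mem[OF Q(1) assms(2,4)] Q(3) by auto
  have Qc: "Q *\<^sub>v x \<in> carrier_vec d" "Q *\<^sub>v y \<in> carrier_vec d"
    using mult_mat_vec_carrier[OF unitary_carrier[OF acts_unitary[OF Q(1)]]] c by auto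
  have "x' \<bullet>c y' = a * (cnj b * (x \<bullet>c y))"
    unfolding a b using Qc acts_cinner[OF Q(1) c(1,2)]
    by (simp add: cinner_smult_left[of _ d] cinner_smult_right[of _ d])
  then show ?thesis using ij(6) by auto
qed

text \<open>Each line lies in an eigenspace of \<open>Q\<close>. Eigenvectors of a unitary matrix
  that are not orthogonal share their eigenvalue, so a single eigenspace contains all lines and
  hence, by spanning, everything.\<close>

lemma fixing_lines_scalar:
  assumes Q: "unitary_mat d Q" and fix_lines: "\<And>i. i < n \<Longrightarrow> (\<lambda>v. Q *\<^sub>v v) ` L i = L i"
  obtains c where "Q = c \<cdot>\<^sub>m 1\<^sub>m d"
proof -
  note Qm = unitary_carrier[OF Q]
  have eig: "\<exists>c. \<forall>x\<in>L i. Q *\<^sub>v x = c \<cdot>\<^sub>v x" if i: "i < n" for i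
  proof -
    obtain x where x: "x \<in> L i" "x \<noteq> 0\<^sub>v d" "x \<in> carrier_vec d" using line_nonzero[OF i] .
    obtain c where c: "Q *\<^sub>v x = c \<cdot>\<^sub>v x" using line_multiple[OF i x(1,2)] fix_lines[OF i] x(1) by blast
    have "Q *\<^sub>v y = c \<cdot>\<^sub>v y" if "y \<in> L i" for y
    proof -
      obtain a where a: "y = a \<cdot>\<^sub>v x" using line_multiple[OF i x(1,2) \<open>y \<in> L i\<close>] by blast
      show ?thesis unfolding a mult_mat_vec[OF Qm x(3)] c by (simp add: smult_smult_assoc mult.commute)
    qed
    then show ?thesis by blast
  qed
  define e where "e i = (SOME c. \<forall>x\<in>L i. Q *\<^sub>v x = c \<cdot>\<^sub>v x)" for i
  have e: "Q *\<^sub>v x = e i \<cdot>\<^sub>v x" if "i < n" "x \<in> L i" for i x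
    using someI_ex[OF eig[OF that(1)]] that(2) unfolding e_def by blast
  have ee: "e i * cnj (e j) = 1" if i: "i < n" and j: "j < n" for i j
  proof -
    obtain x where x: "x \<in> L i" "x \<noteq> 0\<^sub>v d" "x \<in> carrier_vec d" using line_nonzero[OF i] .
    obtain y where y: "y \<in> L j" "y \<noteq> 0\<^sub>v d" "y \<in> carrier_vec d" using line_nonzero[OF j] .
    have "x \<bullet>c y = (e i \<cdot>\<^sub>v x) \<bullet>c (e j \<cdot>\<^sub>v y)"
      using unitary_cinner[OF Q x(3) y(3)] e[OF i x(1)] e[OF j y(1)] by simp
    also have "\<dots> = e i * cnj (e j) * (x \<bullet>c y)"
      using x(3) y(3) by (simp add: cinner_smult_left[of _ d] cinner_smult_right[of _ d])
    finally show ?thesis using not_orthogonal[OF i j x(1) y(1) x(2) y(2)] by simp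
  qed
  have e0: "e i = e 0" if "i < n" for i
  proof -
    have "(e i - e 0) * cnj (e 0) = 0" using ee[OF that n_pos] ee[OF n_pos n_pos] by (simp add: left_diff_distrib)
    moreover have "cnj (e 0) \<noteq> 0" using ee[OF n_pos n_pos] by auto
    ultimately show ?thesis by simp
  qed
  interpret vec_space "TYPE(complex)" d .
  let ?N = "{x \<in> carrier_vec d. Q *\<^sub>v x = e 0 \<cdot>\<^sub>v x}"
  have sub: "submodule class_ring ?N V"
  proof (rule submodule.intro)
    show "Module.module class_ring V" by unfold_locales
    show "?N \<subseteq> carrier V" by auto
    show "v \<oplus>\<^bsub>V\<^esub> w \<in> ?N" if "v \<in> ?N" "w \<in> ?N" for v w
      using that Qm by (auto simp: mult_add_distrib_mat_vec[OF Qm] smult_add_distrib_vec[of _ d])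
    have "Q *\<^sub>v 0\<^sub>v d = e 0 \<cdot>\<^sub>v 0\<^sub>v d" using Qm by (intro eq_vecI) (auto simp: scalar_prod_def)
    then show "\<zero>\<^bsub>V\<^esub> \<in> ?N" by auto
    show "c \<odot>\<^bsub>V\<^esub> v \<in> ?N" if "c \<in> carrier class_ring" "v \<in> ?N" for c v
      using that mult_mat_vec[OF Qm, of v c] by (auto simp: smult_smult_assoc mult.commute)
  qed
  have "(\<Union>i<n. L i) \<subseteq> ?N"
  proof
    fix x assume "x \<in> (\<Union>i<n. L i)"
    then obtain i where i: "i < n" "x \<in> L i" by auto
    then show "x \<in> ?N" using line_carrier[OF i] e[OF i] e0[OF i(1)] by simp
  qed
  then have "LinearCombinations.module.span class_ring V (\<Union>i<n. L i) \<subseteq> ?N"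
    using sub by (rule span_is_subset)
  then have all: "Q *\<^sub>v x = e 0 \<cdot>\<^sub>v x" if "x \<in> carrier_vec d" for x
    using span that unfolding lines_span_space_def by auto
  have "Q = e 0 \<cdot>\<^sub>m 1\<^sub>m d"
  proof (rule eq_matI)
    fix i j assume ij: "i < dim_row (e 0 \<cdot>\<^sub>m 1\<^sub>m d)" "j < dim_col (e 0 \<cdot>\<^sub>m 1\<^sub>m d)"
    have "Q $$ (i, j) = (Q *\<^sub>v unit_vec d j) $ i" using ij Qm by simp
    also have "\<dots> = (e 0 \<cdot>\<^sub>v unit_vec d j) $ i" using all[of "unit_vec d j"] by simp
    also have "\<dots> = (e 0 \<cdot>\<^sub>m 1\<^sub>m d) $$ (i, j)" using ij by simp
    finally show "Q $$ (i, j) = (e 0 \<cdot>\<^sub>m 1\<^sub>m d) $$ (i, j)" .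
  qed (use Qm in auto)
  then show ?thesis using that by blast
qed

text \<open>The group of all unitary symmetries is infinite, as it contains every unimodular scalar;
  fixing the determinant leaves only \<open>d\<close>th roots of unity among them.\<close>

definition "SU = {Q. (\<exists>s. acts Q s) \<and> det Q = 1}"

lemma SU_one: "1\<^sub>m d \<in> SU"
  unfolding SU_def using acts_one by auto

lemma SU_mult: "Q \<in> SU \<Longrightarrow> R \<in> SU \<Longrightarrow> Q * R \<in> SU"
  unfolding SU_def using acts_mult det_mult[OF unitary_carrier[OF acts_unitary] unitary_carrier[OF acts_unitary]]
  by fastforce

lemma SU_inverse: "Q \<in> SU \<Longrightarrow> mat_adjoint Q \<in> SU"
  unfolding SU_def using acts_inverse det_mat_adjoint[OF unitary_carrier[OF acts_unitary]] by fastforce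

text \<open>Rescaling by a \<open>d\<close>th root of the inverse determinant does not affect lines,
  so passing to \<open>SU\<close> loses no permutation.\<close>

lemma normalize_det:
  assumes "acts Q s"
  obtains R where "R \<in> SU" "acts R s"
proof -
  have "cmod (inverse (det Q)) = 1" using unitary_det[OF acts_unitary[OF assms]] by (simp add: norm_inverse)
  then obtain c where c: "cmod c = 1" "c ^ d = inverse (det Q)" using unimodular_root[OF d_pos] by blast
  have "det Q \<noteq> 0" using unitary_det[OF acts_unitary[OF assms]] by auto
  then have "det (c \<cdot>\<^sub>m Q) = 1"
    using c(2) unitary_carrier[OF acts_unitary[OF assms]] by simp
  then show ?thesis using that[of "c \<cdot>\<^sub>m Q"] acts_smult[OF assms c(1)] unfolding SU_def by blast
qed

text \<open>There are finitely many permutations, and two elements with the same permutation differ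
  by a matrix that fixes every line, that is, by a scalar \<open>c\<close> with
  \<open>c ^ d = 1\<close>.\<close>

lemma finite_SU: "finite SU"
proof -
  have fib: "finite {Q \<in> SU. acts Q s}" for s
  proof (cases "{Q \<in> SU. acts Q s} = {}")
    case False
    then obtain R where R: "R \<in> SU" "acts R s" by blast
    note Rm = unitary_carrier[OF acts_unitary[OF R(2)]]
    have "Q \<in> (\<lambda>c. c \<cdot>\<^sub>m R) ` {c. c ^ d = 1}" if Q: "Q \<in> SU" "acts Q s" for Q
    proof -
      note Qm = unitary_carrier[OF acts_unitary[OF Q(2)]]
      note T = acts_mult[OF Q(2) acts_inverse[OF R(2)]]
      have bij: "bij_betw s {..<n} {..<n}" using R(2) unfolding permutes_lines_def Bij_def by simp
      have "(\<lambda>v. (Q * mat_adjoint R) *\<^sub>v v) ` L i = L i" if i: "i < n" for i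
        using acts_image[OF T i] i bij_betw_imp_surj_on[OF bij] by (simp add: compose_def f_inv_into_f)
      then obtain c where c: "Q * mat_adjoint R = c \<cdot>\<^sub>m 1\<^sub>m d"
        using fixing_lines_scalar[OF acts_unitary[OF T]] by blast
      have "Q = Q * (mat_adjoint R * R)" using Qm acts_unitary[OF R(2)] unfolding unitary_mat_def by simp
      also have "\<dots> = (Q * mat_adjoint R) * R"
        using assoc_mult_mat[OF Qm mat_adjoint_carrier[OF Rm] Rm] by simp
      also have "\<dots> = c \<cdot>\<^sub>m R" unfolding c using Rm by (simp add: mult_smult_assoc_mat[of _ d d _ d])
      finally have Qc: "Q = c \<cdot>\<^sub>m R" .
      then have "c ^ d = 1" using Q(1) R(1) Rm unfolding SU_def by simp
      then show ?thesis using Qc by blast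
    qed
    then show ?thesis using finite_roots_unity[of d] d_pos
      by (intro finite_subset[OF _ finite_imageI[of "{c. c ^ d = 1}" "\<lambda>c. c \<cdot>\<^sub>m R"]]) auto
  next
    case True
    then show ?thesis by (metis finite.emptyI)
  qed
  have "SU \<subseteq> (\<Union>s\<in>Bij {..<n}. {Q \<in> SU. acts Q s})"
    unfolding SU_def permutes_lines_def by auto
  then show ?thesis using finite_Bij[of "{..<n}"] fib by (meson finite_UN finite_lessThan finite_subset)
qed

text \<open>The eigenvalues at \<open>u\<close> form a finite set of nonzero numbers closed under
  multiplication; its size serves as \<open>m\<close>.\<close>

lemma SU_eigenvalue_order:
  assumes u: "u \<in> carrier_vec d" "u \<noteq> 0\<^sub>v d"
  obtains m where "m > 0" "\<And>Q c. Q \<in> SU \<Longrightarrow> Q *\<^sub>v u = c \<cdot>\<^sub>v u \<Longrightarrow> c ^ m = 1"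
proof -
  define R where "R = {c. \<exists>Q\<in>SU. Q *\<^sub>v u = c \<cdot>\<^sub>v u}"
  have uu: "u \<bullet>c u \<noteq> 0" using cinner_self(2)[OF u] by auto
  have Qm: "Q \<in> carrier_mat d d" if "Q \<in> SU" for Q
    using that unitary_carrier[OF acts_unitary] unfolding SU_def by blast
  have "R \<subseteq> (\<lambda>Q. ((Q *\<^sub>v u) \<bullet>c u) / (u \<bullet>c u)) ` SU"
  proof
    fix c assume "c \<in> R"
    then obtain Q where Q: "Q \<in> SU" "Q *\<^sub>v u = c \<cdot>\<^sub>v u" unfolding R_def by blast
    then have "((Q *\<^sub>v u) \<bullet>c u) / (u \<bullet>c u) = c" using u uu by (simp add: cinner_smult_left[of _ d])
    then show "c \<in> (\<lambda>Q. ((Q *\<^sub>v u) \<bullet>c u) / (u \<bullet>c u)) ` SU" using Q(1) by blast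
  qed
  then have fin: "finite R" using finite_SU finite_subset by blast
  have one: "1 \<in> R" unfolding R_def using SU_one u(1) by (auto intro!: bexI[of _ "1\<^sub>m d"])
  have zero: "0 \<notin> R"
  proof
    assume "0 \<in> R"
    then obtain Q where Q: "Q \<in> SU" "Q *\<^sub>v u = 0 \<cdot>\<^sub>v u" unfolding R_def by blast
    then obtain s where "acts Q s" unfolding SU_def by blast
    then have "Q *\<^sub>v u \<noteq> 0\<^sub>v d" using acts_nonzero[OF _ u] by blast
    moreover have "0 \<cdot>\<^sub>v u = 0\<^sub>v d" using u(1) by (intro eq_vecI) auto
    ultimately show False using Q(2) by simp
  qed
  have mult: "c * e \<in> R" if ce: "c \<in> R" "e \<in> R" for c e
  proof -
    obtain Q T where Q: "Q \<in> SU" "Q *\<^sub>v u = c \<cdot>\<^sub>v u" and T: "T \<in> SU" "T *\<^sub>v u = e \<cdot>\<^sub>v u"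
      using ce unfolding R_def by blast
    have "(Q * T) *\<^sub>v u = Q *\<^sub>v (e \<cdot>\<^sub>v u)" using assoc_mult_mat_vec[OF Qm[OF Q(1)] Qm[OF T(1)] u(1)] T(2) by simp
    also have "\<dots> = (c * e) \<cdot>\<^sub>v u"
      unfolding mult_mat_vec[OF Qm[OF Q(1)] u(1)] Q(2) by (simp add: smult_smult_assoc mult.commute)
    finally show ?thesis unfolding R_def using SU_mult[OF Q(1) T(1)] by blast
  qed
  have "c ^ card R = 1" if "Q \<in> SU" "Q *\<^sub>v u = c \<cdot>\<^sub>v u" for Q c
    using power_card_of_finite_mult_closed[OF fin one zero mult, of c] that unfolding R_def by blast
  moreover have "card R > 0" using fin one by (auto simp: card_gt_0_iff)
  ultimately show ?thesis using that by blast
qed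

text \<open>The scalars \<open>z\<close> make \<open>G\<close> large enough for the stabilizer of a line to be the product of
  the fixer of a representative and the scalars in \<open>G\<close>, and for a key with real inner product.\<close>

theorem exists_line_group: "\<exists>(G :: nat monoid) \<rho> \<sigma> b u. line_group G n d L \<rho> \<sigma> b u"
proof -
  obtain u where u: "u \<in> L 0" "u \<noteq> 0\<^sub>v d" "u \<in> carrier_vec d" using line_nonzero[OF n_pos] .
  obtain m where m: "m > 0" "\<And>Q c. Q \<in> SU \<Longrightarrow> Q *\<^sub>v u = c \<cdot>\<^sub>v u \<Longrightarrow> c ^ m = 1"
    using SU_eigenvalue_order[OF u(3,2)] by blast
  \<comment> \<open>The exponent \<open>m\<close> covers the eigenvalues at \<open>u\<close>; the
    factor \<open>2\<close> admits their square roots, which the key will need.\<close>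
  define Z where "Z = {z :: complex. z ^ (2 * m) = 1}"
  have Z_unit: "cmod z = 1" if "z \<in> Z" for z
    using that power_eq_imp_eq_base[of "cmod z" "2 * m" 1] m(1) unfolding Z_def by (simp add: norm_power[symmetric])
  have Z_mult: "z * z' \<in> Z" if "z \<in> Z" "z' \<in> Z" for z z'
    using that unfolding Z_def by (simp add: power_mult_distrib)
  have Z_cnj: "cnj z \<in> Z" if "z \<in> Z" for z
    using that unfolding Z_def by (metis (mono_tags) complex_cnj_one complex_cnj_power mem_Collect_eq)
  have Z_one: "1 \<in> Z" unfolding Z_def by simp
  have Z_cancel: "cnj z * z = 1" if "z \<in> Z" for z
    using complex_norm_square[of z] Z_unit[OF that] by (simp add: mult.commute)
  define \<Gamma> where "\<Gamma> = (\<lambda>(z, Q). z \<cdot>\<^sub>m Q) ` (Z \<times> SU)"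
  have SUm: "Q \<in> carrier_mat d d" if "Q \<in> SU" for Q
    using that unitary_carrier[OF acts_unitary] unfolding SU_def by blast
  have \<Gamma>_acts: "\<exists>s. acts P s" if P: "P \<in> \<Gamma>" for P
  proof -
    obtain z Q where zQ: "P = z \<cdot>\<^sub>m Q" "z \<in> Z" "Q \<in> SU" using P unfolding \<Gamma>_def by auto
    then show ?thesis using acts_smult Z_unit unfolding SU_def by blast
  qed
  have \<Gamma>m: "P \<in> carrier_mat d d" if "P \<in> \<Gamma>" for P
    using \<Gamma>_acts[OF that] unitary_carrier[OF acts_unitary] by blast
  have \<Gamma>_mult: "P * P' \<in> \<Gamma>" if P: "P \<in> \<Gamma>" "P' \<in> \<Gamma>" for P P'
  proof -
    obtain z Q where zQ: "P = z \<cdot>\<^sub>m Q" "z \<in> Z" "Q \<in> SU" using P(1) unfolding \<Gamma>_def by auto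
    obtain z' Q' where zQ': "P' = z' \<cdot>\<^sub>m Q'" "z' \<in> Z" "Q' \<in> SU" using P(2) unfolding \<Gamma>_def by auto
    have "P * P' = (z * z') \<cdot>\<^sub>m (Q * Q')"
      unfolding zQ(1) zQ'(1) using SUm[OF zQ(3)] SUm[OF zQ'(3)]
      by (simp add: mult_smult_distrib[of _ d d _ d] mult_smult_assoc_mat[of _ d d _ d])
        (intro eq_matI, auto)
    then show ?thesis unfolding \<Gamma>_def using Z_mult[OF zQ(2) zQ'(2)] SU_mult[OF zQ(3) zQ'(3)] by auto
  qed
  have \<Gamma>_one: "1\<^sub>m d \<in> \<Gamma>"
  proof -
    have "1\<^sub>m d = (1 :: complex) \<cdot>\<^sub>m 1\<^sub>m d" by (simp add: one_smult_mat)
    then show ?thesis unfolding \<Gamma>_def using Z_one SU_one by force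
  qed
  have \<Gamma>_inv: "\<exists>P'\<in>\<Gamma>. P' * P = 1\<^sub>m d" if P: "P \<in> \<Gamma>" for P
  proof -
    obtain z Q where zQ: "P = z \<cdot>\<^sub>m Q" "z \<in> Z" "Q \<in> SU" using P unfolding \<Gamma>_def by auto
    have U: "mat_adjoint Q * Q = 1\<^sub>m d"
      using zQ(3) acts_unitary unfolding SU_def unitary_mat_def by blast
    have "(cnj z \<cdot>\<^sub>m mat_adjoint Q) * P = (cnj z * z) \<cdot>\<^sub>m (mat_adjoint Q * Q)"
      unfolding zQ(1) using SUm[OF zQ(3)] mat_adjoint_carrier[OF SUm[OF zQ(3)]]
      by (simp add: mult_smult_distrib[of _ d d _ d] mult_smult_assoc_mat[of _ d d _ d])
        (intro eq_matI, auto)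
    also have "\<dots> = 1\<^sub>m d" unfolding Z_cancel[OF zQ(2)] U by (rule one_smult_mat)
    finally have "(cnj z \<cdot>\<^sub>m mat_adjoint Q) * P = 1\<^sub>m d" .
    moreover have "cnj z \<cdot>\<^sub>m mat_adjoint Q \<in> \<Gamma>"
      unfolding \<Gamma>_def using Z_cnj[OF zQ(2)] SU_inverse[OF zQ(3)] by auto
    ultimately show ?thesis by blast
  qed
  have "finite Z" unfolding Z_def using finite_roots_unity[of "2 * m"] m(1) by simp
  then have "finite \<Gamma>" unfolding \<Gamma>_def using finite_SU by simp
  \<comment> \<open>The matrices are numbered so that the group has natural numbers as elements;
    \<open>code\<close> below inverts the numbering.\<close>
  then obtain \<rho> where \<rho>: "bij_betw \<rho> {0..<card \<Gamma>} \<Gamma>" using ex_bij_betw_nat_finite by blast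
  define code where "code = inv_into {0..<card \<Gamma>} \<rho>"
  have \<rho>_code: "\<rho> (code P) = P" "code P \<in> {0..<card \<Gamma>}" if "P \<in> \<Gamma>" for P
    unfolding code_def using bij_betw_inv_into_right[OF \<rho> that]
      bij_betwE[OF bij_betw_inv_into[OF \<rho>]] that by blast+
  have code_\<rho>: "code (\<rho> i) = i" if "i \<in> {0..<card \<Gamma>}" for i
    using that \<rho> unfolding code_def by (simp add: bij_betw_inv_into_left)
  have \<rho>_mem: "\<rho> i \<in> \<Gamma>" if "i \<in> {0..<card \<Gamma>}" for i using that \<rho> bij_betwE by blast
  define G :: "nat monoid"
    where "G = \<lparr>carrier = {0..<card \<Gamma>}, monoid.mult = \<lambda>i j. code (\<rho> i * \<rho> j), monoid.one = code (1\<^sub>m d)\<rparr>"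
  have G: "carrier G = {0..<card \<Gamma>}" "i \<otimes>\<^bsub>G\<^esub> j = code (\<rho> i * \<rho> j)" "\<one>\<^bsub>G\<^esub> = code (1\<^sub>m d)" for i j
    unfolding G_def by simp_all
  have \<rho>_mult: "\<rho> (i \<otimes>\<^bsub>G\<^esub> j) = \<rho> i * \<rho> j" if "i \<in> carrier G" "j \<in> carrier G" for i j
    unfolding G(2) using that \<rho>_code(1)[OF \<Gamma>_mult[OF \<rho>_mem \<rho>_mem]] G(1) by simp
  have group: "group G"
  proof (rule groupI)
    show mult: "i \<otimes>\<^bsub>G\<^esub> j \<in> carrier G" if "i \<in> carrier G" "j \<in> carrier G" for i j
      unfolding G(2) using that \<rho>_code(2)[OF \<Gamma>_mult[OF \<rho>_mem \<rho>_mem]] G(1) by simp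
    show one: "\<one>\<^bsub>G\<^esub> \<in> carrier G" unfolding G using \<rho>_code(2)[OF \<Gamma>_one] .
    show "i \<otimes>\<^bsub>G\<^esub> j \<otimes>\<^bsub>G\<^esub> k = i \<otimes>\<^bsub>G\<^esub> (j \<otimes>\<^bsub>G\<^esub> k)"
      if "i \<in> carrier G" "j \<in> carrier G" "k \<in> carrier G" for i j k
    proof -
      have "\<rho> i * \<rho> j * \<rho> k = \<rho> i * (\<rho> j * \<rho> k)"
        using that G(1) \<Gamma>m[OF \<rho>_mem] assoc_mult_mat[of "\<rho> i" d d "\<rho> j" d "\<rho> k" d] by simp
      then show ?thesis
        unfolding G(2)[of "i \<otimes>\<^bsub>G\<^esub> j" k] G(2)[of i "j \<otimes>\<^bsub>G\<^esub> k"] using \<rho>_mult that by simp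
    qed
    show "\<one>\<^bsub>G\<^esub> \<otimes>\<^bsub>G\<^esub> i = i" if "i \<in> carrier G" for i
      unfolding G(2,3) \<rho>_code(1)[OF \<Gamma>_one]
      using that G(1) left_mult_one_mat[OF \<Gamma>m[OF \<rho>_mem]] code_\<rho> by simp
    show "\<exists>j\<in>carrier G. j \<otimes>\<^bsub>G\<^esub> i = \<one>\<^bsub>G\<^esub>" if i: "i \<in> carrier G" for i
    proof -
      obtain P where P: "P \<in> \<Gamma>" "P * \<rho> i = 1\<^sub>m d" using \<Gamma>_inv[OF \<rho>_mem] i G(1) by blast
      have "code P \<otimes>\<^bsub>G\<^esub> i = \<one>\<^bsub>G\<^esub>" unfolding G(2,3) \<rho>_code(1)[OF P(1)] P(2) ..
      then show ?thesis using \<rho>_code(2)[OF P(1)] G(1) by blast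
    qed
  qed
  define \<sigma> where "\<sigma> g = (SOME s. acts (\<rho> g) s)" for g
  have \<sigma>: "acts (\<rho> g) (\<sigma> g)" if "g \<in> carrier G" for g
    unfolding \<sigma>_def using someI_ex[OF \<Gamma>_acts[OF \<rho>_mem]] that G(1) by simp
  \<comment> \<open>Distinct lines make the permutation unique, so the choice by \<open>SOME\<close>
    agrees with any \<open>s\<close> at hand.\<close>
  have \<sigma>_eq: "\<sigma> g i = s i" if "g \<in> carrier G" "acts (\<rho> g) s" "i < n" for g s i
  proof -
    have "L (\<sigma> g i) = L (s i)" using acts_image[OF \<sigma>[OF that(1)] that(3)] acts_image[OF that(2,3)] by simp
    then show ?thesis
      using L_inj acts_less[OF \<sigma>[OF that(1)] that(3)] acts_less[OF that(2,3)] by (simp add: inj_on_def)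
  qed
  have code_mem: "code P \<in> carrier G" if "P \<in> \<Gamma>" for P using \<rho>_code(2)[OF that] G(1) by simp
  have \<Gamma>_smult: "z \<cdot>\<^sub>m Q \<in> \<Gamma>" if "z \<in> Z" "Q \<in> SU" for z Q using that unfolding \<Gamma>_def by auto
  have SU_\<Gamma>: "Q \<in> \<Gamma>" if "Q \<in> SU" for Q
    using \<Gamma>_smult[OF Z_one that] by (simp add: one_smult_mat)
  \<comment> \<open>The key is sought among the multiples of an element that interchanges lines
    \<open>0\<close> and \<open>1\<close>: its square stabilizes line \<open>0\<close>, and the
    eigenvalue \<open>c\<close> of the square at \<open>u\<close> controls the phase of
    \<open>f\<close>.\<close>
  obtain Q s where Q: "Q \<in> SU" "acts Q s" "s 0 = 1" "s 1 = 0"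
  proof -
    obtain Q s where "acts Q s" "s 0 = 1" "s 1 = 0" using transitive2[of 0 1 1 0] n3 by auto
    then show ?thesis using normalize_det that by metis
  qed
  note Qm = SUm[OF Q(1)]
  define w where "w = Q *\<^sub>v u"
  have wL: "w \<in> L 1" unfolding w_def using acts_mem[OF Q(2) n_pos u(1)] Q(3) by simp
  have wc: "w \<in> carrier_vec d" unfolding w_def using mult_mat_vec_carrier[OF Qm u(3)] .
  have w0: "w \<noteq> 0\<^sub>v d" unfolding w_def using acts_nonzero[OF Q(2) u(3,2)] .
  define f where "f = w \<bullet>c u"
  have f0: "f \<noteq> 0" unfolding f_def using not_orthogonal[OF _ n_pos wL u(1) w0 u(2)] n3 by simp
  have "Q *\<^sub>v w \<in> L 0" using acts_mem[OF Q(2) _ wL] Q(4) n3 by simp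
  then obtain c where c: "Q *\<^sub>v w = c \<cdot>\<^sub>v u" using line_multiple[OF n_pos u(1,2)] by blast
  have "(Q * Q) *\<^sub>v u = c \<cdot>\<^sub>v u" using assoc_mult_mat_vec[OF Qm Qm u(3)] c unfolding w_def by simp
  then have cm: "c ^ m = 1" using m(2)[OF SU_mult[OF Q(1) Q(1)]] by simp
  have "f = (Q *\<^sub>v w) \<bullet>c (Q *\<^sub>v u)" unfolding f_def using acts_cinner[OF Q(2) wc u(3)] by simp
  also have "\<dots> = c * (u \<bullet>c w)" unfolding c w_def[symmetric] using cinner_smult_left[OF u(3) wc] .
  also have "u \<bullet>c w = cnj f" unfolding f_def using cinner_swap[OF wc u(3)] .
  finally have fc: "f = c * cnj f" .
  \<comment> \<open>The phase of \<open>f\<close>. Since \<open>f = c * cnj f\<close>, it squares to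
    \<open>c\<close>, so \<open>a ^ (2 * m) = 1\<close> and \<open>cnj a\<close> is one of the
    scalars in \<open>Z\<close>; multiplying \<open>Q\<close> by it replaces \<open>f\<close> by its
    modulus.\<close>
  define a where "a = f / of_real (cmod f)"
  have ac: "cnj a * f = of_real (cmod f)"
    using complex_norm_square[of f] f0 unfolding a_def by (simp add: power2_eq_square mult.commute field_simps)
  have "a * cnj a = 1" using ac f0 unfolding a_def by (simp add: field_simps)
  moreover have "a = c * cnj a"
    unfolding a_def using arg_cong[OF fc, of "\<lambda>x. x / of_real (cmod f)"] by simp
  ultimately have "a ^ 2 = c" by (metis mult.commute mult.left_commute mult_1_right power2_eq_square)
  then have "a ^ (2 * m) = 1" using cm by (simp add: power_mult)
  then have aZ: "cnj a \<in> Z" using Z_cnj unfolding Z_def by blast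
  define b where "b = code (cnj a \<cdot>\<^sub>m Q)"
  have bG: "b \<in> carrier G" and \<rho>b: "\<rho> b = cnj a \<cdot>\<^sub>m Q"
    unfolding b_def using code_mem \<rho>_code(1) \<Gamma>_smult[OF aZ Q(1)] by auto
  have "line_group G n d L \<rho> \<sigma> b u"
  proof (rule line_group.intro[OF group], unfold_locales)
    show "finite (carrier G)" unfolding G(1) by simp
    show "3 \<le> n" "d < n" "inj_on L {..<n}" using n3 dn L_inj by auto
    show "is_line d (L i)" if "i < n" for i using line[OF that] .
    show "unitary_mat d (\<rho> g)" if "g \<in> carrier G" for g using acts_unitary[OF \<sigma>[OF that]] .
    show "\<rho> (g \<otimes>\<^bsub>G\<^esub> h) = \<rho> g * \<rho> h" if "g \<in> carrier G" "h \<in> carrier G" for g h using \<rho>_mult[OF that] .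
    show "\<sigma> g i < n" if "g \<in> carrier G" "i < n" for g i using acts_less[OF \<sigma>[OF that(1)] that(2)] .
    show "(\<lambda>v. \<rho> g *\<^sub>v v) ` L i = L (\<sigma> g i)" if "g \<in> carrier G" "i < n" for g i
      using acts_image[OF \<sigma>[OF that(1)] that(2)] .
    show "\<exists>g\<in>carrier G. \<sigma> g i = i' \<and> \<sigma> g j = j'"
      if ij: "i < n" "j < n" "i' < n" "j' < n" "i \<noteq> j" "i' \<noteq> j'" for i j i' j'
    proof -
      obtain P s where P: "acts P s" "s i = i'" "s j = j'" using transitive2[OF ij] .
      obtain R where R: "R \<in> SU" "acts R s" using normalize_det[OF P(1)] .
      have "acts (\<rho> (code R)) s" using R(2) \<rho>_code(1)[OF SU_\<Gamma>[OF R(1)]] by simp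
      then show ?thesis using code_mem[OF SU_\<Gamma>[OF R(1)]] \<sigma>_eq ij(1,2) P(2,3) by blast
    qed
    show "u \<in> L 0" "u \<noteq> 0\<^sub>v d" using u by auto
    show "\<exists>z\<in>carrier G. \<rho> z = e \<cdot>\<^sub>m 1\<^sub>m d" if g: "g \<in> carrier G" "\<rho> g *\<^sub>v u = e \<cdot>\<^sub>v u" for g e
    proof -
      have "\<rho> g \<in> \<Gamma>" using \<rho>_mem g(1) G(1) by simp
      then obtain z R where zR: "\<rho> g = z \<cdot>\<^sub>m R" "z \<in> Z" "R \<in> SU" unfolding \<Gamma>_def by auto
      have "R *\<^sub>v u = cnj z \<cdot>\<^sub>v (z \<cdot>\<^sub>v (R *\<^sub>v u))" using Z_cancel[OF zR(2)] by (simp add: smult_smult_assoc)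
      also have "z \<cdot>\<^sub>v (R *\<^sub>v u) = e \<cdot>\<^sub>v u" using g(2) smult_mat_mult_vec[OF SUm[OF zR(3)] u(3)] unfolding zR(1) by simp
      finally have "R *\<^sub>v u = (cnj z * e) \<cdot>\<^sub>v u" by (simp add: smult_smult_assoc)
      then have "(cnj z * e) ^ m = 1" using m(2)[OF zR(3)] by simp
      \<comment> \<open>The \<open>m\<close>th roots of unity belong to \<open>Z\<close>, so the
        eigenvalue of the factor in \<open>SU\<close> does; the scalar \<open>z\<close> is then
        multiplied back.\<close>
      then have "((cnj z * e) ^ m) ^ 2 = 1" by simp
      then have "cnj z * e \<in> Z" unfolding Z_def by (simp add: power_mult[symmetric] mult.commute)
      then have "z * (cnj z * e) \<in> Z" using Z_mult zR(2) by blast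
      moreover have "z * (cnj z * e) = (cnj z * z) * e" by simp
      ultimately have "e \<in> Z" using Z_cancel[OF zR(2)] by simp
      then have "e \<cdot>\<^sub>m 1\<^sub>m d \<in> \<Gamma>" using \<Gamma>_smult SU_one by blast
      then show ?thesis using code_mem \<rho>_code(1) by blast
    qed
    show "x \<bullet>c y \<noteq> 0" if "i < n" "j < n" "x \<in> L i" "y \<in> L j" "x \<noteq> 0\<^sub>v d" "y \<noteq> 0\<^sub>v d" for i j x y
      using not_orthogonal[OF that] .
    show "b \<in> carrier G" using bG .
    have "acts (\<rho> b) s" unfolding \<rho>b using acts_smult[OF Q(2) Z_unit[OF aZ]] .
    then show "\<sigma> b 0 \<noteq> 0" using \<sigma>_eq[OF bG _ n_pos] Q(3) by simp
    have "(\<rho> b *\<^sub>v u) \<bullet>c u = cnj a * f"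
      unfolding \<rho>b smult_mat_mult_vec[OF Qm u(3)] w_def[symmetric] f_def using cinner_smult_left[OF wc u(3)] .
    then show "(\<rho> b *\<^sub>v u) \<bullet>c u \<in> \<real>" unfolding ac by simp
  qed
  then show ?thesis by blast
qed

end

theorem theorem1p3:
  shows
    "(\<forall>(n::nat) (d::nat) (L :: nat \<Rightarrow> complex vec set).
        3 \<le> n \<and> d < n \<and> inj_on L {..<n} \<and>
        doubly_transitive_lines d {..<n} L \<and> lines_span_space d {..<n} L \<longrightarrow>
        (\<exists>(r::nat) (G :: nat monoid) (H :: nat set) \<pi> v.
            higman_pair G H \<and>
            r = subgroup_index G (normalizer G H) H \<and>
            n = subgroup_index G (carrier G) (normalizer G H) \<and>
            equal_norm_representatives {..<n} L d r (lcosets\<^bsub>G\<^esub> H) \<pi> v \<and>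
            carries_scheme G H (gram_matrix (lcosets\<^bsub>G\<^esub> H) v) \<and>
            primitive_idempotent G H (gram_matrix (lcosets\<^bsub>G\<^esub> H) v)))
     \<and>
     (\<forall>(G :: ('g, 'm) monoid_scheme) (H :: 'g set).
        higman_pair G H \<longrightarrow>
        gelfand_pair G H \<and>
        (\<forall>E. primitive_idempotent G H E \<longrightarrow>
          (let K = normalizer G H;
               r = subgroup_index G K H;
               n = subgroup_index G (carrier G) K
           in
            (\<exists>d<n. \<exists>(L :: 'g set \<Rightarrow> complex vec set) v.
                doubly_transitive_lines d (lcosets\<^bsub>G\<^esub> K) L \<and>
                lines_span_space d (lcosets\<^bsub>G\<^esub> K) L \<and>
                equal_norm_representatives (lcosets\<^bsub>G\<^esub> K) L d r (lcosets\<^bsub>G\<^esub> H)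
                  (\<lambda>X. X <#>\<^bsub>G\<^esub> K) v \<and>
                E = gram_matrix (lcosets\<^bsub>G\<^esub> H) v \<and>
                coset_action G K ` carrier G \<subseteq> line_automorphisms d (lcosets\<^bsub>G\<^esub> K) L) \<and>
            (\<exists>\<epsilon>\<in>{1, -1}. \<forall>X\<in>lcosets\<^bsub>G\<^esub> H. \<forall>Y\<in>lcosets\<^bsub>G\<^esub> H.
                (if X <#>\<^bsub>G\<^esub> K = Y <#>\<^bsub>G\<^esub> K then sgn (E X Y) else \<epsilon> * sgn (E X Y)) ^ r = 1))))"
proof (intro conjI allI impI)
  fix n d :: nat and L :: "nat \<Rightarrow> complex vec set"
  assume "3 \<le> n \<and> d < n \<and> inj_on L {..<n} \<and>
    doubly_transitive_lines d {..<n} L \<and> lines_span_space d {..<n} L"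
  then have "spanning_lines n d L" unfolding spanning_lines_def by simp
  then obtain G :: "nat monoid" and \<rho> \<sigma> b u where "line_group G n d L \<rho> \<sigma> b u"
    using spanning_lines.exists_line_group by blast
  from line_group.higman_representatives[OF this]
  show "\<exists>r (G :: nat monoid) H \<pi> v. higman_pair G H \<and>
      r = subgroup_index G (normalizer G H) H \<and>
      n = subgroup_index G (carrier G) (normalizer G H) \<and>
      equal_norm_representatives {..<n} L d r (lcosets\<^bsub>G\<^esub> H) \<pi> v \<and>
      carries_scheme G H (gram_matrix (lcosets\<^bsub>G\<^esub> H) v) \<and>
      primitive_idempotent G H (gram_matrix (lcosets\<^bsub>G\<^esub> H) v)"
    by blast
next
  fix G :: "('g, 'm) monoid_scheme" and H :: "'g set"
  assume "higman_pair G H"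
  then obtain b where "key_pair G H b" using higman_pair_key by blast
  then interpret key_pair G H b .
  show "gelfand_pair G H" by (rule gelfand)
  fix E assume "primitive_idempotent G H E"
  from primitive_idempotent_lines[OF this, unfolded n_def r_def K_def]
  show "let K = normalizer G H; r = subgroup_index G K H; n = subgroup_index G (carrier G) K
    in (\<exists>d<n. \<exists>(L :: 'g set \<Rightarrow> complex vec set) v.
          doubly_transitive_lines d (lcosets\<^bsub>G\<^esub> K) L \<and>
          lines_span_space d (lcosets\<^bsub>G\<^esub> K) L \<and>
          equal_norm_representatives (lcosets\<^bsub>G\<^esub> K) L d r (lcosets\<^bsub>G\<^esub> H) (\<lambda>X. X <#>\<^bsub>G\<^esub> K) v \<and>
          E = gram_matrix (lcosets\<^bsub>G\<^esub> H) v \<and>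
          coset_action G K ` carrier G \<subseteq> line_automorphisms d (lcosets\<^bsub>G\<^esub> K) L) \<and>
      (\<exists>\<epsilon>\<in>{1, -1}. \<forall>X\<in>lcosets\<^bsub>G\<^esub> H. \<forall>Y\<in>lcosets\<^bsub>G\<^esub> H.
          (if X <#>\<^bsub>G\<^esub> K = Y <#>\<^bsub>G\<^esub> K then sgn (E X Y) else \<epsilon> * sgn (E X Y)) ^ r = 1)"
    unfolding Let_def by (rule conjI)
qed

end
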